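(* Let $[a,b]\subset\mathbb{R}$ be a compact interval, $m,r\in\mathbb{N}$ (positive integers), $n\in\mathbb{N}\cup\{0\}$, $1\le p\le\infty$, let $I\subset\mathbb{R}$ be a closed interval and $\mu_0\in I$. For every $\mu\in I$ let $A_{0}(\cdot,\mu),\dots,A_{r-1}(\cdot,\mu)\in (W_p^n)^{m\times m}$ be matrix-valued functions and let $B(\mu)\colon (W_p^{n+r})^m\to\mathbb{C}^{rm}$ be a continuous linear operator. Put $$L(\mu)y:=y^{(r)}+\sum_{j=1}^{r}A_{r-j}(\cdot,\mu)\,y^{(r-j)},\qquad y\in (W_p^{n+r})^m,$$ and consider the boundary-value problem $$L(\mu)y(t,\mu)=f(t,\mu),\quad t\in(a,b),\qquad B(\mu)y(\cdot,\mu)=c(\mu),$$ with $f(\cdot,\mu)\in(W_p^n)^m$, $c(\mu)\in\mathbb{C}^{rm}$ and unknown $y(\cdot,\mu)\in(W_p^{n+r})^m$. Assume that: (0) the homogeneous problem $L(\mu_0)y=0$ on $(a,b)$, $B(\mu_0)y=0$ has only the trivial solution $y=0$ in $(W_p^{n+r})^m$; (I) $A_{r-j}(\cdot,\mu)\to A_{r-j}(\cdot,\mu_0)$ in $(W_p^n)^{m\times m}$ as $\mu\to\mu_0$ ($\mu\in I$), for each $j\in\{1,\dots,r\}$; (II) $B(\mu)y\to B(\mu_0)y$ in $\mathbb{C}^{rm}$ as $\mu\to\mu_0$ ($\mu\in I$), for every $y\in(W_p^{n+r})^m$. Then there exist positive numbers $\varepsilon,\gamma_1,\gamma_2$ such that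 for every $\mu\in I\cap(\mu_0-\varepsilon,\mu_0+\varepsilon)$ $$\gamma_1\,\widetilde d_{n,p}(\mu)\le\bigl\|y(\cdot,\mu_0)-y(\cdot,\mu)\bigr\|_{n+r,p}\le\gamma_2\,\widetilde d_{n,p}(\mu),$$ where $y(\cdot,\mu_0)$ and $y(\cdot,\mu)$ are the solutions of the problem for the parameter values $\mu_0$ and $\mu$ and $$\widetilde d_{n,p}(\mu):=\bigl\|L(\mu)y(\cdot,\mu_0)-f(\cdot,\mu)\bigr\|_{n,p}+\bigl\|B(\mu)y(\cdot,\mu_0)-c(\mu)\bigr\|_{\mathbb{C}^{rm}}.$$ Here the numbers $\varepsilon,\gamma_1,\gamma_2$ do not depend on $y(\cdot,\mu_0)$ and $y(\cdot,\mu)$ (that is, they can be chosen uniformly over all right-hand sides $f(\cdot,\mu_0),c(\mu_0),f(\cdot,\mu),c(\mu)$).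
   Context: $W_p^n:=W_p^n([a,b];\mathbb{C})$ is the complex Sobolev space on $(a,b)$ (with $W_p^0=L_p$); $(W_p^n)^m$ and $(W_p^n)^{m\times m}$ are the spaces of $\mathbb{C}^m$-valued and $\mathbb{C}^{m\times m}$-valued functions with all entries in $W_p^n$, with norm $\|\cdot\|_{n,p}$ equal to the sum of the $W_p^n$-norms of the entries. $\|\cdot\|_{\mathbb{C}^{rm}}$ is a fixed norm on $\mathbb{C}^{rm}$. A solution of the boundary-value problem for a given $\mu$ is a function $y(\cdot,\mu)\in(W_p^{n+r})^m$ satisfying the differential equation on $(a,b)$ (everywhere if $n\ge1$, almost everywhere if $n=0$) and the boundary condition. *)

theory Defs
  imports "HOL-Analysis.Analysis" "HOL-Probability.Essential_Supremum"
begin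

definition Lp_space :: "real \<Rightarrow> real \<Rightarrow> ennreal \<Rightarrow> (real \<Rightarrow> complex) set" where
  "Lp_space a b p = {f \<in> borel_measurable (lebesgue_on {a..b}).
     if p = \<infinity> then esssup (lebesgue_on {a..b}) (\<lambda>t. ereal (cmod (f t))) < \<infinity>
     else integrable (lebesgue_on {a..b}) (\<lambda>t. cmod (f t) powr enn2real p)}"

definition Lp_norm :: "real \<Rightarrow> real \<Rightarrow> ennreal \<Rightarrow> (real \<Rightarrow> complex) \<Rightarrow> real" where
  "Lp_norm a b p f =
     (if p = \<infinity> then real_of_ereal (esssup (lebesgue_on {a..b}) (\<lambda>t. ereal (cmod (f t))))
      else (\<integral>t. cmod (f t) powr enn2real p \<partial>lebesgue_on {a..b}) powr (1 / enn2real p))"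

text \<open>Test functions on the open interval: smooth on the line, with compact support
  inside it.  For complex-valued functions real-valued test functions suffice.\<close>

definition test_function :: "real \<Rightarrow> real \<Rightarrow> (real \<Rightarrow> real) \<Rightarrow> bool" where
  "test_function a b \<phi> \<longleftrightarrow>
     (\<forall>k x. (deriv ^^ k) \<phi> differentiable at x) \<and>
     (\<exists>c d. a < c \<and> c \<le> d \<and> d < b \<and> (\<forall>x. x \<notin> {c..d} \<longrightarrow> \<phi> x = 0))"

text \<open>Integrability over the whole interval, rather than local integrability, is no
  restriction here: on a bounded interval every \<open>L\<^sub>p\<close> is contained in \<open>L\<^sub>1\<close>.\<close>

definition has_weak_deriv ::
  "real \<Rightarrow> real \<Rightarrow> (real \<Rightarrow> complex) \<Rightarrow> (real \<Rightarrow> complex) \<Rightarrow> bool" where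
  "has_weak_deriv a b f g \<longleftrightarrow>
     integrable (lebesgue_on {a..b}) f \<and> integrable (lebesgue_on {a..b}) g \<and>
     (\<forall>\<phi>. test_function a b \<phi> \<longrightarrow>
        (\<integral>t. f t * of_real (deriv \<phi> t) \<partial>lebesgue_on {a..b})
          = - (\<integral>t. g t * of_real (\<phi> t) \<partial>lebesgue_on {a..b}))"

text \<open>The weak derivative is determined up to a null set only; whenever it has a
  representative that is continuous on the closed interval, that one is chosen (and is then
  unique on the closed interval).  Hence, for an element of the Sobolev space of order
  \<open>N\<close> defined below, the derivatives of order less than \<open>N\<close> are the classical ones at every point, and
  only the one of order \<open>N\<close> may be an almost everywhere defined object.\<close>

definition wderiv :: "real \<Rightarrow> real \<Rightarrow> (real \<Rightarrow> complex) \<Rightarrow> real \<Rightarrow> complex" where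
  "wderiv a b f = (SOME g. has_weak_deriv a b f g \<and>
     ((\<exists>h. has_weak_deriv a b f h \<and> continuous_on {a..b} h) \<longrightarrow> continuous_on {a..b} g))"

text \<open>An element of the Sobolev space of positive order is represented by the continuous
  function in its equivalence class.  Functions are total; their values outside the closed
  interval are irrelevant.\<close>

definition sobolev :: "real \<Rightarrow> real \<Rightarrow> ennreal \<Rightarrow> nat \<Rightarrow> (real \<Rightarrow> complex) set" where
  "sobolev a b p n = {f.
     (n > 0 \<longrightarrow> continuous_on {a..b} f) \<and>
     (\<forall>k<n. \<exists>g. has_weak_deriv a b ((wderiv a b ^^ k) f) g) \<and>
     (\<forall>k\<le>n. (wderiv a b ^^ k) f \<in> Lp_space a b p)}"

definition sobolev_norm :: "real \<Rightarrow> real \<Rightarrow> ennreal \<Rightarrow> nat \<Rightarrow> (real \<Rightarrow> complex) \<Rightarrow> real" where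
  "sobolev_norm a b p n f = (\<Sum>k\<le>n. Lp_norm a b p ((wderiv a b ^^ k) f))"

definition sobolev_vec ::
  "real \<Rightarrow> real \<Rightarrow> ennreal \<Rightarrow> nat \<Rightarrow> (real \<Rightarrow> complex ^ 'm) set" where
  "sobolev_vec a b p n = {y. \<forall>i. (\<lambda>t. y t $ i) \<in> sobolev a b p n}"

definition sobolev_vec_norm ::
  "real \<Rightarrow> real \<Rightarrow> ennreal \<Rightarrow> nat \<Rightarrow> (real \<Rightarrow> complex ^ 'm) \<Rightarrow> real" where
  "sobolev_vec_norm a b p n y = (\<Sum>i\<in>UNIV. sobolev_norm a b p n (\<lambda>t. y t $ i))"

definition sobolev_mat ::
  "real \<Rightarrow> real \<Rightarrow> ennreal \<Rightarrow> nat \<Rightarrow> (real \<Rightarrow> complex ^ 'm ^ 'm) set" where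
  "sobolev_mat a b p n = {A. \<forall>i j. (\<lambda>t. A t $ i $ j) \<in> sobolev a b p n}"

definition sobolev_mat_norm ::
  "real \<Rightarrow> real \<Rightarrow> ennreal \<Rightarrow> nat \<Rightarrow> (real \<Rightarrow> complex ^ 'm ^ 'm) \<Rightarrow> real" where
  "sobolev_mat_norm a b p n A =
     (\<Sum>i\<in>UNIV. \<Sum>j\<in>UNIV. sobolev_norm a b p n (\<lambda>t. A t $ i $ j))"

definition vec_wderiv ::
  "real \<Rightarrow> real \<Rightarrow> nat \<Rightarrow> (real \<Rightarrow> complex ^ 'm) \<Rightarrow> real \<Rightarrow> complex ^ 'm" where
  "vec_wderiv a b k y t = (\<chi> i. (wderiv a b ^^ k) (\<lambda>s. y s $ i) t)"

text \<open>The argument \<open>A\<close> lists the coefficients: \<open>A k\<close> multiplies the derivative of order \<open>k\<close>,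
  and only \<open>A 0, \<dots>, A (r - 1)\<close> are used.\<close>

definition diff_op :: "real \<Rightarrow> real \<Rightarrow> nat \<Rightarrow> (nat \<Rightarrow> real \<Rightarrow> complex ^ 'm ^ 'm) \<Rightarrow>
    (real \<Rightarrow> complex ^ 'm) \<Rightarrow> real \<Rightarrow> complex ^ 'm" where
  "diff_op a b r A y t =
     vec_wderiv a b r y t + (\<Sum>j=1..r. A (r - j) t *v vec_wderiv a b (r - j) y t)"

text \<open>Linearity over the complex numbers and continuity in the Sobolev norm.  The operator
  acts on functions; continuity forces it to ignore values outside the closed interval.\<close>

definition continuous_linear_operator :: "real \<Rightarrow> real \<Rightarrow> ennreal \<Rightarrow> nat \<Rightarrow>
    ((real \<Rightarrow> complex ^ 'm) \<Rightarrow> complex ^ 'k) \<Rightarrow> bool" where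
  "continuous_linear_operator a b p N B \<longleftrightarrow>
     (\<forall>y\<in>sobolev_vec a b p N. \<forall>z\<in>sobolev_vec a b p N. B (\<lambda>t. y t + z t) = B y + B z) \<and>
     (\<forall>y\<in>sobolev_vec a b p N. \<forall>s. B (\<lambda>t. s *s y t) = s *s B y) \<and>
     (\<forall>y\<in>sobolev_vec a b p N. \<forall>e>0. \<exists>d>0. \<forall>z\<in>sobolev_vec a b p N.
        sobolev_vec_norm a b p N (\<lambda>t. z t - y t) < d \<longrightarrow> norm (B z - B y) < e)"

definition bvp_solution :: "real \<Rightarrow> real \<Rightarrow> ennreal \<Rightarrow> nat \<Rightarrow> nat \<Rightarrow>
    (nat \<Rightarrow> real \<Rightarrow> complex ^ 'm ^ 'm) \<Rightarrow> ((real \<Rightarrow> complex ^ 'm) \<Rightarrow> complex ^ 'k) \<Rightarrow>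
    (real \<Rightarrow> complex ^ 'm) \<Rightarrow> complex ^ 'k \<Rightarrow> (real \<Rightarrow> complex ^ 'm) \<Rightarrow> bool" where
  "bvp_solution a b p n r A B f c y \<longleftrightarrow>
     y \<in> sobolev_vec a b p (n + r) \<and>
     (if n = 0 then AE t in lebesgue_on {a<..<b}. diff_op a b r A y t = f t
      else \<forall>t\<in>{a<..<b}. diff_op a b r A y t = f t) \<and>
     B y = c"

text \<open>Norms over the complex field, that is, homogeneous for complex scalars.\<close>

definition is_norm :: "(complex ^ 'k \<Rightarrow> real) \<Rightarrow> bool" where
  "is_norm N \<longleftrightarrow>
     (\<forall>x. N x \<ge> 0) \<and> (\<forall>x. N x = 0 \<longleftrightarrow> x = 0) \<and>
     (\<forall>s x. N (s *s x) = cmod s * N x) \<and> (\<forall>x y. N (x + y) \<le> N x + N y)"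

end

(* The difference w = y(., mu0) - y(., mu) satisfies L(mu) w = L(mu) y(., mu0) - f(., mu) and
   B(mu) w = B(mu) y(., mu0) - c(mu). Hence the theorem says that the operators (L(mu), B(mu)) are
   bounded and bounded below, uniformly for mu near mu0.

   Boundedness follows from the product estimate in W_p^n and the principle of uniform boundedness.
   If the lower bound failed, there would be mu_k -> mu0 and w_k of norm 1 with L(mu_k) w_k -> 0 and
   B(mu_k) w_k -> 0, hence also L(mu0) w_k -> 0. By Gronwall's inequality the norm of a function w is
   controlled by its finitely many initial values at a and the norm of L(mu0) w. Passing to a
   subsequence with convergent initial values one obtains a limit of norm 1 that solves the
   homogeneous problem at mu0, a contradiction; no existence theory for the differential equation is
   needed. Weak derivatives are reduced to indefinite integrals by the lemma of du Bois-Reymond. *)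

theory Submission
  imports Defs
begin

section \<open>Lebesgue spaces on a compact interval\<close>

locale sobolev_interval =
  fixes a b :: real and p :: ennreal
  assumes ab: "a < b" and p_ge_1: "1 \<le> p"
begin

abbreviation S :: "real measure" where "S \<equiv> lebesgue_on {a..b}"
abbreviation q :: real where "q \<equiv> enn2real p"
abbreviation L :: "(real \<Rightarrow> complex) set" where "L \<equiv> Lp_space a b p"
abbreviation nrm :: "(real \<Rightarrow> complex) \<Rightarrow> real" where "nrm \<equiv> Lp_norm a b p"

text \<open>Membership in \<open>L\<^sub>p\<close> together with a bound for the norm, free of the roots and extended reals
  in the definition of the norm.\<close>

definition Lp_bound :: "(real \<Rightarrow> complex) \<Rightarrow> real \<Rightarrow> bool" where
  "Lp_bound f K \<longleftrightarrow> f \<in> borel_measurable S \<and> 0 \<le> K \<and>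
     (if p = \<infinity> then AE t in S. cmod (f t) \<le> K
      else (\<integral>\<^sup>+t. ennreal (cmod (f t) powr q) \<partial>S) \<le> ennreal (K powr q))"

lemma Lp_bound_top: "p = \<infinity> \<Longrightarrow>
    Lp_bound f K \<longleftrightarrow> f \<in> borel_measurable S \<and> 0 \<le> K \<and> (AE t in S. cmod (f t) \<le> K)"
  unfolding Lp_bound_def by simp

lemma q_ge_1: "p \<noteq> \<infinity> \<Longrightarrow> 1 \<le> q"
  using p_ge_1 by (metis enn2real_1 enn2real_mono infinity_ennreal_def top.not_eq_extremum)

lemma emeasure_S: "emeasure S (space S) = ennreal (b - a)"
  using ab by (simp add: emeasure_restrict_space space_restrict_space)

lemma finite_measure_S: "finite_measure S"
  by (rule finite_measureI) (use emeasure_S in simp)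

sublocale S: finite_measure S by (rule finite_measure_S)

lemma measure_S: "measure S (space S) = b - a"
  using emeasure_S ab by (simp add: measure_def)

lemma space_S [simp]: "space S = {a..b}" by (simp add: space_restrict_space)

lemma nonnull_S: "emeasure S (space S) \<noteq> 0"
  using ab emeasure_S by simp

lemma AE_S_False: "AE t in S. False \<Longrightarrow> False"
  using nonnull_S ae_filter_eq_bot_iff[of S] by (simp add: trivial_limit_def)

lemma esssup_norm_nonneg:
  assumes "f \<in> borel_measurable S"
  shows "0 \<le> esssup S (\<lambda>t. ereal (cmod (f t)))"
proof -
  have "esssup S (\<lambda>t. 0::ereal) \<le> esssup S (\<lambda>t. ereal (cmod (f t)))"
    by (rule esssup_mono) auto
  then show ?thesis using esssup_const[OF nonnull_S, of "0::ereal"] by simp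
qed

lemma Lp_norm_nonneg: "f \<in> L \<Longrightarrow> 0 \<le> nrm f"
  using esssup_norm_nonneg[of f]
  by (auto simp: Lp_norm_def Lp_space_def real_of_ereal_pos)

lemma Lp_bound_iff: "Lp_bound f K \<longleftrightarrow> f \<in> L \<and> nrm f \<le> K"
proof (cases "p = \<infinity>")
  case True
  show ?thesis
  proof
    assume B: "Lp_bound f K"
    then have f: "f \<in> borel_measurable S" and K: "AE t in S. ereal (cmod (f t)) \<le> ereal K"
      unfolding Lp_bound_top[OF True] by auto
    have "esssup S (\<lambda>t. ereal (cmod (f t))) \<le> ereal K"
      by (rule esssup_I) (use f K in auto)
    then show "f \<in> L \<and> nrm f \<le> K"
      using f True esssup_norm_nonneg[OF f]
      by (cases "esssup S (\<lambda>t. ereal (cmod (f t)))") (auto simp: Lp_space_def Lp_norm_def)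
  next
    assume F: "f \<in> L \<and> nrm f \<le> K"
    then have f: "f \<in> borel_measurable S" and fin: "esssup S (\<lambda>t. ereal (cmod (f t))) < \<infinity>"
      and le: "real_of_ereal (esssup S (\<lambda>t. ereal (cmod (f t)))) \<le> K"
      using True by (auto simp: Lp_space_def Lp_norm_def)
    have "0 \<le> K" using Lp_norm_nonneg F by force
    moreover have "AE t in S. cmod (f t) \<le> K"
      using esssup_AE[where M=S and f="\<lambda>t. ereal (cmod (f t))"]
    proof eventually_elim
      case (elim t)
      then show ?case using fin le esssup_norm_nonneg[OF f]
        by (cases "esssup S (\<lambda>t. ereal (cmod (f t)))") auto
    qed
    ultimately show "Lp_bound f K" using f unfolding Lp_bound_top[OF True] by simp
  qed
next
  case False
  note q = q_ge_1[OF False]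
  show ?thesis
  proof
    assume B: "Lp_bound f K"
    then have f[measurable]: "f \<in> borel_measurable S" and K0: "0 \<le> K"
      and K: "(\<integral>\<^sup>+t. ennreal (cmod (f t) powr q) \<partial>S) \<le> ennreal (K powr q)"
      using False by (auto simp: Lp_bound_def)
    have int: "integrable S (\<lambda>t. cmod (f t) powr q)"
      by (rule integrableI_nonneg) (use K in \<open>auto intro: le_less_trans\<close>)
    have "(\<integral>t. cmod (f t) powr q \<partial>S) \<le> K powr q"
      using K nn_integral_eq_integral[OF int] by simp
    then have "(\<integral>t. cmod (f t) powr q \<partial>S) powr (1/q) \<le> (K powr q) powr (1/q)"
      using q by (intro powr_mono2) (auto intro: integral_nonneg_AE)
    also have "\<dots> = K" using q K0 by (simp add: powr_powr)
    finally show "f \<in> L \<and> nrm f \<le> K"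
      using f int False by (auto simp: Lp_space_def Lp_norm_def)
  next
    assume F: "f \<in> L \<and> nrm f \<le> K"
    then have f: "f \<in> borel_measurable S" and int: "integrable S (\<lambda>t. cmod (f t) powr q)"
      and le: "(\<integral>t. cmod (f t) powr q \<partial>S) powr (1/q) \<le> K"
      using False by (auto simp: Lp_space_def Lp_norm_def)
    have "(\<integral>t. cmod (f t) powr q \<partial>S) = ((\<integral>t. cmod (f t) powr q \<partial>S) powr (1/q)) powr q"
      using q by (simp add: powr_powr)
    also have "\<dots> \<le> K powr q" using le q by (intro powr_mono2) auto
    finally have "(\<integral>\<^sup>+t. ennreal (cmod (f t) powr q) \<partial>S) \<le> ennreal (K powr q)"
      using nn_integral_eq_integral[OF int] by simp
    moreover have "0 \<le> K" using Lp_norm_nonneg F by force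
    ultimately show "Lp_bound f K" using f False by (simp add: Lp_bound_def)
  qed
qed

lemma Lp_bound_norm: "f \<in> L \<Longrightarrow> Lp_bound f (nrm f)"
  by (simp add: Lp_bound_iff)

lemma Lp_bound_mono: "Lp_bound f K \<Longrightarrow> K \<le> K' \<Longrightarrow> Lp_bound f K'"
  by (auto simp: Lp_bound_iff)

lemma Lp_bound_dominated:
  assumes B: "Lp_bound g K" and f: "f \<in> borel_measurable S"
    and le: "AE t in S. cmod (f t) \<le> cmod (g t)"
  shows "Lp_bound f K"
proof (cases "p = \<infinity>")
  case True
  have "AE t in S. cmod (g t) \<le> K" using B unfolding Lp_bound_top[OF True] by simp
  with le have "AE t in S. cmod (f t) \<le> K" by eventually_elim simp
  then show ?thesis using B f unfolding Lp_bound_top[OF True] by simp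
next
  case False
  have "(\<integral>\<^sup>+t. ennreal (cmod (f t) powr q) \<partial>S) \<le> (\<integral>\<^sup>+t. ennreal (cmod (g t) powr q) \<partial>S)"
    using le by (intro nn_integral_mono_AE)
      (auto elim!: eventually_mono intro!: ennreal_leI powr_mono2)
  then show ?thesis using B f False by (auto simp: Lp_bound_def intro: order_trans)
qed

lemma Lp_bound_cmult:
  assumes B: "Lp_bound f K"
  shows "Lp_bound (\<lambda>t. c * f t) (cmod c * K)"
proof (cases "p = \<infinity>")
  case True
  have "AE t in S. cmod (f t) \<le> K" using B unfolding Lp_bound_top[OF True] by simp
  then have "AE t in S. cmod (c * f t) \<le> cmod c * K"
    by eventually_elim (auto simp: norm_mult intro: mult_left_mono)
  then show ?thesis using B unfolding Lp_bound_top[OF True] by auto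
next
  case False
  have [measurable]: "f \<in> borel_measurable S" using B by (simp add: Lp_bound_def)
  have "(\<integral>\<^sup>+t. ennreal (cmod (c * f t) powr q) \<partial>S)
      = (\<integral>\<^sup>+t. ennreal (cmod c powr q) * ennreal (cmod (f t) powr q) \<partial>S)"
    by (simp add: norm_mult powr_mult ennreal_mult)
  also have "\<dots> = ennreal (cmod c powr q) * (\<integral>\<^sup>+t. ennreal (cmod (f t) powr q) \<partial>S)"
    by (rule nn_integral_cmult) measurable
  also have "\<dots> \<le> ennreal (cmod c powr q) * ennreal (K powr q)"
    using B False by (intro mult_left_mono) (auto simp: Lp_bound_def)
  also have "\<dots> = ennreal ((cmod c * K) powr q)"
    using B by (simp add: powr_mult ennreal_mult Lp_bound_def)
  finally show ?thesis using B False by (simp add: Lp_bound_def)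
qed

lemma powr_convex_combination:
  fixes x y u :: real
  assumes "1 \<le> r" "0 \<le> x" "0 \<le> y" "0 < u" "u < 1"
  shows "(u * x + (1 - u) * y) powr r \<le> u * x powr r + (1 - u) * y powr r"
proof -
  have le: "s powr r \<le> s" if "0 < s" "s < 1" for s :: real
    using powr_mono'[of 1 r s] that assms(1) by simp
  show ?thesis
  proof (cases "x = 0 \<or> y = 0")
    case True
    then show ?thesis
      using assms le[of u] le[of "1 - u"]
      by (auto simp: powr_mult intro!: mult_right_mono)
  next
    case False
    then show ?thesis
      using convex_onD[OF powr_convex[OF assms(1)], of "1 - u" x y] assms by simp
  qed
qed

text \<open>Minkowski's inequality: normalise by the bounds and use convexity of the power.\<close>

lemma Lp_bound_add:
  assumes f: "Lp_bound f K" and g: "Lp_bound g M"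
  shows "Lp_bound (\<lambda>t. f t + g t) (K + M)"
proof -
  have pos: "Lp_bound (\<lambda>t. f t + g t) (K + M)"
    if f: "Lp_bound f K" and g: "Lp_bound g M" and K: "0 < K" and M: "0 < M" for K M
  proof (cases "p = \<infinity>")
    case True
    have "AE t in S. cmod (f t) \<le> K" "AE t in S. cmod (g t) \<le> M"
      using f g unfolding Lp_bound_top[OF True] by auto
    then have "AE t in S. cmod (f t + g t) \<le> K + M"
      by eventually_elim (meson norm_triangle_mono)
    then show ?thesis using f g unfolding Lp_bound_top[OF True] by auto
  next
    case False
    note q = q_ge_1[OF False]
    have [measurable]: "f \<in> borel_measurable S" "g \<in> borel_measurable S"
      using f g by (auto simp: Lp_bound_def)
    define u where "u = K / (K + M)"
    have u: "0 < u" "u < 1" "1 - u = M / (K + M)"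
      using K M by (auto simp: u_def field_simps)
    have pw: "cmod (f t + g t) powr q \<le> (u * (K + M) powr q / K powr q) * cmod (f t) powr q
        + ((1 - u) * (K + M) powr q / M powr q) * cmod (g t) powr q" for t
    proof -
      have "cmod (f t + g t) \<le> cmod (f t) + cmod (g t)" by (rule norm_triangle_ineq)
      also have "\<dots> = (K + M) * (u * (cmod (f t) / K) + (1 - u) * (cmod (g t) / M))"
      proof -
        have "(K + M) * u = K" "(K + M) * (1 - u) = M" using K M u(3) by (auto simp: u_def)
        then show ?thesis using K M
          by (simp add: distrib_left flip: mult.assoc)
      qed
      finally have "cmod (f t + g t) powr q
          \<le> ((K + M) * (u * (cmod (f t) / K) + (1 - u) * (cmod (g t) / M))) powr q"
        using q by (intro powr_mono2) auto
      also have "\<dots> = (K + M) powr q * (u * (cmod (f t) / K) + (1 - u) * (cmod (g t) / M)) powr q"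
        by (rule powr_mult)
      also have "\<dots> \<le> (K + M) powr q * (u * (cmod (f t) / K) powr q + (1 - u) * (cmod (g t) / M) powr q)"
        using q u K M by (intro mult_left_mono powr_convex_combination) auto
      finally show ?thesis using K M by (simp add: powr_divide field_simps)
    qed
    define U V where "U = u * (K + M) powr q / K powr q" and "V = (1 - u) * (K + M) powr q / M powr q"
    have UV: "0 \<le> U" "0 \<le> V" "U * K powr q + V * M powr q = (K + M) powr q"
      using u K M by (auto simp: U_def V_def field_simps)
    have "(\<integral>\<^sup>+t. ennreal (cmod (f t + g t) powr q) \<partial>S)
       \<le> (\<integral>\<^sup>+t. ennreal U * ennreal (cmod (f t) powr q) + ennreal V * ennreal (cmod (g t) powr q) \<partial>S)"
    proof (intro nn_integral_mono)
      fix t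
      have "ennreal (cmod (f t + g t) powr q) \<le> ennreal (U * cmod (f t) powr q + V * cmod (g t) powr q)"
        using pw[of t] unfolding U_def V_def by (rule ennreal_leI)
      then show "ennreal (cmod (f t + g t) powr q)
          \<le> ennreal U * ennreal (cmod (f t) powr q) + ennreal V * ennreal (cmod (g t) powr q)"
        using UV(1,2) by (simp add: ennreal_mult)
    qed
    also have "\<dots> = ennreal U * (\<integral>\<^sup>+t. ennreal (cmod (f t) powr q) \<partial>S)
        + ennreal V * (\<integral>\<^sup>+t. ennreal (cmod (g t) powr q) \<partial>S)"
      by (simp add: nn_integral_add nn_integral_cmult)
    also have "\<dots> \<le> ennreal U * ennreal (K powr q) + ennreal V * ennreal (M powr q)"
      using f g False by (intro add_mono mult_left_mono) (auto simp: Lp_bound_def)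
    also have "\<dots> = ennreal ((K + M) powr q)"
      using UV by (simp flip: ennreal_mult ennreal_plus)
    finally show ?thesis using f g False by (simp add: Lp_bound_def)
  qed
  have nn: "0 \<le> K" "0 \<le> M" using f g by (auto simp: Lp_bound_def)
  have "Lp_bound (\<lambda>t. f t + g t) (K + M + e)" if "0 < e" for e
    using pos[of "K + e/2" "M + e/2"] Lp_bound_mono[OF f, of "K+e/2"] Lp_bound_mono[OF g, of "M+e/2"] that nn
    by (simp add: algebra_simps)
  then have "f' \<in> L \<and> (\<forall>e>0. nrm f' \<le> K + M + e)" if "f' = (\<lambda>t. f t + g t)" for f'
    using that unfolding Lp_bound_iff by (meson zero_less_one)
  then show ?thesis unfolding Lp_bound_iff by (auto intro: field_le_epsilon)
qed

lemma Lp_bound_lim: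
  assumes B: "\<And>k. Lp_bound (u k) K" and f: "f \<in> borel_measurable S"
    and lim: "AE t in S. (\<lambda>k. u k t) \<longlonglongrightarrow> f t"
  shows "Lp_bound f K"
proof (cases "p = \<infinity>")
  case True
  have "AE t in S. \<forall>k. cmod (u k t) \<le> K"
    using B unfolding Lp_bound_top[OF True] by (subst AE_all_countable) auto
  with lim have "AE t in S. cmod (f t) \<le> K"
    by eventually_elim (rule LIMSEQ_le_const2[OF tendsto_norm], auto)
  then show ?thesis using B[of 0] f unfolding Lp_bound_top[OF True] by simp
next
  case False
  note q = q_ge_1[OF False]
  have [measurable]: "u k \<in> borel_measurable S" for k using B[of k] by (simp add: Lp_bound_def)
  have "(\<integral>\<^sup>+t. ennreal (cmod (f t) powr q) \<partial>S)
      = (\<integral>\<^sup>+t. liminf (\<lambda>k. ennreal (cmod (u k t) powr q)) \<partial>S)"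
  proof (rule nn_integral_cong_AE)
    show "AE t in S. ennreal (cmod (f t) powr q) = liminf (\<lambda>k. ennreal (cmod (u k t) powr q))"
      using lim
    proof eventually_elim
      case (elim t)
      have "(\<lambda>k. cmod (u k t) powr q) \<longlonglongrightarrow> cmod (f t) powr q"
        by (rule tendsto_powr2) (use elim q in \<open>auto intro: tendsto_norm\<close>)
      then have "(\<lambda>k. ennreal (cmod (u k t) powr q)) \<longlonglongrightarrow> ennreal (cmod (f t) powr q)"
        by (rule tendsto_ennrealI)
      then show ?case using lim_imp_Liminf[OF sequentially_bot] by metis
    qed
  qed
  also have "\<dots> \<le> liminf (\<lambda>k. \<integral>\<^sup>+t. ennreal (cmod (u k t) powr q) \<partial>S)"
    by (rule nn_integral_liminf) measurable
  also have "\<dots> \<le> liminf (\<lambda>k. ennreal (K powr q))"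
    using B False by (intro Liminf_mono always_eventually) (auto simp: Lp_bound_def)
  finally show ?thesis using B f False by (simp add: Lp_bound_def Liminf_const)
qed

lemma Lp_bound_const: "\<exists>C>0. \<forall>f M. f \<in> borel_measurable S \<longrightarrow> 0 \<le> M \<longrightarrow>
    (AE t in S. cmod (f t) \<le> M) \<longrightarrow> Lp_bound f (C * M)"
proof -
  have "\<exists>C>0. Lp_bound (\<lambda>t. 1) C"
  proof (cases "p = \<infinity>")
    case True
    show ?thesis unfolding Lp_bound_top[OF True] by (intro exI[of _ 1]) simp
  next
    case False
    note q = q_ge_1[OF False]
    show ?thesis
      using False q ab emeasure_S
      by (intro exI[of _ "(b - a) powr (1/q)"]) (auto simp: Lp_bound_def powr_powr)
  qed
  then obtain C where C: "C > 0" "Lp_bound (\<lambda>t. 1) C" by blast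
  show ?thesis
  proof (intro exI conjI allI impI)
    fix f M assume f: "f \<in> borel_measurable S" and M: "0 \<le> M" "AE t in S. cmod (f t) \<le> M"
    have "Lp_bound (\<lambda>t. of_real M * 1) (cmod (of_real M) * C)"
      by (rule Lp_bound_cmult[OF C(2)])
    then show "Lp_bound f (C * M)"
      using Lp_bound_dominated[of "\<lambda>t. of_real M" "C * M" f] f M by (simp add: mult.commute)
  qed (use C in auto)
qed

lemma Lp_bound_L1:
  assumes B: "Lp_bound f K"
  shows "integrable S f" and "(\<integral>t. cmod (f t) \<partial>S) \<le> (b - a + 1) * K"
proof -
  have [measurable]: "f \<in> borel_measurable S" using B by (simp add: Lp_bound_def)
  have main: "(\<integral>\<^sup>+t. ennreal (cmod (f t)) \<partial>S) \<le> ennreal ((b - a + 1) * M)"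
    if B: "Lp_bound f M" and M: "0 < M" for M
  proof (cases "p = \<infinity>")
    case True
    have "AE t in S. ennreal (cmod (f t)) \<le> ennreal M"
      using B by (auto simp: Lp_bound_top[OF True] elim!: eventually_mono intro: ennreal_leI)
    then have "(\<integral>\<^sup>+t. ennreal (cmod (f t)) \<partial>S) \<le> (\<integral>\<^sup>+t. ennreal M \<partial>S)"
      by (rule nn_integral_mono_AE)
    also have "\<dots> = ennreal M * ennreal (b - a)" by (simp add: emeasure_S[simplified])
    also have "\<dots> \<le> ennreal ((b - a + 1) * M)"
      using ab M by (simp flip: ennreal_mult add: algebra_simps ennreal_leI)
    finally show ?thesis .
  next
    case False
    note q = q_ge_1[OF False]
    have le: "x \<le> M * (1 + x powr q / M powr q)" if "0 \<le> x" for x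
    proof (cases "x \<le> M")
      case True
      then show ?thesis using M by (simp add: algebra_simps add_increasing2)
    next
      case False
      then have "x / M \<le> (x / M) powr q" using powr_mono[of 1 q "x/M"] q M by simp
      then show ?thesis using M False by (simp add: powr_divide field_simps add_increasing)
    qed
    have "(\<integral>\<^sup>+t. ennreal (cmod (f t)) \<partial>S)
        \<le> (\<integral>\<^sup>+t. ennreal M + ennreal (M / M powr q) * ennreal (cmod (f t) powr q) \<partial>S)"
      using le M by (intro nn_integral_mono)
        (simp flip: ennreal_mult ennreal_plus add: algebra_simps del: ennreal_plus)
    also have "\<dots> = ennreal M * ennreal (b - a)
        + ennreal (M / M powr q) * (\<integral>\<^sup>+t. ennreal (cmod (f t) powr q) \<partial>S)"
      by (simp add: nn_integral_add nn_integral_cmult emeasure_S[simplified])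
    also have "\<dots> \<le> ennreal M * ennreal (b - a) + ennreal (M / M powr q) * ennreal (M powr q)"
      using B False by (intro add_mono mult_left_mono) (auto simp: Lp_bound_def)
    also have "\<dots> = ennreal ((b - a + 1) * M)"
      using M ab by (simp flip: ennreal_mult ennreal_plus add: algebra_simps)
    finally show ?thesis .
  qed
  have K: "0 \<le> K" using B by (simp add: Lp_bound_def)
  then have e: "(\<integral>\<^sup>+t. ennreal (cmod (f t)) \<partial>S) \<le> ennreal ((b - a + 1) * (K + e))" if "0 < e" for e
    using main[OF Lp_bound_mono[OF B, of "K + e"]] that by simp
  show int: "integrable S f"
    by (rule integrableI_bounded) (use e[of 1] in \<open>auto intro: le_less_trans\<close>)
  have "(\<integral>t. cmod (f t) \<partial>S) \<le> (b - a + 1) * (K + e)" if "0 < e" for e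
    using e[OF that] nn_integral_eq_integral[OF integrable_norm[OF int]] ab K that by simp
  then have "(\<integral>t. cmod (f t) \<partial>S) / (b - a + 1) \<le> K + e" if "0 < e" for e
    using that ab by (simp add: pos_divide_le_eq mult.commute)
  then have "(\<integral>t. cmod (f t) \<partial>S) / (b - a + 1) \<le> K" by (rule field_le_epsilon)
  then show "(\<integral>t. cmod (f t) \<partial>S) \<le> (b - a + 1) * K" using ab by (simp add: field_simps)
qed

lemma measurable_S_AE:
  assumes f: "f \<in> borel_measurable S" and ae: "AE t in S. f t = (g t :: complex)"
  shows "g \<in> borel_measurable S"
proof -
  have "(\<lambda>t. indicator {a..b} t *\<^sub>R f t) \<in> borel_measurable lebesgue"
    using f by (simp add: borel_measurable_restrict_space_iff)
  moreover have "AE t in lebesgue. indicator {a..b} t *\<^sub>R f t = indicator {a..b} t *\<^sub>R g t"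
    using ae by (subst (asm) AE_restrict_space_iff) (auto elim!: eventually_mono simp: indicator_def)
  ultimately have "(\<lambda>t. indicator {a..b} t *\<^sub>R g t) \<in> borel_measurable lebesgue"
    by (rule borel_measurable_AE)
  then show ?thesis by (simp add: borel_measurable_restrict_space_iff)
qed

lemma Lp_measurable: "f \<in> L \<Longrightarrow> f \<in> borel_measurable S"
  by (simp add: Lp_space_def)

lemma Lp_integrable: "f \<in> L \<Longrightarrow> integrable S f"
  using Lp_bound_L1(1)[OF Lp_bound_norm] .

lemma Lp_L1: "f \<in> L \<Longrightarrow> (\<integral>t. cmod (f t) \<partial>S) \<le> (b - a + 1) * nrm f"
  using Lp_bound_L1(2)[OF Lp_bound_norm] .

lemma Lp_cong_AE:
  assumes "f \<in> L" "AE t in S. f t = g t"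
  shows "g \<in> L" "nrm g = nrm f"
proof -
  have f: "f \<in> borel_measurable S" by (rule Lp_measurable[OF assms(1)])
  have g: "g \<in> borel_measurable S" by (rule measurable_S_AE[OF f assms(2)])
  have "Lp_bound g (nrm f)"
    by (rule Lp_bound_dominated[OF Lp_bound_norm[OF assms(1)] g]) (use assms(2) in auto)
  then have G: "g \<in> L" and le: "nrm g \<le> nrm f" by (auto simp: Lp_bound_iff)
  have "Lp_bound f (nrm g)"
    by (rule Lp_bound_dominated[OF Lp_bound_norm[OF G] f]) (use assms(2) in auto)
  with G le show "g \<in> L" "nrm g = nrm f" by (auto simp: Lp_bound_iff)
qed

lemma Lp_add:
  assumes "f \<in> L" "g \<in> L"
  shows "(\<lambda>t. f t + g t) \<in> L" "nrm (\<lambda>t. f t + g t) \<le> nrm f + nrm g"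
  using Lp_bound_add[OF Lp_bound_norm[OF assms(1)] Lp_bound_norm[OF assms(2)]]
  by (auto simp: Lp_bound_iff)

lemma Lp_cmult:
  assumes "f \<in> L"
  shows "(\<lambda>t. c * f t) \<in> L" "nrm (\<lambda>t. c * f t) \<le> cmod c * nrm f"
  using Lp_bound_cmult[OF Lp_bound_norm[OF assms], of c] by (auto simp: Lp_bound_iff)

lemma Lp_zero: "(\<lambda>t. 0) \<in> L" "nrm (\<lambda>t. 0) = 0"
proof -
  obtain C where "C > 0" and C: "\<And>f M. f \<in> borel_measurable S \<Longrightarrow> 0 \<le> M \<Longrightarrow>
      (AE t in S. cmod (f t) \<le> M) \<Longrightarrow> Lp_bound f (C * M)" using Lp_bound_const by blast
  show "(\<lambda>t. 0) \<in> L" "nrm (\<lambda>t. 0) = 0"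
    using C[of "\<lambda>t. 0" 0] Lp_norm_nonneg[of "\<lambda>t. 0"] by (auto simp: Lp_bound_iff)
qed

lemma Lp_norm_eq_0_AE:
  assumes "f \<in> L" "nrm f = 0"
  shows "AE t in S. f t = 0"
proof -
  have "(\<integral>t. cmod (f t) \<partial>S) = 0"
    using Lp_L1[OF assms(1)] assms(2) by (simp add: order_antisym)
  then show ?thesis
    using integral_nonneg_eq_0_iff_AE[of S "\<lambda>t. cmod (f t)"] Lp_integrable[OF assms(1)] by simp
qed

lemma Lp_bounded_mult:
  assumes f: "f \<in> L" and u: "u \<in> borel_measurable S" and M: "AE t in S. cmod (u t) \<le> M"
  shows "(\<lambda>t. u t * f t) \<in> L" "nrm (\<lambda>t. u t * f t) \<le> M * nrm f"
proof -
  have M0: "0 \<le> M"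
  proof (rule ccontr)
    assume "\<not> 0 \<le> M"
    then have "AE t in S. False"
      using M by (auto elim!: eventually_mono) (meson norm_ge_zero order_trans)
    then show False by (rule AE_S_False)
  qed
  have "Lp_bound (\<lambda>t. of_real M * f t) (cmod (of_real M) * nrm f)"
    by (rule Lp_bound_cmult[OF Lp_bound_norm[OF f]])
  then have "Lp_bound (\<lambda>t. u t * f t) (cmod (of_real M) * nrm f)"
    by (rule Lp_bound_dominated) (use M M0 u Lp_measurable[OF f] in
        \<open>auto elim!: eventually_mono simp: norm_mult intro: mult_right_mono\<close>)
  then show "(\<lambda>t. u t * f t) \<in> L" "nrm (\<lambda>t. u t * f t) \<le> M * nrm f"
    using M0 by (auto simp: Lp_bound_iff)
qed

lemma Lp_complete:
  assumes u: "\<And>k. u k \<in> L"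
    and C: "\<And>e. e > 0 \<Longrightarrow> \<exists>N. \<forall>i\<ge>N. \<forall>j\<ge>N. nrm (\<lambda>t. u i t - u j t) < e"
  obtains f where "f \<in> L" "(\<lambda>k. nrm (\<lambda>t. u k t - f t)) \<longlonglongrightarrow> 0"
proof -
  have dL: "(\<lambda>t. u i t - u j t) \<in> L" for i j
    using Lp_add(1)[OF u[of i] Lp_cmult(1)[OF u[of j], of "-1"]] by simp
  have [measurable]: "u k \<in> borel_measurable S" for k by (rule Lp_measurable[OF u])
  have L1: "\<exists>N. \<forall>i\<ge>N. \<forall>j\<ge>N. (LINT t|S. norm (u i t - u j t)) < e" if "e > 0" for e :: real
  proof -
    obtain N where N: "\<And>i j. i \<ge> N \<Longrightarrow> j \<ge> N \<Longrightarrow> nrm (\<lambda>t. u i t - u j t) < e / (b - a + 1)"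
      using C[of "e / (b - a + 1)"] ab \<open>e > 0\<close> by auto
    have "(LINT t|S. norm (u i t - u j t)) < e" if "i \<ge> N" "j \<ge> N" for i j
      using Lp_L1[OF dL[of i j]] N[OF that] ab by (simp add: field_simps)
    then show ?thesis by blast
  qed
  obtain r :: "nat \<Rightarrow> nat" where r: "strict_mono r" "AE t in S. Cauchy (\<lambda>i. u (r i) t)"
    using cauchy_L1_AE_cauchy_subseq[of S u, OF Lp_integrable[OF u] L1] by blast
  define f where "f t = lim (\<lambda>i. u (r i) t)" for t
  have f[measurable]: "f \<in> borel_measurable S" unfolding f_def by measurable
  have lim: "AE t in S. (\<lambda>i. u (r i) t) \<longlonglongrightarrow> f t"
    using r(2) by eventually_elim (simp add: f_def Cauchy_convergent convergent_LIMSEQ_iff[symmetric])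
  have bound: "\<exists>N. \<forall>k\<ge>N. Lp_bound (\<lambda>t. u k t - f t) e" if "e > 0" for e
  proof -
    obtain N where N: "\<And>i j. i \<ge> N \<Longrightarrow> j \<ge> N \<Longrightarrow> nrm (\<lambda>t. u i t - u j t) < e"
      using C[OF \<open>e > 0\<close>] by blast
    have "Lp_bound (\<lambda>t. u k t - f t) e" if k: "k \<ge> N" for k
    proof (rule Lp_bound_lim)
      show "Lp_bound (\<lambda>t. u k t - u (r (i + N)) t) e" for i
        using N[OF k, of "r (i + N)"] dL seq_suble[OF r(1), of "i + N"]
        by (auto simp: Lp_bound_iff)
      show "AE t in S. (\<lambda>i. u k t - u (r (i + N)) t) \<longlonglongrightarrow> u k t - f t"
        using lim by eventually_elim (intro tendsto_intros LIMSEQ_ignore_initial_segment)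
    qed measurable
    then show ?thesis by blast
  qed
  obtain N where "Lp_bound (\<lambda>t. u N t - f t) 1" using bound[of 1] by auto
  then have "f \<in> L"
    using Lp_add(1)[OF u[of N] Lp_cmult(1)[of "\<lambda>t. u N t - f t" "-1"]] by (simp add: Lp_bound_iff)
  moreover have "(\<lambda>k. nrm (\<lambda>t. u k t - f t)) \<longlonglongrightarrow> 0"
  proof (rule LIMSEQ_I)
    fix e :: real assume "e > 0"
    then obtain N where N: "\<forall>k\<ge>N. Lp_bound (\<lambda>t. u k t - f t) (e/2)" using bound[of "e/2"] by auto
    have "norm (nrm (\<lambda>t. u k t - f t) - 0) < e" if "k \<ge> N" for k
      using N that \<open>e > 0\<close> Lp_norm_nonneg[of "\<lambda>t. u k t - f t"] by (auto simp: Lp_bound_iff)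
    then show "\<exists>N. \<forall>k\<ge>N. norm (nrm (\<lambda>t. u k t - f t) - 0) < e" by blast
  qed
  ultimately show ?thesis by (rule that)
qed

end

section \<open>Test functions and the lemma of du Bois-Reymond\<close>

primrec kdiff :: "nat \<Rightarrow> (real \<Rightarrow> real) \<Rightarrow> bool" where
  "kdiff 0 f = True"
| "kdiff (Suc k) f = ((\<forall>x. f differentiable at x) \<and> kdiff k (deriv f))"

lemma kdiff_iff: "kdiff k f \<longleftrightarrow> (\<forall>j<k. \<forall>x. (deriv ^^ j) f differentiable at x)"
proof (induction k arbitrary: f)
  case (Suc k)
  have "(\<forall>j<Suc k. \<forall>x. (deriv ^^ j) f differentiable at x) \<longleftrightarrow>
      (\<forall>x. f differentiable at x) \<and> (\<forall>j<k. \<forall>x. (deriv ^^ j) (deriv f) differentiable at x)"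
    by (auto simp: All_less_Suc2 funpow_swap1)
  then show ?case using Suc by simp
qed simp

lemma kdiff_SucI:
  assumes "\<And>x. (f has_real_derivative f' x) (at x)" "kdiff k f'"
  shows "kdiff (Suc k) f"
proof -
  have "deriv f = f'" using assms(1) by (auto intro: DERIV_imp_deriv)
  then show ?thesis using assms by (auto simp: real_differentiable_def)
qed

lemma kdiff_SucD: "kdiff (Suc k) f \<Longrightarrow> kdiff k f"
  by (auto simp: kdiff_iff)

lemma kdiff_const: "kdiff k (\<lambda>x. c)"
proof (induction k arbitrary: c)
  case (Suc k)
  then show ?case by (intro kdiff_SucI[of _ "\<lambda>x. 0"]) auto
qed simp

lemma kdiff_DERIV: "kdiff (Suc k) f \<Longrightarrow> (f has_real_derivative deriv f x) (at x)"
  by (metis kdiff.simps(2) DERIV_deriv_iff_real_differentiable)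

lemma kdiff_add: "kdiff k f \<Longrightarrow> kdiff k g \<Longrightarrow> kdiff k (\<lambda>x. f x + g x)"
proof (induction k arbitrary: f g)
  case (Suc k)
  show ?case
    by (rule kdiff_SucI[of _ "\<lambda>x. deriv f x + deriv g x"])
      (use Suc in \<open>auto intro!: derivative_eq_intros kdiff_DERIV\<close>)
qed simp

lemma kdiff_mult: "kdiff k f \<Longrightarrow> kdiff k g \<Longrightarrow> kdiff k (\<lambda>x. f x * g x)"
proof (induction k arbitrary: f g)
  case (Suc k)
  have f: "kdiff k f" "kdiff k (deriv f)" and g: "kdiff k g" "kdiff k (deriv g)"
    using Suc.prems kdiff_SucD by auto
  show ?case
  proof (rule kdiff_SucI)
    show "((\<lambda>x. f x * g x) has_real_derivative deriv f x * g x + f x * deriv g x) (at x)" for x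
      using Suc.prems[THEN kdiff_DERIV, of x] by (auto intro!: derivative_eq_intros)
    show "kdiff k (\<lambda>x. deriv f x * g x + f x * deriv g x)"
      by (intro kdiff_add Suc.IH f g)
  qed
qed simp

lemma kdiff_affine: "kdiff k f \<Longrightarrow> kdiff k (\<lambda>x. f (c * x + d))"
proof (induction k arbitrary: f)
  case (Suc k)
  show ?case
  proof (rule kdiff_SucI)
    show "((\<lambda>x. f (c * x + d)) has_real_derivative c * deriv f (c * x + d)) (at x)" for x
    proof -
      have "((\<lambda>x. c * x + d) has_real_derivative c) (at x)"
        by (auto intro!: derivative_eq_intros)
      from DERIV_chain2[OF kdiff_DERIV[OF Suc.prems] this] show ?thesis by (simp add: mult.commute)
    qed
    show "kdiff k (\<lambda>x. c * deriv f (c * x + d))"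
      using Suc by (intro kdiff_mult kdiff_const) auto
  qed
qed simp

definition exp_cutoff :: "real \<Rightarrow> real poly \<Rightarrow> real \<Rightarrow> real" where
  "exp_cutoff \<delta> P x = (if x > 0 then poly P (1 / x) * exp (- \<delta> / x) else 0)"

lemma poly_times_exp_tendsto_0:
  fixes \<delta> :: real
  assumes "\<delta> > 0"
  shows "((\<lambda>y. poly P y * exp (- \<delta> * y)) \<longlongrightarrow> 0) at_top"
proof -
  have mono: "((\<lambda>y. y ^ k * exp (- \<delta> * y)) \<longlongrightarrow> 0) at_top" for k
  proof -
    have "filterlim (\<lambda>y. \<delta> * y) at_top at_top"
      using assms by (intro filterlim_tendsto_pos_mult_at_top[OF tendsto_const]) (auto simp: filterlim_ident)
    from filterlim_compose[OF tendsto_power_div_exp_0[of k] this]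
    have "((\<lambda>y. (1 / \<delta> ^ k) * ((\<delta> * y) ^ k / exp (\<delta> * y))) \<longlongrightarrow> (1 / \<delta> ^ k) * 0) at_top"
      by (intro tendsto_intros)
    then show ?thesis using assms by (simp add: power_mult_distrib exp_minus field_simps)
  qed
  have "((\<lambda>y. \<Sum>i\<le>degree P. coeff P i * (y ^ i * exp (- \<delta> * y))) \<longlongrightarrow> (\<Sum>i\<le>degree P. coeff P i * 0)) at_top"
    by (intro tendsto_intros mono)
  then show ?thesis by (simp add: poly_altdef sum_distrib_right mult.assoc)
qed

lemma exp_cutoff_DERIV:
  assumes "\<delta> > 0"
  shows "(exp_cutoff \<delta> P has_real_derivative
    exp_cutoff \<delta> ([:0, 0, 1:] * (smult \<delta> P - pderiv P)) x) (at x)"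
proof (cases x "0 :: real" rule: linorder_cases)
  case less
  then have "\<forall>\<^sub>F y in nhds x. exp_cutoff \<delta> P y = 0"
    by (auto simp: exp_cutoff_def eventually_nhds intro!: exI[of _ "{..<0}"])
  then have "(exp_cutoff \<delta> P has_real_derivative 0) (at x) \<longleftrightarrow> ((\<lambda>_. 0) has_real_derivative 0) (at x)"
    by (intro DERIV_cong_ev) auto
  then show ?thesis using less by (simp add: exp_cutoff_def)
next
  case greater
  then have ev: "\<forall>\<^sub>F y in nhds x. exp_cutoff \<delta> P y = poly P (1 / y) * exp (- \<delta> / y)"
    by (auto simp: exp_cutoff_def eventually_nhds intro!: exI[of _ "{0<..}"])
  have "((\<lambda>y. poly P (1 / y) * exp (- \<delta> / y)) has_real_derivative
      (poly (pderiv P) (1/x) * (- 1 / x^2)) * exp (- \<delta> / x) + poly P (1/x) * (exp (- \<delta> / x) * (\<delta> / x^2))) (at x)"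
    using greater
    by (auto intro!: derivative_eq_intros DERIV_chain2[OF poly_DERIV] simp: power2_eq_square)
  with DERIV_cong_ev[OF refl ev refl] have "(exp_cutoff \<delta> P has_real_derivative
      (poly (pderiv P) (1/x) * (- 1 / x^2)) * exp (- \<delta> / x) + poly P (1/x) * (exp (- \<delta> / x) * (\<delta> / x^2))) (at x)"
    by blast
  moreover have "(poly (pderiv P) (1/x) * (- 1 / x^2)) * exp (- \<delta> / x) + poly P (1/x) * (exp (- \<delta> / x) * (\<delta> / x^2))
      = exp_cutoff \<delta> ([:0, 0, 1:] * (smult \<delta> P - pderiv P)) x"
    using greater by (simp add: exp_cutoff_def field_simps power2_eq_square)
  ultimately show ?thesis by simp
next
  case equal
  have "((\<lambda>h. exp_cutoff \<delta> P h / h) \<longlongrightarrow> 0) (at_right 0)"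
  proof (rule Lim_transform_eventually)
    show "((\<lambda>h. poly (pCons 0 P) (inverse h) * exp (- \<delta> * inverse h)) \<longlongrightarrow> 0) (at_right (0::real))"
      by (rule filterlim_compose[OF poly_times_exp_tendsto_0[OF assms] filterlim_inverse_at_top_right])
    show "\<forall>\<^sub>F h in at_right 0. poly (pCons 0 P) (inverse h) * exp (- \<delta> * inverse h) = exp_cutoff \<delta> P h / h"
      by (auto simp: eventually_at_right_field exp_cutoff_def field_simps intro!: exI[of _ 1])
  qed
  moreover have "((\<lambda>h. exp_cutoff \<delta> P h / h) \<longlongrightarrow> 0) (at_left 0)"
  proof (rule Lim_transform_eventually[OF tendsto_const])
    show "\<forall>\<^sub>F h in at_left 0. 0 = exp_cutoff \<delta> P h / h"
      by (auto simp: eventually_at_left_field exp_cutoff_def intro!: exI[of _ "-1"])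
  qed
  ultimately have "((\<lambda>h. exp_cutoff \<delta> P h / h) \<longlongrightarrow> 0) (at 0)"
    by (simp add: filterlim_split_at)
  then have "(exp_cutoff \<delta> P has_real_derivative 0) (at 0)"
    by (simp add: DERIV_def exp_cutoff_def)
  then show ?thesis using equal by (simp add: exp_cutoff_def)
qed

lemma kdiff_exp_cutoff: "\<delta> > 0 \<Longrightarrow> kdiff k (exp_cutoff \<delta> P)"
  by (induction k arbitrary: P) (auto intro: kdiff_SucI[OF exp_cutoff_DERIV] simp del: kdiff.simps(2))

definition bump :: "real \<Rightarrow> real \<Rightarrow> real \<Rightarrow> real \<Rightarrow> real" where
  "bump \<delta> c d x = exp_cutoff \<delta> 1 (x - c) * exp_cutoff \<delta> 1 (d - x)"

lemma kdiff_bump: "\<delta> > 0 \<Longrightarrow> kdiff k (bump \<delta> c d)"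
  using kdiff_mult[OF kdiff_affine[OF kdiff_exp_cutoff, of \<delta> k 1 1 "-c"]
      kdiff_affine[OF kdiff_exp_cutoff, of \<delta> k 1 "-1" d]]
  by (simp add: bump_def[abs_def])

lemma continuous_bump: "\<delta> > 0 \<Longrightarrow> continuous_on X (bump \<delta> c d)"
  using kdiff_DERIV[OF kdiff_bump, of \<delta> c d]
  by (meson DERIV_isCont continuous_at_imp_continuous_on)

lemma bump_bounds: "\<delta> > 0 \<Longrightarrow> 0 \<le> bump \<delta> c d x" "\<delta> > 0 \<Longrightarrow> bump \<delta> c d x \<le> 1"
  by (auto simp: bump_def exp_cutoff_def intro!: mult_le_one divide_nonpos_pos)

lemma bump_pos: "c < x \<Longrightarrow> x < d \<Longrightarrow> 0 < bump \<delta> c d x"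
  by (auto simp: bump_def exp_cutoff_def)

lemma bump_outside: "x \<notin> {c<..<d} \<Longrightarrow> bump \<delta> c d x = 0"
  by (auto simp: bump_def exp_cutoff_def)

lemma bump_tendsto_indicator:
  "(\<lambda>k. bump (1 / real (Suc k)) c d x) \<longlonglongrightarrow> indicator {c<..<d} x"
proof (cases "x \<in> {c<..<d}")
  case True
  have "(\<lambda>k. exp (- (1 / real (Suc k)) / (x - c)) * exp (- (1 / real (Suc k)) / (d - x)))
      \<longlonglongrightarrow> exp (- 0 / (x - c)) * exp (- 0 / (d - x))"
    using LIMSEQ_Suc[OF lim_const_over_n[of "1::real"]] True
    by (intro tendsto_intros) auto
  then show ?thesis using True by (simp add: bump_def exp_cutoff_def)
qed (simp add: bump_outside)

context sobolev_interval
begin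

lemma integrable_S_iff: "integrable S f \<longleftrightarrow> f absolutely_integrable_on {a..b}"
  for f :: "real \<Rightarrow> 'a::euclidean_space"
  by (simp add: integrable_restrict_space set_integrable_def)

lemma integral_S: "integrable S f \<Longrightarrow> integral\<^sup>L S f = integral {a..b} f"
  for f :: "real \<Rightarrow> 'a::euclidean_space"
  by (rule lebesgue_integral_eq_integral) auto

lemma integrable_S_continuous: "continuous_on {a..b} f \<Longrightarrow> integrable S f"
  for f :: "real \<Rightarrow> 'a::euclidean_space"
  unfolding integrable_S_iff
  by (metis absolutely_integrable_continuous cbox_interval)

lemma integrable_on_sub:
  fixes f :: "real \<Rightarrow> 'a::euclidean_space"
  assumes "integrable S f" "a \<le> c" "d \<le> b"
  shows "f absolutely_integrable_on {c..d}" "f integrable_on {c..d}"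
proof -
  show "f absolutely_integrable_on {c..d}"
    using assms by (auto simp: integrable_S_iff intro: absolutely_integrable_on_subinterval)
  then show "f integrable_on {c..d}" by (rule set_lebesgue_integral_eq_integral(1))
qed

lemma measurable_continuous_S:
  "continuous_on {a..b} f \<Longrightarrow> f \<in> borel_measurable S"
  for f :: "real \<Rightarrow> 'a::euclidean_space"
  by (meson borel_measurable_integrable integrable_S_continuous)

lemma integral_indicator_S:
  fixes f :: "real \<Rightarrow> complex"
  assumes f: "integrable S f" and X: "X \<subseteq> {a..b}" "X \<in> sets lebesgue"
  shows "(\<integral>t. indicator X t *\<^sub>R f t \<partial>S) = integral X f"
proof -
  have "(\<integral>t. indicator X t *\<^sub>R f t \<partial>S)
      = (\<integral>t. indicat_real {a..b} t *\<^sub>R (indicat_real X t *\<^sub>R f t) \<partial>lebesgue)"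
    by (subst integral_restrict_space) auto
  also have "\<dots> = (\<integral>t. indicat_real X t *\<^sub>R f t \<partial>lebesgue)"
    by (rule Bochner_Integration.integral_cong) (use X in \<open>auto simp: indicator_def\<close>)
  also have "\<dots> = integral X f"
    using set_lebesgue_integral_eq_integral(2)[OF set_integrable_subset[OF f[unfolded integrable_S_iff] X(2,1)]]
    by (simp add: set_lebesgue_integral_def)
  finally show ?thesis .
qed

lemma AE_eq_const_if_integrals:
  fixes v :: "real \<Rightarrow> complex"
  assumes v: "integrable S v"
    and I: "\<And>c d. a < c \<Longrightarrow> c < d \<Longrightarrow> d < b \<Longrightarrow> integral {c..d} v = (d - c) *\<^sub>R K"
  shows "AE t in S. v t = K"
proof -
  define w where "w t = (if t \<in> {a..b} then v t else 0)" for t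
  have "w integrable_on UNIV"
    using integrable_on_sub(2)[OF v, of a b] unfolding w_def by (simp only: integrable_restrict_UNIV)
  then have "w integrable_on cbox c d" for c d
    by (rule integrable_on_subcbox) auto
  then obtain N where N: "negligible N" "\<And>x e. x \<notin> N \<Longrightarrow> 0 < e \<Longrightarrow>
      \<exists>d>0. \<forall>h. 0 < h \<and> h < d \<longrightarrow> norm (integral (cbox x (x + h *\<^sub>R One)) w /\<^sub>R h ^ DIM(real) - w x) < e"
    using integrable_ccontinuous_explicit[of w] by blast
  have eq: "v x = K" if x: "x \<in> {a<..<b}" "x \<notin> N" for x
  proof (rule ccontr)
    assume ne: "v x \<noteq> K"
    then obtain d where d: "d > 0"
      "\<And>h. 0 < h \<Longrightarrow> h < d \<Longrightarrow> norm (integral {x..x + h} w /\<^sub>R h - w x) < norm (K - v x)"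
      using N(2)[OF x(2), of "norm (K - v x)"] by auto
    define h where "h = min d (b - x) / 2"
    have h: "0 < h" "h < d" "x + h < b" using d x by (auto simp: h_def min_def field_simps)
    have "integral {x..x + h} w = integral {x..x + h} v"
      by (rule integral_cong) (use x h in \<open>auto simp: w_def\<close>)
    also have "\<dots> = h *\<^sub>R K" using I[of x "x + h"] x h by simp
    finally show False using d(2)[OF h(1,2)] x h by (simp add: w_def)
  qed
  have "AE t in lebesgue. t \<notin> N \<union> {a, b}"
    using N(1) by (intro AE_not_in) (auto simp: negligible_iff_null_sets[symmetric])
  then have "AE t in lebesgue. t \<in> {a..b} \<longrightarrow> v t = K"
    by eventually_elim (use eq in auto)
  then show ?thesis by (subst AE_restrict_space_iff) auto
qed

lemma test_function_iff:
  "test_function a b \<phi> \<longleftrightarrow> (\<forall>k. kdiff k \<phi>) \<and>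
    (\<exists>c d. a < c \<and> c \<le> d \<and> d < b \<and> (\<forall>x. x \<notin> {c..d} \<longrightarrow> \<phi> x = 0))"
  unfolding test_function_def kdiff_iff by auto

lemma test_function_primitive:
  assumes sm: "\<And>k. kdiff k \<psi>" and cd: "a < c" "c \<le> d" "d < b" "\<And>x. x \<notin> {c..d} \<Longrightarrow> \<psi> x = 0"
    and I: "integral {a..b} \<psi> = 0"
  obtains \<phi> where "test_function a b \<phi>" "deriv \<phi> = \<psi>"
proof -
  define \<phi> where "\<phi> t = integral {a..t} \<psi>" for t
  have cont: "continuous_on X \<psi>" for X
    using kdiff_DERIV[OF sm] by (meson DERIV_isCont continuous_at_imp_continuous_on)
  have int: "\<psi> integrable_on {x..y}" for x y by (rule integrable_continuous_real[OF cont])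
  have left: "\<phi> t = 0" if "t < c" for t
  proof -
    have "integral {a..t} \<psi> = integral {a..t} (\<lambda>x. 0)"
      by (rule integral_cong) (use that cd in auto)
    then show ?thesis by (simp add: \<phi>_def)
  qed
  have right: "\<phi> t = 0" if t: "t > d" for t
  proof -
    have z: "integral {x..y} \<psi> = 0" if "d < x" for x y
    proof -
      have "integral {x..y} \<psi> = integral {x..y} (\<lambda>x. 0)"
        by (rule integral_cong) (use that cd in auto)
      then show ?thesis by simp
    qed
    show ?thesis
    proof (cases "t \<le> b")
      case True
      then show ?thesis using z[of t b] I t cd
          Henstock_Kurzweil_Integration.integral_combine[OF _ True int, of a] by (simp add: \<phi>_def)
    next
      case False
      then show ?thesis using z[of b t] I t cd
          Henstock_Kurzweil_Integration.integral_combine[OF _ _ int, of a b t] by (simp add: \<phi>_def)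
    qed
  qed
  have D: "(\<phi> has_real_derivative \<psi> t) (at t)" for t
  proof (cases "t < c")
    case True
    then have "\<forall>\<^sub>F y in nhds t. \<phi> y = 0"
      using left by (auto simp: eventually_nhds intro!: exI[of _ "{..<c}"])
    then show ?thesis using DERIV_cong_ev[of t t \<phi> "\<lambda>_. 0" 0 0] True cd(4)[of t] by simp
  next
    case False
    have "((\<lambda>u. integral {a..u} \<psi>) has_real_derivative \<psi> t) (at t within {a..t + 1})"
      by (rule integral_has_real_derivative[OF cont]) (use False cd in auto)
    moreover have "at t within {a..t + 1} = at t"
      by (rule at_within_interior) (use False cd in auto)
    ultimately show ?thesis by (simp add: \<phi>_def[abs_def])
  qed
  show ?thesis
  proof
    have "kdiff k \<phi>" for k using kdiff_SucI[OF D sm] by (rule kdiff_SucD)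
    then show "test_function a b \<phi>"
      unfolding test_function_iff using cd left right
      by (intro conjI allI exI[of _ c] exI[of _ d]) (auto simp: not_le)
    show "deriv \<phi> = \<psi>" using D by (auto intro: DERIV_imp_deriv)
  qed
qed

lemma integrable_mult_continuous:
  fixes v \<phi> :: "real \<Rightarrow> 'a::{real_normed_field, euclidean_space}"
  assumes "integrable S v" and \<phi>: "continuous_on {a..b} \<phi>"
  shows "integrable S (\<lambda>t. v t * \<phi> t)"
proof -
  obtain M where M: "\<And>t. t \<in> {a..b} \<Longrightarrow> norm (\<phi> t) \<le> M"
    using compact_imp_bounded[OF compact_continuous_image[OF \<phi> compact_Icc]]
    unfolding bounded_iff by blast
  show ?thesis
  proof (rule Bochner_Integration.integrable_bound)
    show "integrable S (\<lambda>t. of_real M * v t)" using assms(1) by simp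
    show "(\<lambda>t. v t * \<phi> t) \<in> borel_measurable S"
      using assms measurable_continuous_S[OF \<phi>] by (auto intro: borel_measurable_times)
    have "0 \<le> M" using M[of a] ab by (auto intro: order_trans[OF norm_ge_zero])
    then show "AE t in S. norm (v t * \<phi> t) \<le> norm (of_real M * v t)"
      using M by (intro AE_I2) (auto simp: norm_mult mult.commute intro!: mult_right_mono)
  qed
qed

text \<open>Differences of normalised bumps have smooth compactly
  supported primitives, and the bumps converge boundedly to indicators of intervals.\<close>

lemma du_Bois_Reymond:
  fixes v :: "real \<Rightarrow> complex"
  assumes v: "integrable S v"
    and orth: "\<And>\<phi>. test_function a b \<phi> \<Longrightarrow> (\<integral>t. v t * of_real (deriv \<phi> t) \<partial>S) = 0"
  shows "\<exists>K. AE t in S. v t = K"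
proof -
  define c0 d0 where "c0 = a + (b - a) / 3" and "d0 = b - (b - a) / 3"
  have cd0: "a < c0" "c0 < d0" "d0 < b" using ab by (auto simp: c0_def d0_def field_simps)
  define J where "J \<delta> c d = integral {a..b} (bump \<delta> c d)" for \<delta> c d
  have ib: "bump \<delta> c d integrable_on {a..b}" if "\<delta> > 0" for \<delta> c d
    by (intro integrable_continuous_real continuous_bump that)
  have J0: "J 1 c0 d0 > 0"
  proof -
    have "J 1 c0 d0 \<noteq> 0"
    proof
      assume "J 1 c0 d0 = 0"
      then have "bump 1 c0 d0 ((c0 + d0) / 2) = 0"
        using integral_eq_0_iff[OF continuous_bump, of 1 a b c0 d0] bump_bounds ab cd0
        by (auto simp: J_def)
      then show False using bump_pos[of c0 "(c0 + d0) / 2" d0 1] cd0 by (simp add: field_simps)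
    qed
    moreover have "J 1 c0 d0 \<ge> 0"
      unfolding J_def by (intro integral_nonneg ib) (auto simp: bump_bounds)
    ultimately show ?thesis by simp
  qed
  define K where "K = (\<integral>t. v t * of_real (bump 1 c0 d0 t / J 1 c0 d0) \<partial>S)"
  have int1: "integrable S (\<lambda>t. v t * of_real (bump \<delta> c d t))" if "\<delta> > 0" for \<delta> c d
    by (intro integrable_mult_continuous v continuous_intros continuous_bump that)
  have step: "(\<integral>t. v t * of_real (bump \<delta> c d t) \<partial>S) = J \<delta> c d *\<^sub>R K"
    if \<delta>: "\<delta> > 0" and cd: "a < c" "c < d" "d < b" for \<delta> c d
  proof -
    define \<psi> where "\<psi> x = bump \<delta> c d x + (- J \<delta> c d / J 1 c0 d0) * bump 1 c0 d0 x" for x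
    obtain \<phi> where \<phi>: "test_function a b \<phi>" "deriv \<phi> = \<psi>"
    proof (rule test_function_primitive)
      show "kdiff k \<psi>" for k
        unfolding \<psi>_def[abs_def] by (intro kdiff_add kdiff_mult kdiff_const kdiff_bump \<delta>) simp
      show "a < min c c0" "min c c0 \<le> max d d0" "max d d0 < b" using cd cd0 by auto
      show "\<psi> x = 0" if "x \<notin> {min c c0..max d d0}" for x
      proof -
        have "x \<notin> {c<..<d}" "x \<notin> {c0<..<d0}"
          using that by (auto simp: min_le_iff_disj le_max_iff_disj)
        then show ?thesis by (simp add: \<psi>_def bump_outside)
      qed
      define k where "k = - J \<delta> c d / J 1 c0 d0"
      have "integral {a..b} \<psi> = J \<delta> c d + integral {a..b} (\<lambda>x. k * bump 1 c0 d0 x)"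
        unfolding \<psi>_def[abs_def] J_def k_def
        by (intro Henstock_Kurzweil_Integration.integral_add integrable_continuous_real
            continuous_intros continuous_bump \<delta>) simp
      also have "\<dots> = J \<delta> c d + k * J 1 c0 d0" by (simp add: J_def)
      finally have "integral {a..b} \<psi> = J \<delta> c d + k * J 1 c0 d0" .
      then show "integral {a..b} \<psi> = 0" using J0 by (simp add: k_def)
    qed auto
    have "0 = (\<integral>t. v t * of_real (\<psi> t) \<partial>S)" using orth[OF \<phi>(1)] \<phi>(2) by simp
    also have "\<dots> = (\<integral>t. v t * of_real (bump \<delta> c d t) - of_real (J \<delta> c d) * (v t * of_real (bump 1 c0 d0 t / J 1 c0 d0)) \<partial>S)"
      by (rule Bochner_Integration.integral_cong) (auto simp: \<psi>_def algebra_simps)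
    also have "\<dots> = (\<integral>t. v t * of_real (bump \<delta> c d t) \<partial>S) - of_real (J \<delta> c d) * K"
    proof -
      have "integrable S (\<lambda>t. v t * of_real (bump 1 c0 d0 t / J 1 c0 d0))"
        using J0 by (intro integrable_mult_continuous v continuous_intros continuous_bump) auto
      then show ?thesis
        unfolding K_def by (subst Bochner_Integration.integral_diff[OF int1[OF \<delta>] integrable_mult_right])
          (simp_all only: integral_mult_right_zero)
    qed
    finally show ?thesis by (simp add: scaleR_conv_of_real)
  qed
  have "AE t in S. v t = K"
  proof (rule AE_eq_const_if_integrals[OF v])
    fix c d assume cd: "a < c" "c < d" "d < b"
    define \<delta> where "\<delta> k = 1 / real (Suc k)" for k
    have \<delta>: "\<delta> k > 0" for k by (simp add: \<delta>_def)
    have lim1: "(\<lambda>k. \<integral>t. u t * of_real (bump (\<delta> k) c d t) \<partial>S) \<longlonglongrightarrow> (\<integral>t. u t * of_real (indicator {c<..<d} t) \<partial>S)"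
      if u: "integrable S u" for u :: "real \<Rightarrow> complex"
    proof (rule integral_dominated_convergence[where w="\<lambda>t. norm (u t)"])
      have "u \<in> borel_measurable S" using u by simp
      moreover have "(\<lambda>t. complex_of_real (indicator {c<..<d} t)) \<in> borel_measurable S"
        by (intro measurable_restrict_space1 measurable_completion) measurable
      ultimately show "(\<lambda>t. u t * of_real (indicator {c<..<d} t)) \<in> borel_measurable S"
        by (rule borel_measurable_times)
      show "(\<lambda>t. u t * of_real (bump (\<delta> k) c d t)) \<in> borel_measurable S" for k
        using integrable_mult_continuous[OF u, of "\<lambda>t. of_real (bump (\<delta> k) c d t)"]
        by (auto intro!: borel_measurable_integrable continuous_intros continuous_bump \<delta>)
      show "AE t in S. (\<lambda>k. u t * of_real (bump (\<delta> k) c d t)) \<longlonglongrightarrow> u t * of_real (indicator {c<..<d} t)"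
        unfolding \<delta>_def by (intro AE_I2 tendsto_intros bump_tendsto_indicator)
      show "AE t in S. norm (u t * of_real (bump (\<delta> k) c d t)) \<le> norm (u t)" for k
        using bump_bounds[OF \<delta>] by (intro AE_I2) (auto simp: norm_mult intro!: mult_left_le)
    qed (use u in simp)
    have ind: "(\<integral>t. u t * of_real (indicator {c<..<d} t) \<partial>S) = integral {c..d} u"
      if u: "integrable S u" for u :: "real \<Rightarrow> complex"
      using integral_indicator_S[OF u, of "{c<..<d}"] greaterThanLessThan_subseteq_atLeastAtMost_iff[of c d a b] cd
      by (simp add: scaleR_conv_of_real mult.commute integral_open_interval_real)
    have i1: "integrable S (\<lambda>t. 1::complex)" by simp
    have "(\<lambda>k. of_real (J (\<delta> k) c d) * K) \<longlonglongrightarrow> integral {c..d} v"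
      using lim1[OF v] unfolding ind[OF v] step[OF \<delta> cd] scaleR_conv_of_real .
    moreover have J1: "(\<integral>t. 1 * complex_of_real (bump (\<delta> k) c d t) \<partial>S) = of_real (J (\<delta> k) c d)" for k
      unfolding J_def integral_S[OF integrable_S_continuous[OF continuous_bump[OF \<delta>]], symmetric]
      by simp
    have "(\<lambda>k. complex_of_real (J (\<delta> k) c d)) \<longlonglongrightarrow> integral {c..d} (\<lambda>t. 1::complex)"
      using lim1[OF i1] unfolding ind[OF i1] J1 .
    then have "(\<lambda>k. of_real (J (\<delta> k) c d) * K) \<longlonglongrightarrow> integral {c..d} (\<lambda>t. 1::complex) * K"
      by (intro tendsto_intros)
    ultimately have "integral {c..d} v = integral {c..d} (\<lambda>t. 1::complex) * K"
      by (rule LIMSEQ_unique)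
    then show "integral {c..d} v = (d - c) *\<^sub>R K" using cd by (simp add: scaleR_conv_of_real)
  qed
  then show ?thesis ..
qed

section \<open>Weak derivatives and primitives\<close>

definition primitive_of :: "(real \<Rightarrow> complex) \<Rightarrow> (real \<Rightarrow> complex) \<Rightarrow> bool" where
  "primitive_of u g \<longleftrightarrow> integrable S g \<and> (\<forall>t\<in>{a..b}. integral {a..t} g = u t - u a)"

lemma continuous_indefinite: "integrable S g \<Longrightarrow> continuous_on {a..b} (\<lambda>t. integral {a..t} g)"
  for g :: "real \<Rightarrow> complex"
  using indefinite_integral_continuous_1[of g a b] integrable_on_sub(2)[of g a b] by simp

lemma primitive_of_continuous:
  assumes "primitive_of u g"
  shows "continuous_on {a..b} u"
proof -
  have "continuous_on {a..b} (\<lambda>t. u a + integral {a..t} g)"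
    using assms by (intro continuous_intros continuous_indefinite) (simp add: primitive_of_def)
  then show ?thesis
    by (rule continuous_on_eq) (use assms in \<open>simp add: primitive_of_def\<close>)
qed

lemma integrable_S_AE: "integrable S f \<Longrightarrow> AE t in S. f t = g t \<Longrightarrow> integrable S g"
  for f :: "real \<Rightarrow> complex"
  using integrable_cong_AE_imp[of S f g] measurable_S_AE[of f g] by (auto elim: eventually_mono)

lemma AE_S_sub:
  assumes "AE t in S. P t"
  obtains N where "negligible N" "\<And>t. t \<in> {a..b} \<Longrightarrow> t \<notin> N \<Longrightarrow> P t"
proof -
  have "AE t in lebesgue. t \<in> {a..b} \<longrightarrow> P t"
    using assms by (subst (asm) AE_restrict_space_iff) auto
  then obtain N where "N \<in> null_sets lebesgue" "{t \<in> space lebesgue. \<not> (t \<in> {a..b} \<longrightarrow> P t)} \<subseteq> N"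
    by (rule AE_E3) auto
  then show ?thesis by (intro that[of N]) (auto simp: negligible_iff_null_sets)
qed

lemma integral_cong_AE_sub:
  assumes "AE t in S. f t = (g t :: complex)" "a \<le> c" "d \<le> b"
  shows "integral {c..d} f = integral {c..d} g"
proof -
  obtain N where N: "negligible N" "\<And>t. t \<in> {a..b} \<Longrightarrow> t \<notin> N \<Longrightarrow> f t = g t"
    using AE_S_sub[OF assms(1)] by blast
  show ?thesis by (rule integral_spike[OF N(1)]) (use N assms in auto)
qed

lemma primitive_of_cong:
  assumes "primitive_of u g" "\<And>t. t \<in> {a..b} \<Longrightarrow> u t = u' t" "AE t in S. g t = g' t"
  shows "primitive_of u' g'"
  using assms(1) assms(2) integral_cong_AE_sub[OF assms(3), of a] integrable_S_AE[OF _ assms(3)] ab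
  by (auto simp: primitive_of_def)

lemma primitive_of_indefinite: "integrable S g \<Longrightarrow> primitive_of (\<lambda>t. c + integral {a..t} g) g"
  by (simp add: primitive_of_def)

lemma primitive_of_add:
  assumes "primitive_of u g" "primitive_of v h"
  shows "primitive_of (\<lambda>t. u t + v t) (\<lambda>t. g t + h t)"
proof -
  have "integral {a..t} (\<lambda>t. g t + h t) = integral {a..t} g + integral {a..t} h" if "t \<in> {a..b}" for t
    using assms integrable_on_sub(2)[of _ a t] that
    by (intro Henstock_Kurzweil_Integration.integral_add) (auto simp: primitive_of_def)
  then show ?thesis using assms unfolding primitive_of_def by simp
qed

lemma primitive_of_cmult:
  assumes "primitive_of u g"
  shows "primitive_of (\<lambda>t. c * u t) (\<lambda>t. c * g t)"
proof -
  show ?thesis using assms unfolding primitive_of_def by (simp add: right_diff_distrib)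
qed

text \<open>Fubini on the triangle \<open>s \<le> t\<close>.\<close>

lemma integral_by_parts:
  fixes g h :: "real \<Rightarrow> complex"
  assumes g: "integrable S g" and h: "integrable S h"
  shows "integral {a..b} (\<lambda>t. g t * integral {a..t} h + integral {a..t} g * h t)
    = integral {a..b} g * integral {a..b} h"
proof -
  interpret P: pair_sigma_finite S S
    by (intro pair_sigma_finite.intro S.sigma_finite_measure_axioms)
  define f where "f t s = indicator {a..t} s *\<^sub>R (g t * h s)" for t s
  have [measurable]: "g \<in> borel_measurable S" "h \<in> borel_measurable S" using g h by auto
  have [measurable]: "(\<lambda>x. x) \<in> borel_measurable S"
    by (intro measurable_restrict_space1 measurable_completion) measurable
  have ff: "f t s = (if a \<le> s \<and> s \<le> t then g t * h s else 0)" for t s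
    by (simp add: f_def indicator_def)
  have m1: "(\<lambda>x. fst x) \<in> borel_measurable (S \<Otimes>\<^sub>M S)" and m2: "(\<lambda>x. snd x) \<in> borel_measurable (S \<Otimes>\<^sub>M S)"
    using measurable_compose[OF measurable_fst, of "\<lambda>x. x" S borel S]
      measurable_compose[OF measurable_snd, of "\<lambda>x. x" S borel S] by auto
  have fm: "case_prod f \<in> borel_measurable (S \<Otimes>\<^sub>M S)"
    unfolding ff case_prod_beta by (intro measurable_If) (use m1 m2 in measurable)
  have int: "integrable (S \<Otimes>\<^sub>M S) (case_prod f)"
  proof (rule Bochner_Integration.integrable_bound)
    show "integrable (S \<Otimes>\<^sub>M S) (\<lambda>(t, s). g t * h s)"
    proof (rule P.Fubini_integrable)
      show "integrable S (\<lambda>x. \<integral>y. norm (case (x, y) of (t, s) \<Rightarrow> g t * h s) \<partial>S)"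
        using g by (simp add: norm_mult)
      show "AE x in S. integrable S (\<lambda>y. case (x, y) of (t, s) \<Rightarrow> g t * h s)"
        using h by simp
    qed measurable
    show "AE x in S \<Otimes>\<^sub>M S. norm (case_prod f x) \<le> norm (case x of (t, s) \<Rightarrow> g t * h s)"
      by (intro AE_I2) (auto simp: ff)
  qed (rule fm)
  have "(\<integral>t. g t * integral {a..t} h \<partial>S) = (\<integral>t. (\<integral>s. f t s \<partial>S) \<partial>S)"
  proof (rule Bochner_Integration.integral_cong)
    fix t assume "t \<in> space S"
    then have "(\<integral>s. f t s \<partial>S) = (\<integral>s. g t * (indicator {a..t} s *\<^sub>R h s) \<partial>S)"
      by (intro Bochner_Integration.integral_cong) (auto simp: f_def)
    also have "\<dots> = g t * integral {a..t} h"
      by (subst integral_mult_right_zero, subst integral_indicator_S[OF h]) (use \<open>t \<in> space S\<close> in auto)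
    finally show "g t * integral {a..t} h = (\<integral>s. f t s \<partial>S)" ..
  qed simp
  also have "\<dots> = (\<integral>s. (\<integral>t. f t s \<partial>S) \<partial>S)"
    using P.Fubini_integral[OF int] by simp
  also have "\<dots> = (\<integral>s. (integral {a..b} g - integral {a..s} g) * h s \<partial>S)"
  proof (rule Bochner_Integration.integral_cong)
    fix s assume s: "s \<in> space S"
    then have "(\<integral>t. f t s \<partial>S) = (\<integral>t. h s * (indicator {s..b} t *\<^sub>R g t) \<partial>S)"
      by (intro Bochner_Integration.integral_cong) (auto simp: f_def indicator_def)
    also have "\<dots> = h s * integral {s..b} g"
      by (subst integral_mult_right_zero, subst integral_indicator_S[OF g]) (use s in auto)
    also have "integral {s..b} g = integral {a..b} g - integral {a..s} g"
      using Henstock_Kurzweil_Integration.integral_combine[of a s b g] s integrable_on_sub(2)[OF g, of a b]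
      by (simp add: algebra_simps)
    finally show "(\<integral>t. f t s \<partial>S) = (integral {a..b} g - integral {a..s} g) * h s" by simp
  qed simp
  finally have eq: "(\<integral>t. g t * integral {a..t} h \<partial>S)
      = (\<integral>s. (integral {a..b} g - integral {a..s} g) * h s \<partial>S)" .
  have i1: "integrable S (\<lambda>t. g t * integral {a..t} h)"
    by (intro integrable_mult_continuous g continuous_indefinite h)
  have i2: "integrable S (\<lambda>t. integral {a..t} g * h t)"
    using integrable_mult_continuous[OF h continuous_indefinite[OF g]] by (simp add: mult.commute)
  have "integral {a..b} (\<lambda>t. g t * integral {a..t} h + integral {a..t} g * h t)
      = (\<integral>t. g t * integral {a..t} h + integral {a..t} g * h t \<partial>S)"
    by (rule integral_S[symmetric]) (use i1 i2 in simp)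
  also have "\<dots> = (\<integral>s. (integral {a..b} g - integral {a..s} g) * h s \<partial>S) + (\<integral>t. integral {a..t} g * h t \<partial>S)"
    using i1 i2 eq by simp
  also have "\<dots> = (\<integral>t. integral {a..b} g * h t \<partial>S)"
    using i2 h by (simp add: left_diff_distrib)
  also have "\<dots> = integral {a..b} g * integral {a..b} h" using integral_S[OF h] by simp
  finally show ?thesis .
qed

lemma primitive_of_mult:
  assumes u: "primitive_of u g" and v: "primitive_of v h"
  shows "primitive_of (\<lambda>t. u t * v t) (\<lambda>t. g t * v t + u t * h t)"
proof -
  have g: "integrable S g" and h: "integrable S h" using u v by (auto simp: primitive_of_def)
  note cu = primitive_of_continuous[OF u] and cv = primitive_of_continuous[OF v]
  have i1: "integrable S (\<lambda>t. g t * v t)" by (rule integrable_mult_continuous[OF g cv])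
  have i2: "integrable S (\<lambda>t. u t * h t)"
    using integrable_mult_continuous[OF h cu] by (simp add: mult.commute)
  have "integral {a..x} (\<lambda>t. g t * v t + u t * h t) = u x * v x - u a * v a" if x: "a < x" "x \<le> b" for x
  proof -
    interpret X: sobolev_interval a x p using x p_ge_1 by unfold_locales
    have gx: "integrable (lebesgue_on {a..x}) g" "integrable (lebesgue_on {a..x}) h"
      unfolding X.integrable_S_iff using integrable_on_sub(1)[OF g, of a x] integrable_on_sub(1)[OF h, of a x] x by auto
    let ?G = "\<lambda>t. integral {a..t} g" and ?H = "\<lambda>t. integral {a..t} h"
    have j: "(\<lambda>t. g t * ?H t + ?G t * h t) integrable_on {a..x}" "g integrable_on {a..x}" "h integrable_on {a..x}"
    proof -
      have "integrable S (\<lambda>t. g t * ?H t + ?G t * h t)"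
        using integrable_mult_continuous[OF g continuous_indefinite[OF h]]
          integrable_mult_continuous[OF h continuous_indefinite[OF g]] by (simp add: mult.commute)
      then show "(\<lambda>t. g t * ?H t + ?G t * h t) integrable_on {a..x}"
        using integrable_on_sub(2) x by blast
    qed (use integrable_on_sub(2)[OF g, of a x] integrable_on_sub(2)[OF h, of a x] x in auto)
    have "integral {a..x} (\<lambda>t. g t * v t + u t * h t)
        = integral {a..x} (\<lambda>t. (g t * ?H t + ?G t * h t) + (v a * g t + u a * h t))"
    proof (rule integral_cong)
      fix t assume "t \<in> {a..x}"
      then have "u t = u a + ?G t" "v t = v a + ?H t" using u v x by (simp_all add: primitive_of_def)
      then show "g t * v t + u t * h t = (g t * ?H t + ?G t * h t) + (v a * g t + u a * h t)"
        by (simp add: algebra_simps)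
    qed
    also have "\<dots> = integral {a..x} (\<lambda>t. g t * ?H t + ?G t * h t)
        + (integral {a..x} (\<lambda>t. v a * g t) + integral {a..x} (\<lambda>t. u a * h t))"
    proof -
      have k: "(\<lambda>t. v a * g t) integrable_on {a..x}" "(\<lambda>t. u a * h t) integrable_on {a..x}"
        using j by (auto intro: integrable_on_mult_right)
      show ?thesis
        by (simp only: Henstock_Kurzweil_Integration.integral_add[OF j(1) integrable_add[OF k]]
            Henstock_Kurzweil_Integration.integral_add[OF k])
    qed
    also have "\<dots> = ?G x * ?H x + (v a * ?G x + u a * ?H x)"
      by (simp add: X.integral_by_parts[OF gx])
    also have "\<dots> = (u a + ?G x) * (v a + ?H x) - u a * v a" by (simp add: algebra_simps)
    also have "(u a + ?G x) * (v a + ?H x) = u x * v x"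
      using u v x by (simp add: primitive_of_def)
    finally show ?thesis by simp
  qed
  then show ?thesis using i1 i2 unfolding primitive_of_def
    by (auto simp: le_less)
qed

lemma test_function_primitive_of:
  assumes "test_function a b \<phi>"
  shows "primitive_of (\<lambda>t. of_real (\<phi> t)) (\<lambda>t. of_real (deriv \<phi> t))"
    "\<phi> a = 0" "\<phi> b = 0" "continuous_on {a..b} \<phi>" "continuous_on {a..b} (deriv \<phi>)"
proof -
  obtain c d where cd: "a < c" "c \<le> d" "d < b" "\<And>x. x \<notin> {c..d} \<Longrightarrow> \<phi> x = 0"
    and sm: "\<And>k. kdiff k \<phi>" using assms unfolding test_function_iff by blast
  show "\<phi> a = 0" "\<phi> b = 0" using cd by auto
  have D: "(\<phi> has_real_derivative deriv \<phi> x) (at x)" for x by (rule kdiff_DERIV[OF sm])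
  have "kdiff (Suc k) (deriv \<phi>)" for k using sm[of "Suc (Suc k)"] by simp
  then have D2: "(deriv \<phi> has_real_derivative deriv (deriv \<phi>) x) (at x)" for x by (rule kdiff_DERIV)
  show "continuous_on {a..b} \<phi>" and c: "continuous_on {a..b} (deriv \<phi>)"
    using D D2 by (meson DERIV_isCont continuous_at_imp_continuous_on)+
  have "((\<lambda>t. complex_of_real (deriv \<phi> t)) has_integral of_real (\<phi> x) - of_real (\<phi> a)) {a..x}"
    if "x \<in> {a..b}" for x
  proof (rule fundamental_theorem_of_calculus)
    show "((\<lambda>t. complex_of_real (\<phi> t)) has_vector_derivative of_real (deriv \<phi> t)) (at t within {a..x})" for t
      using D[of t] by (intro has_vector_derivative_of_real)
        (auto intro: has_field_derivative_at_within simp: has_real_derivative_iff_has_vector_derivative[symmetric])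
  qed (use that in auto)
  then show "primitive_of (\<lambda>t. of_real (\<phi> t)) (\<lambda>t. of_real (deriv \<phi> t))"
    unfolding primitive_of_def using c
    by (auto intro!: integrable_S_continuous continuous_intros dest: integral_unique)
qed

lemma primitive_of_imp_weak:
  assumes u: "primitive_of u g"
  shows "has_weak_deriv a b u g"
  unfolding has_weak_deriv_def
proof (intro conjI allI impI)
  show g: "integrable S g" using u by (simp add: primitive_of_def)
  note cu = primitive_of_continuous[OF u]
  show "integrable S u" by (rule integrable_S_continuous[OF cu])
  fix \<phi> assume \<phi>: "test_function a b \<phi>"
  note T = test_function_primitive_of[OF \<phi>]
  have i: "integrable S (\<lambda>t. g t * of_real (\<phi> t))" "integrable S (\<lambda>t. u t * of_real (deriv \<phi> t))"
    using T by (auto intro!: integrable_mult_continuous[OF g]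
        integrable_mult_continuous[OF integrable_S_continuous[OF cu]] continuous_intros)
  have "integral {a..b} (\<lambda>t. g t * of_real (\<phi> t) + u t * of_real (deriv \<phi> t)) = 0"
    using primitive_of_mult[OF u T(1)] T(2,3) ab by (auto simp: primitive_of_def)
  then have "(\<integral>t. g t * of_real (\<phi> t) + u t * of_real (deriv \<phi> t) \<partial>S) = 0"
    using i by (subst integral_S) auto
  then show "(\<integral>t. u t * of_real (deriv \<phi> t) \<partial>S) = - (\<integral>t. g t * of_real (\<phi> t) \<partial>S)"
    using i by (simp add: add_eq_0_iff)
qed

lemma continuous_AE_eq:
  fixes u v :: "real \<Rightarrow> complex"
  assumes "continuous_on {a..b} u" "continuous_on {a..b} v" "AE t in S. u t = v t" "t \<in> {a..b}"
  shows "u t = v t"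
proof -
  have c: "continuous_on {a..b} (\<lambda>t. norm (u t - v t))" using assms by (intro continuous_intros)
  have "(\<integral>t. norm (u t - v t) \<partial>S) = (\<integral>t. 0 \<partial>S)"
    by (rule integral_cong_AE) (use assms(3) measurable_continuous_S[OF c] in auto)
  then have "integral {a..b} (\<lambda>t. norm (u t - v t)) = 0"
    using integral_S[OF integrable_S_continuous[OF c]] by simp
  then show ?thesis using integral_eq_0_iff[OF c ab] assms(4) by simp
qed

lemma weak_deriv_AE_primitive:
  assumes "has_weak_deriv a b f g"
  obtains c where "AE t in S. f t = c + integral {a..t} g"
proof -
  have f: "integrable S f" and g: "integrable S g" using assms by (auto simp: has_weak_deriv_def)
  define G where "G t = integral {a..t} g" for t
  have G: "has_weak_deriv a b G g"
    using primitive_of_imp_weak[OF primitive_of_indefinite[OF g, of 0]] by (simp add: G_def[abs_def])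
  have cG: "continuous_on {a..b} G" unfolding G_def by (rule continuous_indefinite[OF g])
  have "\<exists>K. AE t in S. f t - G t = K"
  proof (rule du_Bois_Reymond)
    show "integrable S (\<lambda>t. f t - G t)" using f integrable_S_continuous[OF cG] by simp
    fix \<phi> assume \<phi>: "test_function a b \<phi>"
    have c: "continuous_on {a..b} (\<lambda>t. complex_of_real (deriv \<phi> t))"
      by (intro continuous_intros test_function_primitive_of[OF \<phi>])
    have "(\<integral>t. (f t - G t) * of_real (deriv \<phi> t) \<partial>S)
        = (\<integral>t. f t * of_real (deriv \<phi> t) \<partial>S) - (\<integral>t. G t * of_real (deriv \<phi> t) \<partial>S)"
      using integrable_mult_continuous[OF f c] integrable_mult_continuous[OF integrable_S_continuous[OF cG] c]
      by (simp add: left_diff_distrib)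
    then show "(\<integral>t. (f t - G t) * of_real (deriv \<phi> t) \<partial>S) = 0"
      using assms G \<phi> by (simp add: has_weak_deriv_def)
  qed
  then obtain K where "AE t in S. f t - G t = K" by blast
  then have "AE t in S. f t = K + integral {a..t} g"
    by eventually_elim (auto simp: G_def algebra_simps)
  then show ?thesis by (rule that)
qed

lemma weak_deriv_continuous_primitive:
  assumes "has_weak_deriv a b u g" "continuous_on {a..b} u"
  shows "primitive_of u g"
proof -
  have g: "integrable S g" using assms by (auto simp: has_weak_deriv_def)
  obtain c where c: "AE t in S. u t = c + integral {a..t} g" using weak_deriv_AE_primitive[OF assms(1)] .
  have "u t = c + integral {a..t} g" if "t \<in> {a..b}" for t
    by (rule continuous_AE_eq[OF assms(2) _ c that]) (intro continuous_intros continuous_indefinite g)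
  then show ?thesis using g ab by (simp add: primitive_of_def)
qed

lemma weak_deriv_unique:
  assumes "has_weak_deriv a b f g1" "has_weak_deriv a b f g2"
  shows "AE t in S. g1 t = g2 t"
proof -
  have g: "integrable S g1" "integrable S g2" using assms by (auto simp: has_weak_deriv_def)
  obtain c1 where c1: "AE t in S. f t = c1 + integral {a..t} g1" using weak_deriv_AE_primitive[OF assms(1)] .
  obtain c2 where c2: "AE t in S. f t = c2 + integral {a..t} g2" using weak_deriv_AE_primitive[OF assms(2)] .
  have "AE t in S. c1 + integral {a..t} g1 = c2 + integral {a..t} g2"
    using c1 c2 by eventually_elim simp
  then have eq: "c1 + integral {a..t} g1 = c2 + integral {a..t} g2" if "t \<in> {a..b}" for t
    using that by (intro continuous_AE_eq) (auto intro!: continuous_intros continuous_indefinite g)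
  have "c1 = c2" using eq[of a] ab by simp
  then have eq: "integral {a..t} g1 = integral {a..t} g2" if "t \<in> {a..b}" for t using eq[OF that] by simp
  have "AE t in S. g1 t - g2 t = 0"
  proof (rule AE_eq_const_if_integrals)
    fix c d assume cd: "a < c" "c < d" "d < b"
    have sub: "integral {c..d} h = integral {a..d} h - integral {a..c} h" if "integrable S h" for h :: "real \<Rightarrow> complex"
      using Henstock_Kurzweil_Integration.integral_combine[of a c d h] cd integrable_on_sub(2)[OF that, of a d]
      by (simp add: algebra_simps)
    have "integral {c..d} (\<lambda>t. g1 t - g2 t) = integral {c..d} g1 - integral {c..d} g2"
      using integrable_on_sub(2)[OF g(1), of c d] integrable_on_sub(2)[OF g(2), of c d] cd
      by (intro Henstock_Kurzweil_Integration.integral_diff) auto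
    then show "integral {c..d} (\<lambda>t. g1 t - g2 t) = (d - c) *\<^sub>R 0"
      using eq[of c] eq[of d] cd by (simp add: sub[OF g(1)] sub[OF g(2)])
  qed (use g in simp)
  then show ?thesis by simp
qed

lemma weak_deriv_cong1:
  assumes "AE t in S. f t = f' t"
  shows "has_weak_deriv a b f g \<longleftrightarrow> has_weak_deriv a b f' g"
proof -
  have *: "has_weak_deriv a b f' g" if ae: "AE t in S. f t = f' t" and w: "has_weak_deriv a b f g" for f f'
    unfolding has_weak_deriv_def
  proof (intro conjI allI impI)
    have f: "integrable S f" using w by (simp add: has_weak_deriv_def)
    show f': "integrable S f'" by (rule integrable_S_AE[OF f ae])
    show "integrable S g" using w by (simp add: has_weak_deriv_def)
    fix \<phi> assume \<phi>: "test_function a b \<phi>"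
    have c: "continuous_on {a..b} (\<lambda>t. complex_of_real (deriv \<phi> t))"
      by (intro continuous_intros test_function_primitive_of[OF \<phi>])
    have "(\<integral>t. f' t * of_real (deriv \<phi> t) \<partial>S) = (\<integral>t. f t * of_real (deriv \<phi> t) \<partial>S)"
      using integrable_mult_continuous[OF f c] integrable_mult_continuous[OF f' c] ae
      by (intro integral_cong_AE) auto
    then show "(\<integral>t. f' t * of_real (deriv \<phi> t) \<partial>S) = - (\<integral>t. g t * of_real (\<phi> t) \<partial>S)"
      using w \<phi> by (simp add: has_weak_deriv_def)
  qed
  have "AE t in S. f' t = f t" using assms by eventually_elim simp
  then show ?thesis using *[of f f'] *[of f' f] assms by blast
qed

lemma weak_deriv_cong2:
  assumes w: "has_weak_deriv a b f g" and ae: "AE t in S. g t = g' t"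
  shows "has_weak_deriv a b f g'"
proof -
  obtain c where c: "AE t in S. f t = c + integral {a..t} g" using weak_deriv_AE_primitive[OF w] .
  have "primitive_of (\<lambda>t. c + integral {a..t} g) g'"
    by (rule primitive_of_cong[OF primitive_of_indefinite _ ae]) (use w in \<open>simp_all add: has_weak_deriv_def\<close>)
  then show ?thesis using weak_deriv_cong1[OF c] primitive_of_imp_weak by blast
qed

abbreviation D :: "(real \<Rightarrow> complex) \<Rightarrow> real \<Rightarrow> complex" where "D \<equiv> wderiv a b"
abbreviation W :: "nat \<Rightarrow> (real \<Rightarrow> complex) set" where "W \<equiv> sobolev a b p"
abbreviation wnrm :: "nat \<Rightarrow> (real \<Rightarrow> complex) \<Rightarrow> real" where "wnrm \<equiv> sobolev_norm a b p"

lemma wderiv_cong: "AE t in S. f t = f' t \<Longrightarrow> D f = D f'"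
  unfolding wderiv_def by (simp add: weak_deriv_cong1)

lemma wderiv_weak:
  assumes "has_weak_deriv a b f g"
  shows "has_weak_deriv a b f (D f)"
    and "has_weak_deriv a b f h \<Longrightarrow> continuous_on {a..b} h \<Longrightarrow> continuous_on {a..b} (D f)"
proof -
  have "\<exists>g. has_weak_deriv a b f g \<and>
     ((\<exists>h. has_weak_deriv a b f h \<and> continuous_on {a..b} h) \<longrightarrow> continuous_on {a..b} g)"
    using assms by blast
  from someI_ex[OF this]
  show "has_weak_deriv a b f (D f)"
    and "has_weak_deriv a b f h \<Longrightarrow> continuous_on {a..b} h \<Longrightarrow> continuous_on {a..b} (D f)"
    unfolding wderiv_def by blast+
qed

lemma primitive_of_wderiv:
  assumes "primitive_of u g"
  shows "AE t in S. D u t = g t" "primitive_of u (D u)"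
    "continuous_on {a..b} g \<Longrightarrow> continuous_on {a..b} (D u)"
  using primitive_of_imp_weak[OF assms] primitive_of_continuous[OF assms]
    weak_deriv_unique weak_deriv_continuous_primitive wderiv_weak by blast+

lemma sobolev_0: "f \<in> W 0 \<longleftrightarrow> f \<in> L"
  by (simp add: sobolev_def)

lemma sobolev_norm_0: "wnrm 0 f = nrm f"
  by (simp add: sobolev_norm_def)

lemma continuous_Lp: "continuous_on {a..b} f \<Longrightarrow> f \<in> L"
proof -
  assume f: "continuous_on {a..b} f"
  obtain M where M: "\<forall>t\<in>{a..b}. norm (f t) \<le> M"
    using compact_imp_bounded[OF compact_continuous_image[OF f compact_Icc]]
    unfolding bounded_iff by blast
  have "0 \<le> M" using M ab by (auto intro: order_trans[OF norm_ge_zero] dest: bspec[of _ _ a])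
  then obtain C where "Lp_bound f (C * M)"
    using Lp_bound_const M measurable_continuous_S[OF f] by (metis AE_I2 space_S)
  then show ?thesis by (simp add: Lp_bound_iff)
qed

lemma sobolev_Suc_iff: "f \<in> W (Suc n) \<longleftrightarrow> primitive_of f (D f) \<and> D f \<in> W n"
proof
  assume f: "f \<in> W (Suc n)"
  then have c: "continuous_on {a..b} f"
    and w: "\<And>k. k < Suc n \<Longrightarrow> \<exists>g. has_weak_deriv a b ((D ^^ k) f) g"
    and l: "\<And>k. k \<le> Suc n \<Longrightarrow> (D ^^ k) f \<in> L"
    by (auto simp: sobolev_def)
  obtain g where "has_weak_deriv a b f g" using w[of 0] by auto
  then have wf: "has_weak_deriv a b f (D f)" by (rule wderiv_weak)
  then have P: "primitive_of f (D f)" using c by (rule weak_deriv_continuous_primitive)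
  have "continuous_on {a..b} (D f)" if n0: "n > 0"
  proof -
    obtain h where h: "has_weak_deriv a b (D f) h" using w[of 1] n0 by auto
    then obtain c where c: "AE t in S. D f t = c + integral {a..t} h" by (rule weak_deriv_AE_primitive)
    have ih: "integrable S h" using h by (simp add: has_weak_deriv_def)
    show ?thesis
      by (rule wderiv_weak(2)[OF wf weak_deriv_cong2[OF wf c]])
        (intro continuous_intros continuous_indefinite ih)
  qed
  moreover have "\<exists>g. has_weak_deriv a b ((D ^^ k) (D f)) g" if "k < n" for k
    using w[of "Suc k"] that by (simp add: funpow_swap1)
  moreover have "(D ^^ k) (D f) \<in> L" if "k \<le> n" for k
    using l[of "Suc k"] that by (simp add: funpow_swap1)
  ultimately show "primitive_of f (D f) \<and> D f \<in> W n" using P by (auto simp: sobolev_def)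
next
  assume f: "primitive_of f (D f) \<and> D f \<in> W n"
  then have c: "continuous_on {a..b} f" by (auto intro: primitive_of_continuous)
  have "\<exists>g. has_weak_deriv a b ((D ^^ k) f) g" if "k < Suc n" for k
    using f primitive_of_imp_weak[of f "D f"] that
    by (cases k) (auto simp: sobolev_def funpow_swap1)
  moreover have "(D ^^ k) f \<in> L" if "k \<le> Suc n" for k
    using f continuous_Lp[OF c] that by (cases k) (auto simp: sobolev_def funpow_swap1)
  ultimately show "f \<in> W (Suc n)" using c by (auto simp: sobolev_def)
qed

lemma sobolev_norm_Suc: "wnrm (Suc n) f = nrm f + wnrm n (D f)"
  unfolding sobolev_norm_def by (subst sum.atMost_Suc_shift) (simp add: funpow_swap1)

lemma sobolev_continuous: "f \<in> W n \<Longrightarrow> n > 0 \<Longrightarrow> continuous_on {a..b} f"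
  by (simp add: sobolev_def)

lemma sobolev_Lp: "f \<in> W n \<Longrightarrow> f \<in> L"
  by (force simp: sobolev_def)

lemma sobolev_cong:
  assumes f: "f \<in> W n" and ae: "AE t in S. f t = f' t" and c: "n > 0 \<Longrightarrow> continuous_on {a..b} f'"
  shows "f' \<in> W n"
proof (cases n)
  case 0
  then show ?thesis using f Lp_cong_AE(1)[OF _ ae] by (simp add: sobolev_0)
next
  case (Suc k)
  have "f t = f' t" if "t \<in> {a..b}" for t
    using continuous_AE_eq[OF sobolev_continuous[OF f] c ae that] Suc by simp
  then have "primitive_of f' (D f)"
    using f Suc primitive_of_cong[of f "D f" f' "D f"] by (simp add: sobolev_Suc_iff)
  then show ?thesis using f Suc wderiv_cong[OF ae] by (simp add: sobolev_Suc_iff)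
qed

lemma sobolev_norm_cong: "f \<in> W n \<Longrightarrow> AE t in S. f t = f' t \<Longrightarrow> wnrm n f' = wnrm n f"
  using Lp_cong_AE(2)[of f f'] sobolev_Lp wderiv_cong[of f f']
  by (cases n) (simp_all add: sobolev_norm_0 sobolev_norm_Suc)

lemma sobolev_SucI:
  assumes u: "primitive_of u g" and g: "g \<in> W n"
  shows "u \<in> W (Suc n)" "wnrm (Suc n) u = nrm u + wnrm n g"
proof -
  note P = primitive_of_wderiv[OF u]
  have ae: "AE t in S. g t = D u t" using P(1) by eventually_elim simp
  have "D u \<in> W n" by (rule sobolev_cong[OF g ae]) (use P(3) sobolev_continuous[OF g] in auto)
  then show "u \<in> W (Suc n)" using P(2) by (simp add: sobolev_Suc_iff)
  show "wnrm (Suc n) u = nrm u + wnrm n g"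
    using sobolev_norm_cong[OF g ae] by (simp add: sobolev_norm_Suc)
qed

section \<open>Scalar Sobolev spaces\<close>

lemma Lp_norm_cmult: "f \<in> L \<Longrightarrow> nrm (\<lambda>t. c * f t) = cmod c * nrm f"
proof (cases "c = 0")
  case False
  assume f: "f \<in> L"
  have "nrm f = nrm (\<lambda>t. inverse c * (c * f t))" using False by (simp flip: mult.assoc)
  also have "\<dots> \<le> cmod (inverse c) * nrm (\<lambda>t. c * f t)" by (rule Lp_cmult(2)[OF Lp_cmult(1)[OF f]])
  finally have "cmod c * nrm f \<le> nrm (\<lambda>t. c * f t)"
    using False by (simp add: norm_inverse norm_divide field_simps)
  then show ?thesis using Lp_cmult(2)[OF f, of c] by simp
qed (simp add: Lp_zero)

lemma sobolev_norm_nonneg: "f \<in> W n \<Longrightarrow> 0 \<le> wnrm n f"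
  unfolding sobolev_norm_def by (intro sum_nonneg Lp_norm_nonneg) (simp add: sobolev_def)

lemma Lp_norm_le_sobolev: "f \<in> W n \<Longrightarrow> nrm f \<le> wnrm n f"
  by (cases n) (auto simp: sobolev_norm_0 sobolev_norm_Suc sobolev_Suc_iff sobolev_norm_nonneg)

lemma sobolev_mono:
  assumes "f \<in> W n" "m \<le> n"
  shows "f \<in> W m" "wnrm m f \<le> wnrm n f"
proof -
  show "f \<in> W m" using assms by (auto simp: sobolev_def)
  show "wnrm m f \<le> wnrm n f" unfolding sobolev_norm_def
    using assms by (intro sum_mono2) (auto intro!: Lp_norm_nonneg simp: sobolev_def)
qed

lemma sobolev_add:
  "f \<in> W n \<Longrightarrow> g \<in> W n \<Longrightarrow>
    (\<lambda>t. f t + g t) \<in> W n \<and> wnrm n (\<lambda>t. f t + g t) \<le> wnrm n f + wnrm n g"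
proof (induction n arbitrary: f g)
  case 0
  then show ?case using Lp_add by (simp add: sobolev_0 sobolev_norm_0)
next
  case (Suc n)
  then have f: "primitive_of f (D f)" "D f \<in> W n" and g: "primitive_of g (D g)" "D g \<in> W n"
    by (auto simp: sobolev_Suc_iff)
  note S = sobolev_SucI[OF primitive_of_add[OF f(1) g(1)] conjunct1[OF Suc.IH[OF f(2) g(2)]]]
  have "nrm (\<lambda>t. f t + g t) \<le> nrm f + nrm g" by (intro Lp_add sobolev_Lp[OF Suc.prems(1)] sobolev_Lp[OF Suc.prems(2)])
  then show ?case using S Suc.IH[OF f(2) g(2)] by (simp add: sobolev_norm_Suc)
qed

lemma sobolev_cmult:
  "f \<in> W n \<Longrightarrow> (\<lambda>t. c * f t) \<in> W n \<and> wnrm n (\<lambda>t. c * f t) = cmod c * wnrm n f"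
proof (induction n arbitrary: f)
  case 0
  then show ?case using Lp_cmult(1) Lp_norm_cmult by (simp add: sobolev_0 sobolev_norm_0)
next
  case (Suc n)
  then have f: "primitive_of f (D f)" "D f \<in> W n"
    by (auto simp: sobolev_Suc_iff)
  note S = sobolev_SucI[OF primitive_of_cmult[OF f(1)] conjunct1[OF Suc.IH[OF f(2)]]]
  show ?case using S Suc.IH[OF f(2)] Lp_norm_cmult[OF sobolev_Lp[OF Suc.prems], of c]
    by (simp add: sobolev_norm_Suc distrib_left)
qed

lemma sobolev_diff:
  assumes "f \<in> W n" "g \<in> W n"
  shows "(\<lambda>t. f t - g t) \<in> W n" "wnrm n (\<lambda>t. f t - g t) \<le> wnrm n f + wnrm n g"
  using sobolev_add[OF assms(1) conjunct1[OF sobolev_cmult[OF assms(2), of "-1"]]]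
    sobolev_cmult[OF assms(2), of "-1"] by auto

lemma sobolev_zero: "(\<lambda>t. 0) \<in> W n \<and> wnrm n (\<lambda>t. 0) = 0"
proof (induction n)
  case 0
  then show ?case by (simp add: sobolev_0 sobolev_norm_0 Lp_zero)
next
  case (Suc n)
  have "primitive_of (\<lambda>t. 0) (\<lambda>t. 0)" by (simp add: primitive_of_def)
  from sobolev_SucI[OF this conjunct1[OF Suc]] show ?case using Suc by (simp add: Lp_zero)
qed

lemma sobolev_sum:
  assumes "finite X" "\<And>i. i \<in> X \<Longrightarrow> f i \<in> W n"
  shows "(\<lambda>t. \<Sum>i\<in>X. f i t) \<in> W n \<and> wnrm n (\<lambda>t. \<Sum>i\<in>X. f i t) \<le> (\<Sum>i\<in>X. wnrm n (f i))"
  using assms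
proof (induction rule: finite_induct)
  case (insert x X)
  then have IH: "(\<lambda>t. \<Sum>i\<in>X. f i t) \<in> W n" "wnrm n (\<lambda>t. \<Sum>i\<in>X. f i t) \<le> (\<Sum>i\<in>X. wnrm n (f i))"
    by auto
  show ?case using sobolev_add[OF insert.prems[of x] IH(1)] IH(2) insert.hyps by simp
qed (simp add: sobolev_zero)

lemma wderiv_pow_mem: "f \<in> W n \<Longrightarrow> k \<le> n \<Longrightarrow> (D ^^ k) f \<in> W (n - k) \<and> wnrm (n - k) ((D ^^ k) f) \<le> wnrm n f"
proof (induction k)
  case (Suc k)
  then have IH: "(D ^^ k) f \<in> W (Suc (n - Suc k))" "wnrm (Suc (n - Suc k)) ((D ^^ k) f) \<le> wnrm n f"
    by (auto simp: Suc_diff_Suc)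
  then show ?case using Lp_norm_nonneg[OF sobolev_Lp[OF IH(1)]] by (simp add: sobolev_Suc_iff sobolev_norm_Suc)
qed simp

lemma wderiv_pow_primitive:
  assumes "f \<in> W n" "k < n"
  shows "primitive_of ((D ^^ k) f) ((D ^^ Suc k) f)"
  using wderiv_pow_mem[OF assms(1), of k] assms(2) by (auto simp: sobolev_Suc_iff Suc_diff_Suc[symmetric])

lemma wderiv_pow_cong_AE: "AE t in S. f t = g t \<Longrightarrow> AE t in S. (D ^^ k) f t = (D ^^ k) g t"
  using wderiv_cong[of f g] by (cases k) (simp_all del: funpow.simps add: funpow_Suc_right)

lemma wderiv_add_AE:
  assumes "f \<in> W (Suc n)" "g \<in> W (Suc n)"
  shows "AE t in S. D (\<lambda>t. f t + g t) t = D f t + D g t"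
  using assms by (intro primitive_of_wderiv(1) primitive_of_add) (auto simp: sobolev_Suc_iff)

lemma wderiv_cmult_AE:
  assumes "f \<in> W (Suc n)"
  shows "AE t in S. D (\<lambda>t. c * f t) t = c * D f t"
  using assms by (intro primitive_of_wderiv(1) primitive_of_cmult) (auto simp: sobolev_Suc_iff)

lemma wderiv_pow_add_AE:
  "f \<in> W n \<Longrightarrow> g \<in> W n \<Longrightarrow> k \<le> n \<Longrightarrow>
    AE t in S. (D ^^ k) (\<lambda>t. f t + g t) t = (D ^^ k) f t + (D ^^ k) g t"
proof (induction k arbitrary: f g n)
  case (Suc k)
  then obtain m where m: "n = Suc m" "k \<le> m" by (cases n) auto
  then have fg: "D f \<in> W m" "D g \<in> W m" using Suc.prems by (auto simp: sobolev_Suc_iff)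
  have "AE t in S. (D ^^ k) (D (\<lambda>t. f t + g t)) t = (D ^^ k) (\<lambda>t. D f t + D g t) t"
    by (intro wderiv_pow_cong_AE wderiv_add_AE[where n=m]) (use Suc.prems m in auto)
  with Suc.IH[OF fg m(2)]
  have "AE t in S. (D ^^ k) (D (\<lambda>t. f t + g t)) t = (D ^^ k) (D f) t + (D ^^ k) (D g) t"
    by eventually_elim simp
  then show ?case by (simp add: funpow_Suc_right del: funpow.simps)
qed simp

lemma wderiv_pow_cmult_AE:
  "f \<in> W n \<Longrightarrow> k \<le> n \<Longrightarrow> AE t in S. (D ^^ k) (\<lambda>t. c * f t) t = c * (D ^^ k) f t"
proof (induction k arbitrary: f n)
  case (Suc k)
  then obtain m where m: "n = Suc m" "k \<le> m" by (cases n) auto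
  then have f: "D f \<in> W m" using Suc.prems by (auto simp: sobolev_Suc_iff)
  have "AE t in S. (D ^^ k) (D (\<lambda>t. c * f t)) t = (D ^^ k) (\<lambda>t. c * D f t) t"
    by (intro wderiv_pow_cong_AE wderiv_cmult_AE[where n=m]) (use Suc.prems m in auto)
  with Suc.IH[OF f m(2)]
  have "AE t in S. (D ^^ k) (D (\<lambda>t. c * f t)) t = c * (D ^^ k) (D f) t"
    by eventually_elim simp
  then show ?case by (simp add: funpow_Suc_right del: funpow.simps)
qed simp

lemma wderiv_pow_diff_AE:
  assumes "f \<in> W n" "g \<in> W n" "k \<le> n"
  shows "AE t in S. (D ^^ k) (\<lambda>t. f t - g t) t = (D ^^ k) f t - (D ^^ k) g t"
proof -
  have "AE t in S. (D ^^ k) (\<lambda>t. f t + (-1) * g t) t = (D ^^ k) f t + (D ^^ k) (\<lambda>t. (-1) * g t) t"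
    using assms by (intro wderiv_pow_add_AE[where n=n] conjunct1[OF sobolev_cmult])
  with wderiv_pow_cmult_AE[OF assms(2,3), of "-1"] show ?thesis
    by eventually_elim simp
qed

lemma norm_integral_le:
  fixes g :: "real \<Rightarrow> complex"
  assumes g: "integrable S g" and st: "a \<le> s" "t \<le> b"
  shows "norm (integral {s..t} g) \<le> (\<integral>x. norm (g x) \<partial>S)"
proof -
  have "norm (integral {s..t} g) \<le> integral {s..t} (\<lambda>x. norm (g x))"
    using integrable_on_sub(1)[OF g st]
    by (intro integral_norm_bound_integral) (auto simp: absolutely_integrable_on_def)
  also have "\<dots> \<le> integral {a..b} (\<lambda>x. norm (g x))"
    using integrable_on_sub(2)[OF integrable_norm[OF g] st] integrable_on_sub(2)[OF integrable_norm[OF g], of a b] st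
    by (intro integral_subset_le) auto
  also have "\<dots> = (\<integral>x. norm (g x) \<partial>S)" by (rule integral_S[symmetric]) (use g in simp)
  finally show ?thesis .
qed

lemma primitive_of_bound:
  assumes "primitive_of u g" "g \<in> L" "s \<in> {a..b}" "t \<in> {a..b}"
  shows "cmod (u t - u s) \<le> (b - a + 1) * nrm g"
proof -
  have *: "cmod (u t - u s) \<le> (b - a + 1) * nrm g" if "s \<in> {a..b}" "t \<in> {a..b}" "s \<le> t" for s t
  proof -
    have "integral {a..s} g = u s - u a" "integral {a..t} g = u t - u a" "g integrable_on {a..t}"
      using assms(1) that integrable_on_sub(2)[of g a t] by (auto simp: primitive_of_def)
    moreover from this have "integral {a..s} g + integral {s..t} g = integral {a..t} g"
      using that by (intro Henstock_Kurzweil_Integration.integral_combine) auto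
    then have "integral {s..t} g = integral {a..t} g - integral {a..s} g" by (simp add: eq_diff_eq add.commute)
    ultimately have "integral {s..t} g = u t - u s" by simp
    then show ?thesis using norm_integral_le[of g s t] Lp_L1[OF assms(2)] assms(1) that
      by (auto simp: primitive_of_def)
  qed
  show ?thesis using *[of s t] *[of t s] assms(3,4) by (cases "s \<le> t") (auto simp: norm_minus_commute)
qed

lemma primitive_of_sup_bound:
  assumes u: "primitive_of u g" and g: "g \<in> L" and t: "t \<in> {a..b}"
  shows "(b - a) * cmod (u t) \<le> (b - a + 1) * (nrm u + (b - a) * nrm g)"
proof -
  note c = primitive_of_continuous[OF u]
  have uL: "u \<in> L" by (rule continuous_Lp[OF c])
  have "(b - a) * cmod (u t) = (\<integral>s. cmod (u t) \<partial>S)" using measure_S by simp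
  also have "\<dots> \<le> (\<integral>s. cmod (u s) + (b - a + 1) * nrm g \<partial>S)"
  proof (rule integral_mono)
    show "integrable S (\<lambda>s. cmod (u s) + (b - a + 1) * nrm g)" using Lp_integrable[OF uL] by simp
    fix s assume "s \<in> space S"
    then have "cmod (u t - u s) \<le> (b - a + 1) * nrm g" using primitive_of_bound[OF u g _ t] by simp
    then show "cmod (u t) \<le> cmod (u s) + (b - a + 1) * nrm g"
      using norm_triangle_ineq2[of "u t" "u s"] by linarith
  qed simp
  also have "\<dots> = (\<integral>s. cmod (u s) \<partial>S) + (b - a) * ((b - a + 1) * nrm g)"
    using Lp_integrable[OF uL] measure_S by simp
  also have "\<dots> \<le> (b - a + 1) * nrm u + (b - a) * ((b - a + 1) * nrm g)"
    using Lp_L1[OF uL] by simp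
  finally show ?thesis by (simp add: algebra_simps)
qed

lemma sobolev_embedding:
  "\<exists>C>0. \<forall>n f t. f \<in> W (Suc n) \<longrightarrow> t \<in> {a..b} \<longrightarrow> cmod (f t) \<le> C * wnrm (Suc n) f"
proof (intro exI conjI allI impI)
  let ?C = "(b - a + 1) * (1 + (b - a)) / (b - a)"
  show "?C > 0" using ab by simp
  fix n f t assume f: "f \<in> W (Suc n)" and t: "t \<in> {a..b}"
  then have P: "primitive_of f (D f)" "D f \<in> W n" by (auto simp: sobolev_Suc_iff)
  have nn: "0 \<le> nrm f" "0 \<le> nrm (D f)" "nrm (D f) \<le> wnrm n (D f)"
    using f P(2) sobolev_Lp Lp_norm_nonneg Lp_norm_le_sobolev by blast+
  have "(b - a) * cmod (f t) \<le> (b - a + 1) * (nrm f + (b - a) * nrm (D f))"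
    by (rule primitive_of_sup_bound[OF P(1) sobolev_Lp[OF P(2)] t])
  also have "\<dots> \<le> (b - a + 1) * ((1 + (b - a)) * wnrm (Suc n) f)"
  proof (rule mult_left_mono)
    have "nrm f + (b - a) * nrm (D f) \<le> (1 + (b - a)) * nrm f + (1 + (b - a)) * wnrm n (D f)"
      using nn ab by (intro add_mono mult_mono) (auto simp: distrib_right)
    then show "nrm f + (b - a) * nrm (D f) \<le> (1 + (b - a)) * wnrm (Suc n) f"
      by (simp add: sobolev_norm_Suc distrib_left)
  qed (use ab in auto)
  finally show "cmod (f t) \<le> ?C * wnrm (Suc n) f"
    using ab by (simp add: field_simps)
qed

lemma primitive_of_norm_bound:
  "\<exists>C>0. \<forall>u g. primitive_of u g \<longrightarrow> g \<in> L \<longrightarrow> nrm u \<le> C * (cmod (u a) + nrm g)"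
proof -
  obtain C where C: "C > 0" "\<And>f M. f \<in> borel_measurable S \<Longrightarrow> 0 \<le> M \<Longrightarrow>
      (AE t in S. cmod (f t) \<le> M) \<Longrightarrow> Lp_bound f (C * M)" using Lp_bound_const by blast
  show ?thesis
  proof (intro exI conjI allI impI)
    show "C * (b - a + 1) > 0" using C ab by simp
    fix u g assume u: "primitive_of u g" and g: "g \<in> L"
    have "cmod (u t) \<le> (b - a + 1) * (cmod (u a) + nrm g)" if "t \<in> {a..b}" for t
    proof -
      have "cmod (u t - u a) \<le> (b - a + 1) * nrm g" using primitive_of_bound[OF u g _ that, of a] ab by simp
      moreover have "cmod (u t) \<le> cmod (u a) + cmod (u t - u a)" by (rule norm_triangle_sub)
      moreover have "cmod (u a) \<le> (b - a + 1) * cmod (u a)"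
        using ab mult_right_mono[of 1 "b - a + 1" "cmod (u a)"] by simp
      ultimately show ?thesis by (simp add: distrib_left)
    qed
    then have "Lp_bound u (C * ((b - a + 1) * (cmod (u a) + nrm g)))"
      using Lp_norm_nonneg[OF g] ab measurable_continuous_S[OF primitive_of_continuous[OF u]]
      by (intro C) auto
    then show "nrm u \<le> C * (b - a + 1) * (cmod (u a) + nrm g)"
      by (simp add: Lp_bound_iff mult.assoc)
  qed
qed

lemma sobolev_mult:
  "\<exists>C>0. \<forall>u v. u \<in> W n \<longrightarrow> v \<in> W (max n 1) \<longrightarrow>
    (\<lambda>t. u t * v t) \<in> W n \<and> wnrm n (\<lambda>t. u t * v t) \<le> C * wnrm n u * wnrm (max n 1) v"
proof -
  obtain E where E: "E > 0" "\<And>n f t. f \<in> W (Suc n) \<Longrightarrow> t \<in> {a..b} \<Longrightarrow> cmod (f t) \<le> E * wnrm (Suc n) f"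
    using sobolev_embedding by blast
  have base: "(\<lambda>t. u t * v t) \<in> L \<and> nrm (\<lambda>t. u t * v t) \<le> E * wnrm (Suc m) v * nrm u"
    if u: "u \<in> L" and v: "v \<in> W (Suc m)" for u v m
  proof -
    have "AE t in S. cmod (v t) \<le> E * wnrm (Suc m) v"
      using E(2)[OF v] by (intro AE_I2) simp
    note B = Lp_bounded_mult[OF u measurable_continuous_S[OF sobolev_continuous[OF v]] this]
    have "(\<lambda>t. v t * u t) \<in> L" "nrm (\<lambda>t. v t * u t) \<le> E * wnrm (Suc m) v * nrm u"
      using B by auto
    then show ?thesis by (simp add: mult.commute)
  qed
  show ?thesis
  proof (induction n)
    case 0
    show ?case
      by (intro exI[of _ E]) (use E(1) base[of _ _ 0] in \<open>auto simp: sobolev_0 sobolev_norm_0 mult_ac\<close>)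
  next
    case (Suc n)
    then obtain C where C: "C > 0" "\<And>u v. u \<in> W n \<Longrightarrow> v \<in> W (max n 1) \<Longrightarrow>
      (\<lambda>t. u t * v t) \<in> W n \<and> wnrm n (\<lambda>t. u t * v t) \<le> C * wnrm n u * wnrm (max n 1) v" by blast
    have C': "(\<lambda>t. D u t * v t) \<in> W n \<and> wnrm n (\<lambda>t. D u t * v t) \<le> C * wnrm (Suc n) u * wnrm (Suc n) v"
      if u: "u \<in> W (Suc n)" and v: "v \<in> W (Suc n)" for u v
    proof -
      have Du: "D u \<in> W n" "wnrm n (D u) \<le> wnrm (Suc n) u"
        using u Lp_norm_nonneg[OF sobolev_Lp[OF u]] by (auto simp: sobolev_Suc_iff sobolev_norm_Suc)
      have v': "v \<in> W (max n 1)" "wnrm (max n 1) v \<le> wnrm (Suc n) v"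
        by (rule sobolev_mono[OF v], simp)+
      have "C * wnrm n (D u) * wnrm (max n 1) v \<le> C * wnrm (Suc n) u * wnrm (Suc n) v"
        using Du v' C(1) sobolev_norm_nonneg u v by (intro mult_mono) auto
      then show ?thesis using C(2)[OF Du(1) v'(1)] by linarith
    qed
    show ?case
    proof (intro exI conjI allI impI)
      show "E + C + C > 0" using E(1) C(1) by simp
      fix u v assume u: "u \<in> W (Suc n)" and "v \<in> W (max (Suc n) 1)"
      then have v: "v \<in> W (Suc n)" by simp
      have P: "primitive_of u (D u)" "primitive_of v (D v)" using u v by (auto simp: sobolev_Suc_iff)
      have c1: "(\<lambda>t. D u t * v t) \<in> W n" "wnrm n (\<lambda>t. D u t * v t) \<le> C * wnrm (Suc n) u * wnrm (Suc n) v"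
        using C'[OF u v] by auto
      have c2: "(\<lambda>t. u t * D v t) \<in> W n" "wnrm n (\<lambda>t. u t * D v t) \<le> C * wnrm (Suc n) u * wnrm (Suc n) v"
        using C'[OF v u] by (auto simp: mult_ac)
      note a = sobolev_add[OF c1(1) c2(1)]
      note S = sobolev_SucI[OF primitive_of_mult[OF P] conjunct1[OF a]]
      show "(\<lambda>t. u t * v t) \<in> W (Suc n)" by (rule S(1))
      have "nrm (\<lambda>t. u t * v t) \<le> E * wnrm (Suc n) v * nrm u"
        using base[OF sobolev_Lp[OF u] v] by simp
      also have "\<dots> \<le> E * wnrm (Suc n) v * wnrm (Suc n) u"
        using E(1) sobolev_norm_nonneg[OF v] Lp_norm_le_sobolev[OF u] by (intro mult_left_mono) auto
      finally have "nrm (\<lambda>t. u t * v t) \<le> E * wnrm (Suc n) u * wnrm (Suc n) v" by (simp add: mult_ac)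
      then show "wnrm (Suc n) (\<lambda>t. u t * v t) \<le> (E + C + C) * wnrm (Suc n) u * wnrm (max (Suc n) 1) v"
        using S(2) a c1(2) c2(2) by (simp add: distrib_right)
    qed
  qed
qed

lemma sobolev_complete:
  assumes "\<And>k. u k \<in> W n"
    and "\<And>e. e > 0 \<Longrightarrow> \<exists>N. \<forall>i\<ge>N. \<forall>j\<ge>N. wnrm n (\<lambda>t. u i t - u j t) < e"
  shows "\<exists>f. f \<in> W n \<and> (\<lambda>k. wnrm n (\<lambda>t. u k t - f t)) \<longlonglongrightarrow> 0"
  using assms
proof (induction n arbitrary: u)
  case 0
  have "u k \<in> L" for k using 0(1) by (simp add: sobolev_0)
  then obtain f where "f \<in> L" "(\<lambda>k. nrm (\<lambda>t. u k t - f t)) \<longlonglongrightarrow> 0"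
    by (rule Lp_complete[OF _ 0(2)[unfolded sobolev_norm_0]])
  then show ?case by (auto simp: sobolev_0 sobolev_norm_0)
next
  case (Suc n)
  obtain E where E: "E > 0" "\<And>n f t. f \<in> W (Suc n) \<Longrightarrow> t \<in> {a..b} \<Longrightarrow> cmod (f t) \<le> E * wnrm (Suc n) f"
    using sobolev_embedding by blast
  obtain C where C: "C > 0" "\<And>u g. primitive_of u g \<Longrightarrow> g \<in> L \<Longrightarrow> nrm u \<le> C * (cmod (u a) + nrm g)"
    using primitive_of_norm_bound by blast
  have u: "primitive_of (u k) (D (u k))" "D (u k) \<in> W n" for k
    using Suc.prems(1)[of k] by (auto simp: sobolev_Suc_iff)
  have d: "(\<lambda>t. u i t - u j t) \<in> W (Suc n)" for i j by (intro sobolev_diff Suc.prems)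
  have Dd: "wnrm n (\<lambda>t. D (u i) t - D (u j) t) \<le> wnrm (Suc n) (\<lambda>t. u i t - u j t)" for i j
  proof -
    have "AE t in S. D (\<lambda>t. u i t - u j t) t = D (u i) t - D (u j) t"
      using wderiv_pow_diff_AE[OF Suc.prems(1) Suc.prems(1), of 1 i j] by simp
    moreover have "D (\<lambda>t. u i t - u j t) \<in> W n" using d by (simp add: sobolev_Suc_iff)
    ultimately have "wnrm n (\<lambda>t. D (u i) t - D (u j) t) = wnrm n (D (\<lambda>t. u i t - u j t))"
      by (intro sobolev_norm_cong)
    then show ?thesis using Lp_norm_nonneg[OF sobolev_Lp[OF d]] by (simp add: sobolev_norm_Suc)
  qed
  obtain g where g: "g \<in> W n" "(\<lambda>k. wnrm n (\<lambda>t. D (u k) t - g t)) \<longlonglongrightarrow> 0"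
    using Suc.IH[of "\<lambda>k. D (u k)", OF u(2)] Suc.prems(2) Dd by (meson le_less_trans)
  have "Cauchy (\<lambda>k. u k a)"
  proof (rule metric_CauchyI)
    fix e :: real assume e: "e > 0"
    then obtain N where N: "\<And>i j. i \<ge> N \<Longrightarrow> j \<ge> N \<Longrightarrow> wnrm (Suc n) (\<lambda>t. u i t - u j t) < e / E"
      using Suc.prems(2)[of "e / E"] E(1) by auto
    have "dist (u i a) (u j a) < e" if "i \<ge> N" "j \<ge> N" for i j
    proof -
      have "dist (u i a) (u j a) \<le> E * wnrm (Suc n) (\<lambda>t. u i t - u j t)"
        using E(2)[OF d, of a i j] ab by (simp add: dist_norm)
      also have "\<dots> < e" using N[OF that] E(1) by (simp add: field_simps)
      finally show ?thesis .
    qed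
    then show "\<exists>N. \<forall>i\<ge>N. \<forall>j\<ge>N. dist (u i a) (u j a) < e" by blast
  qed
  then obtain c where c: "(\<lambda>k. u k a) \<longlonglongrightarrow> c" using Cauchy_convergent by (auto simp: convergent_def)
  define f where "f t = c + integral {a..t} g" for t
  have f: "primitive_of f g"
    unfolding f_def[abs_def] by (rule primitive_of_indefinite[OF Lp_integrable[OF sobolev_Lp[OF g(1)]]])
  have fa: "f a = c" by (simp add: f_def)
  have pk: "primitive_of (\<lambda>t. u k t - f t) (\<lambda>t. D (u k) t - g t)" for k
    using primitive_of_add[OF u(1) primitive_of_cmult[OF f, of "-1"]] by simp
  have gk: "(\<lambda>t. D (u k) t - g t) \<in> W n" for k by (intro sobolev_diff u g)
  have le: "wnrm (Suc n) (\<lambda>t. u k t - f t) \<le> C * (cmod (u k a - c) + wnrm n (\<lambda>t. D (u k) t - g t))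
      + wnrm n (\<lambda>t. D (u k) t - g t)" for k
  proof -
    have "nrm (\<lambda>t. u k t - f t) \<le> C * (cmod (u k a - f a) + nrm (\<lambda>t. D (u k) t - g t))"
      by (rule C(2)[OF pk sobolev_Lp[OF gk]])
    also have "\<dots> \<le> C * (cmod (u k a - c) + wnrm n (\<lambda>t. D (u k) t - g t))"
      using C(1) Lp_norm_le_sobolev[OF gk] by (intro mult_left_mono) (auto simp: fa)
    finally show ?thesis using sobolev_SucI(2)[OF pk gk] by simp
  qed
  have "(\<lambda>k. C * (cmod (u k a - c) + wnrm n (\<lambda>t. D (u k) t - g t)) + wnrm n (\<lambda>t. D (u k) t - g t))
      \<longlonglongrightarrow> C * (cmod (c - c) + 0) + 0"
    by (intro tendsto_intros c g)
  then have "(\<lambda>k. wnrm (Suc n) (\<lambda>t. u k t - f t)) \<longlonglongrightarrow> 0"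
    using sobolev_norm_nonneg[OF sobolev_SucI(1)[OF pk gk]] le
    by (intro tendsto_sandwich[OF _ _ tendsto_const, of _ "\<lambda>k. wnrm (Suc n) (\<lambda>t. u k t - f t)"]) (auto intro: always_eventually)
  then show ?case using sobolev_SucI(1)[OF f g(1)] by blast
qed

section \<open>Vector-valued functions and the a priori estimate\<close>

text \<open>Induction over the levels of the primitive of \<open>\<phi>\<close>: between two levels \<open>\<phi>\<close> has mass at most one
  half, so that the maximum of \<open>U\<close> can be absorbed.\<close>

lemma Gronwall:
  fixes \<phi> :: "real \<Rightarrow> real"
  assumes \<phi>: "integrable S \<phi>" "\<And>t. 0 \<le> \<phi> t"
  shows "\<exists>M>0. \<forall>U K. continuous_on {a..b} U \<longrightarrow> 0 \<le> K \<longrightarrow> (\<forall>t\<in>{a..b}. 0 \<le> U t) \<longrightarrow>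
    (\<forall>t\<in>{a..b}. U t \<le> K + integral {a..t} (\<lambda>s. \<phi> s * U s)) \<longrightarrow> (\<forall>t\<in>{a..b}. U t \<le> M * K)"
proof -
  define \<Phi> where "\<Phi> t = integral {a..t} \<phi>" for t
  have ip: "\<phi> integrable_on {c..d}" if "a \<le> c" "d \<le> b" for c d
    using integrable_on_sub(2)[OF \<phi>(1)] that by blast
  have \<Phi>c: "continuous_on {a..b} \<Phi>"
    unfolding \<Phi>_def[abs_def] by (rule indefinite_integral_continuous_1[OF ip]) auto
  have \<Phi>d: "integral {c..d} \<phi> = \<Phi> d - \<Phi> c" if "a \<le> c" "c \<le> d" "d \<le> b" for c d
    using Henstock_Kurzweil_Integration.integral_combine[of a c d \<phi>] ip[of a d] that
    by (simp add: \<Phi>_def algebra_simps)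
  have \<Phi>m: "\<Phi> c \<le> \<Phi> d" if "a \<le> c" "c \<le> d" "d \<le> b" for c d
    using \<Phi>d[OF that] integral_nonneg[OF ip[of c d]] \<phi>(2) that by auto
  have \<Phi>a: "\<Phi> a = 0" by (simp add: \<Phi>_def)
  have \<Phi>0: "0 \<le> \<Phi> t" if "t \<in> {a..b}" for t using \<Phi>m[of a t] that \<Phi>a by simp
  have seg: "integral {c..d} (\<lambda>s. \<phi> s * U s) \<le> R * (\<Phi> d - \<Phi> c)"
    if U: "continuous_on {a..b} U" and cd: "a \<le> c" "c \<le> d" "d \<le> b" and R: "\<And>s. s \<in> {c..d} \<Longrightarrow> U s \<le> R"
    for U c d R
  proof -
    have "integral {c..d} (\<lambda>s. \<phi> s * U s) \<le> integral {c..d} (\<lambda>s. R * \<phi> s)"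
      using integrable_on_sub(2)[OF integrable_mult_continuous[OF \<phi>(1) U], of c d] ip[of c d] cd R \<phi>(2)
      by (intro integral_le integrable_on_mult_right) (auto simp: mult.commute intro: mult_right_mono)
    then show ?thesis using \<Phi>d[OF cd] by simp
  qed
  have comb: "integral {a..d} (\<lambda>s. \<phi> s * U s)
      = integral {a..c} (\<lambda>s. \<phi> s * U s) + integral {c..d} (\<lambda>s. \<phi> s * U s)"
    if U: "continuous_on {a..b} U" and cd: "a \<le> c" "c \<le> d" "d \<le> b" for U c d
    by (rule Henstock_Kurzweil_Integration.integral_combine[symmetric, OF cd(1,2)])
      (use integrable_on_sub(2)[OF integrable_mult_continuous[OF \<phi>(1) U], of a d] cd in auto)
  let ?H = "\<lambda>U K. continuous_on {a..b} U \<and> 0 \<le> K \<and> (\<forall>t\<in>{a..b}. 0 \<le> U t) \<and>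
      (\<forall>t\<in>{a..b}. U t \<le> K + integral {a..t} (\<lambda>s. \<phi> s * U s))"
  have maxim: "\<exists>s\<in>{a..t}. \<forall>x\<in>{a..t}. U x \<le> U s" if "continuous_on {a..b} U" "t \<in> {a..b}" for U :: "real \<Rightarrow> real" and t
    using that by (intro continuous_attains_sup) (auto intro: continuous_on_subset)
  have level: "\<exists>M>0. \<forall>U K. ?H U K \<longrightarrow> (\<forall>t\<in>{a..b}. \<Phi> t \<le> real j / 2 \<longrightarrow> U t \<le> M * K)" for j
  proof (induction j)
    case 0
    show ?case
    proof (intro exI[of _ 1] conjI allI impI ballI)
      fix U K t assume H: "?H U K" and t: "t \<in> {a..b}" "\<Phi> t \<le> real 0 / 2"
      obtain s where s: "s \<in> {a..t}" "\<And>x. x \<in> {a..t} \<Longrightarrow> U x \<le> U s" using maxim[of U t] H t by blast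
      have "\<Phi> t = 0" using t \<Phi>0[of t] by simp
      then have "integral {a..t} (\<lambda>s. \<phi> s * U s) \<le> 0"
        using seg[of U a t "U s"] H t s(2) \<Phi>a by simp
      moreover have "U t \<le> K + integral {a..t} (\<lambda>s. \<phi> s * U s)" using H t by blast
      ultimately show "U t \<le> 1 * K" by simp
    qed simp
  next
    case (Suc j)
    then obtain M where M: "M > 0"
      "\<And>U K t. ?H U K \<Longrightarrow> t \<in> {a..b} \<Longrightarrow> \<Phi> t \<le> real j / 2 \<Longrightarrow> U t \<le> M * K" by blast
    let ?M = "M + 2 * (1 + M * \<Phi> b)"
    have \<Phi>b: "0 \<le> \<Phi> b" using \<Phi>0[of b] ab by simp
    show ?case
    proof (intro exI[of _ ?M] conjI allI impI ballI)
      show "?M > 0" using M(1) \<Phi>b by (simp add: add_pos_nonneg)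
      fix U K t assume H: "?H U K" and t: "t \<in> {a..b}" "\<Phi> t \<le> real (Suc j) / 2"
      have Uc: "continuous_on {a..b} U" and K: "0 \<le> K" using H by auto
      obtain s where s: "s \<in> {a..t}" "\<And>x. x \<in> {a..t} \<Longrightarrow> U x \<le> U s" using maxim[of U t] H t by blast
      have s': "s \<in> {a..b}" using s t by auto
      have MK: "M * K \<le> ?M * K" "2 * (1 + M * \<Phi> b) * K \<le> ?M * K"
        using K M(1) \<Phi>b by (auto intro!: mult_right_mono)
      have "U s \<le> ?M * K"
      proof (cases "\<Phi> s \<le> real j / 2")
        case True
        then show ?thesis using M(2)[OF H s'] MK by linarith
      next
        case False
        then obtain c where c: "a \<le> c" "c \<le> s" "\<Phi> c = real j / 2"
          using IVT'[of \<Phi> a "real j / 2" s] \<Phi>a s' continuous_on_subset[OF \<Phi>c, of "{a..s}"] by auto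
        have cb: "c \<in> {a..b}" using c s' by auto
        have U1: "U x \<le> M * K" if "x \<in> {a..c}" for x
          using M(2)[OF H, of x] \<Phi>m[of x c] that c(3) cb by auto
        have "U s \<le> K + integral {a..s} (\<lambda>s. \<phi> s * U s)" using H s' by blast
        also have "\<dots> = K + integral {a..c} (\<lambda>s. \<phi> s * U s) + integral {c..s} (\<lambda>s. \<phi> s * U s)"
          using comb[OF Uc c(1,2)] s' by simp
        also have "integral {a..c} (\<lambda>s. \<phi> s * U s) \<le> M * K * (\<Phi> c - \<Phi> a)"
          by (rule seg[OF Uc _ c(1) _ U1]) (use cb in auto)
        also have "M * K * (\<Phi> c - \<Phi> a) \<le> M * K * \<Phi> b"
          using \<Phi>a \<Phi>m[of c b] cb M(1) K by (intro mult_left_mono) auto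
        also have "integral {c..s} (\<lambda>s. \<phi> s * U s) \<le> U s * (\<Phi> s - \<Phi> c)"
          by (rule seg[OF Uc c(1,2)]) (use s s' c in auto)
        also have "U s * (\<Phi> s - \<Phi> c) \<le> U s * (1 / 2)"
          using c(3) \<Phi>m[of s t] s t H s' by (intro mult_left_mono) auto
        finally have "U s \<le> 2 * (1 + M * \<Phi> b) * K" by (simp add: algebra_simps)
        then show ?thesis using MK by linarith
      qed
      then show "U t \<le> ?M * K" using s(2)[of t] t by auto
    qed
  qed
  obtain j :: nat where j: "\<Phi> b \<le> real j / 2"
    using real_arch_simple[of "2 * \<Phi> b"] by (auto simp: field_simps)
  obtain M where M: "M > 0"
    "\<And>U K t. ?H U K \<Longrightarrow> t \<in> {a..b} \<Longrightarrow> \<Phi> t \<le> real j / 2 \<Longrightarrow> U t \<le> M * K" using level[of j] by blast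
  have "\<Phi> t \<le> real j / 2" if "t \<in> {a..b}" for t using \<Phi>m[of t b] that j by auto
  then show ?thesis using M by (intro exI[of _ M]) auto
qed

abbreviation VW :: "nat \<Rightarrow> (real \<Rightarrow> complex ^ 'm) set" where "VW \<equiv> sobolev_vec a b p"
abbreviation vnrm :: "nat \<Rightarrow> (real \<Rightarrow> complex ^ 'm) \<Rightarrow> real" where "vnrm \<equiv> sobolev_vec_norm a b p"

abbreviation MW :: "nat \<Rightarrow> (real \<Rightarrow> complex ^ 'm ^ 'm) set" where "MW \<equiv> sobolev_mat a b p"
abbreviation mnrm :: "nat \<Rightarrow> (real \<Rightarrow> complex ^ 'm ^ 'm) \<Rightarrow> real" where "mnrm \<equiv> sobolev_mat_norm a b p"
abbreviation Lop :: "nat \<Rightarrow> (nat \<Rightarrow> real \<Rightarrow> complex ^ 'm ^ 'm) \<Rightarrow> (real \<Rightarrow> complex ^ 'm) \<Rightarrow> real \<Rightarrow> complex ^ 'm"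
  where "Lop \<equiv> diff_op a b"

lemma sobolev_vec_nth: "y \<in> VW n \<Longrightarrow> (\<lambda>t. y t $ i) \<in> W n"
  by (simp add: sobolev_vec_def)

lemma sobolev_vec_norm_nonneg: "y \<in> VW n \<Longrightarrow> 0 \<le> vnrm n y"
  unfolding sobolev_vec_norm_def by (intro sum_nonneg sobolev_norm_nonneg sobolev_vec_nth)

lemma sobolev_norm_nth_le:
  assumes "y \<in> VW n"
  shows "wnrm n (\<lambda>t. y t $ i) \<le> vnrm n y"
proof -
  have "wnrm n (\<lambda>t. y t $ i) = (\<Sum>i\<in>{i}. wnrm n (\<lambda>t. y t $ i))" by simp
  also have "\<dots> \<le> vnrm n y" unfolding sobolev_vec_norm_def
    by (intro sum_mono2) (auto intro: sobolev_norm_nonneg sobolev_vec_nth[OF assms])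
  finally show ?thesis .
qed

lemma sobolev_vec_add:
  assumes "y \<in> VW n" "z \<in> VW n"
  shows "(\<lambda>t. y t + z t) \<in> VW n" "vnrm n (\<lambda>t. y t + z t) \<le> vnrm n y + vnrm n z"
proof -
  note A = sobolev_add[OF sobolev_vec_nth[OF assms(1)] sobolev_vec_nth[OF assms(2)]]
  show "(\<lambda>t. y t + z t) \<in> VW n" using A by (auto simp: sobolev_vec_def)
  show "vnrm n (\<lambda>t. y t + z t) \<le> vnrm n y + vnrm n z"
    unfolding sobolev_vec_norm_def using A by (auto simp flip: sum.distrib intro!: sum_mono)
qed

lemma sobolev_vec_cmult:
  assumes "y \<in> VW n"
  shows "(\<lambda>t. c *s y t) \<in> VW n" "vnrm n (\<lambda>t. c *s y t) = cmod c * vnrm n y"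
proof -
  note A = sobolev_cmult[OF sobolev_vec_nth[OF assms], of c]
  show "(\<lambda>t. c *s y t) \<in> VW n" using A by (auto simp: sobolev_vec_def)
  show "vnrm n (\<lambda>t. c *s y t) = cmod c * vnrm n y"
    unfolding sobolev_vec_norm_def using A by (simp add: sum_distrib_left)
qed

lemma sobolev_vec_diff:
  assumes "y \<in> VW n" "z \<in> VW n"
  shows "(\<lambda>t. y t - z t) \<in> VW n" "vnrm n (\<lambda>t. y t - z t) \<le> vnrm n y + vnrm n z"
proof -
  note A = sobolev_diff[OF sobolev_vec_nth[OF assms(1)] sobolev_vec_nth[OF assms(2)]]
  show "(\<lambda>t. y t - z t) \<in> VW n" using A by (auto simp: sobolev_vec_def)
  show "vnrm n (\<lambda>t. y t - z t) \<le> vnrm n y + vnrm n z"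
    unfolding sobolev_vec_norm_def using A by (auto simp flip: sum.distrib intro!: sum_mono)
qed

lemma sobolev_vec_norm_minus_commute:
  assumes "y \<in> VW n" "z \<in> VW n"
  shows "vnrm n (\<lambda>t. y t - z t) = vnrm n (\<lambda>t. z t - y t)"
proof -
  have "(-1) *s (y t - z t) = z t - y t" for t by (simp add: vec_eq_iff)
  then show ?thesis using sobolev_vec_cmult(2)[OF sobolev_vec_diff(1)[OF assms], of "-1"] by simp
qed

lemma sobolev_vec_norm_triangle_sub:
  assumes "y \<in> VW n" "z \<in> VW n"
  shows "vnrm n y \<le> vnrm n z + vnrm n (\<lambda>t. y t - z t)"
  using sobolev_vec_add(2)[OF assms(2) sobolev_vec_diff(1)[OF assms]] by simp

lemma sobolev_vec_cong_AE:
  assumes y: "y \<in> VW n" and ae: "AE t in S. y t = z t"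
  shows "vnrm n z = vnrm n y"
  unfolding sobolev_vec_norm_def
  by (intro sum.cong refl sobolev_norm_cong[OF sobolev_vec_nth[OF y]])
    (use ae in \<open>auto elim: eventually_mono\<close>)

lemma sobolev_vec_complete:
  assumes u: "\<And>k. u k \<in> VW n"
    and C: "\<And>e. e > 0 \<Longrightarrow> \<exists>N. \<forall>i\<ge>N. \<forall>j\<ge>N. vnrm n (\<lambda>t. u i t - u j t) < e"
  obtains f where "f \<in> VW n" "(\<lambda>k. vnrm n (\<lambda>t. u k t - f t)) \<longlonglongrightarrow> 0"
proof -
  have "\<exists>f. f \<in> W n \<and> (\<lambda>k. wnrm n (\<lambda>t. u k t $ i - f t)) \<longlonglongrightarrow> 0" for i
  proof (rule sobolev_complete)
    show "(\<lambda>t. u k t $ i) \<in> W n" for k by (rule sobolev_vec_nth[OF u])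
    fix e :: real assume "e > 0"
    then obtain N where N: "\<And>j k. j \<ge> N \<Longrightarrow> k \<ge> N \<Longrightarrow> vnrm n (\<lambda>t. u j t - u k t) < e" using C by blast
    have "wnrm n (\<lambda>t. u j t $ i - u k t $ i) < e" if "j \<ge> N" "k \<ge> N" for j k
      using sobolev_norm_nth_le[OF sobolev_vec_diff(1)[OF u[of j] u[of k]], of i] N[OF that] by simp
    then show "\<exists>N. \<forall>j\<ge>N. \<forall>k\<ge>N. wnrm n (\<lambda>t. u j t $ i - u k t $ i) < e" by blast
  qed
  then have "\<exists>f. \<forall>i. f i \<in> W n \<and> (\<lambda>k. wnrm n (\<lambda>t. u k t $ i - f i t)) \<longlonglongrightarrow> 0"
    by (intro choice allI)
  then obtain f where f: "\<And>i. f i \<in> W n" "\<And>i. (\<lambda>k. wnrm n (\<lambda>t. u k t $ i - f i t)) \<longlonglongrightarrow> 0"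
    by blast
  show ?thesis
  proof (rule that)
    show "(\<lambda>t. \<chi> i. f i t) \<in> VW n" using f by (simp add: sobolev_vec_def)
    have "(\<lambda>k. \<Sum>i\<in>UNIV. wnrm n (\<lambda>t. u k t $ i - f i t)) \<longlonglongrightarrow> (\<Sum>i\<in>(UNIV :: 'a set). 0)"
      by (intro tendsto_intros f)
    then show "(\<lambda>k. vnrm n (\<lambda>t. u k t - (\<chi> i. f i t))) \<longlonglongrightarrow> 0" by (simp add: sobolev_vec_norm_def)
  qed
qed

definition lower_part :: "nat \<Rightarrow> (nat \<Rightarrow> real \<Rightarrow> complex ^ 'm ^ 'm) \<Rightarrow> (real \<Rightarrow> complex ^ 'm) \<Rightarrow> real \<Rightarrow> complex ^ 'm" where
  "lower_part r A y t = (\<chi> i. \<Sum>k<r. \<Sum>l\<in>UNIV. A k t $ i $ l * (D ^^ k) (\<lambda>s. y s $ l) t)"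

lemma diff_op_nth:
  "Lop r A y t $ i = (D ^^ r) (\<lambda>s. y s $ i) t + lower_part r A y t $ i"
proof -
  have "(\<Sum>j=1..r. A (r - j) t *v vec_wderiv a b (r - j) y t) = (\<Sum>k<r. A k t *v vec_wderiv a b k y t)"
    by (rule sum.reindex_bij_witness[of _ "\<lambda>k. r - k" "\<lambda>j. r - j"]) auto
  then show ?thesis
    by (simp add: diff_op_def vec_wderiv_def matrix_vector_mult_def lower_part_def)
qed

lemma sobolev_mat_nth: "A \<in> MW n \<Longrightarrow> (\<lambda>t. A t $ i $ l) \<in> W n"
  by (simp add: sobolev_mat_def)

lemma lower_part_bound:
  "\<exists>C>0. \<forall>(A :: nat \<Rightarrow> real \<Rightarrow> complex ^ 'm ^ 'm) y. (\<forall>k<r. A k \<in> MW n) \<longrightarrow> y \<in> VW (n + r) \<longrightarrow>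
    lower_part r A y \<in> VW n \<and>
    vnrm n (lower_part r A y) \<le> C * (\<Sum>k<r. mnrm n (A k)) * vnrm (n + r) y"
proof -
  obtain C where C: "C > 0" "\<And>u v. u \<in> W n \<Longrightarrow> v \<in> W (max n 1) \<Longrightarrow>
    (\<lambda>t. u t * v t) \<in> W n \<and> wnrm n (\<lambda>t. u t * v t) \<le> C * wnrm n u * wnrm (max n 1) v"
    using sobolev_mult[of n] by blast
  show ?thesis
  proof (intro exI[of _ C] conjI allI impI)
    fix A :: "nat \<Rightarrow> real \<Rightarrow> complex ^ 'm ^ 'm" and y :: "real \<Rightarrow> complex ^ 'm"
    assume A: "\<forall>k<r. A k \<in> MW n" and y: "y \<in> VW (n + r)"
    let ?a = "\<lambda>k i l t. A k t $ i $ l" and ?y = "\<lambda>k l. (D ^^ k) (\<lambda>s. y s $ l)"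
    have summand: "(\<lambda>t. ?a k i l t * ?y k l t) \<in> W n \<and>
        wnrm n (\<lambda>t. ?a k i l t * ?y k l t) \<le> C * wnrm n (?a k i l) * vnrm (n + r) y" if k: "k < r" for k i l
    proof -
      have a: "?a k i l \<in> W n" using A k sobolev_mat_nth by blast
      have m: "?y k l \<in> W (n + r - k)" "wnrm (n + r - k) (?y k l) \<le> wnrm (n + r) (\<lambda>s. y s $ l)"
        using wderiv_pow_mem[OF sobolev_vec_nth[OF y], of k] k by auto
      have "max n 1 \<le> n + r - k" using k by auto
      note m' = sobolev_mono[OF m(1) this]
      have "wnrm (max n 1) (?y k l) \<le> vnrm (n + r) y"
        using m'(2) m(2) sobolev_norm_nth_le[OF y, of l] by linarith
      then have "C * wnrm n (?a k i l) * wnrm (max n 1) (?y k l) \<le> C * wnrm n (?a k i l) * vnrm (n + r) y"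
        using C(1) sobolev_norm_nonneg[OF a] by (intro mult_left_mono) auto
      then show ?thesis using C(2)[OF a m'(1)] by linarith
    qed
    have row: "(\<lambda>t. \<Sum>k<r. \<Sum>l\<in>UNIV. ?a k i l t * ?y k l t) \<in> W n \<and>
        wnrm n (\<lambda>t. \<Sum>k<r. \<Sum>l\<in>UNIV. ?a k i l t * ?y k l t)
          \<le> (\<Sum>k<r. \<Sum>l\<in>UNIV. C * wnrm n (?a k i l) * vnrm (n + r) y)" for i
    proof -
      have s1: "(\<lambda>t. \<Sum>l\<in>UNIV. ?a k i l t * ?y k l t) \<in> W n \<and>
          wnrm n (\<lambda>t. \<Sum>l\<in>UNIV. ?a k i l t * ?y k l t) \<le> (\<Sum>l\<in>UNIV. C * wnrm n (?a k i l) * vnrm (n + r) y)"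
        if "k < r" for k
        using sobolev_sum[of UNIV "\<lambda>l t. ?a k i l t * ?y k l t" n] summand[OF that]
        by (meson finite order_trans sum_mono)
      show ?thesis
        using sobolev_sum[of "{..<r}" "\<lambda>k t. \<Sum>l\<in>UNIV. ?a k i l t * ?y k l t" n] s1
        by (meson finite_lessThan lessThan_iff order_trans sum_mono)
    qed
    show "lower_part r A y \<in> VW n" using row by (simp add: sobolev_vec_def lower_part_def)
    have "vnrm n (lower_part r A y) \<le> (\<Sum>i\<in>UNIV. \<Sum>k<r. \<Sum>l\<in>UNIV. C * wnrm n (?a k i l) * vnrm (n + r) y)"
      unfolding sobolev_vec_norm_def[of _ _ _ n] using row by (intro sum_mono) (simp add: lower_part_def)
    also have "\<dots> = (\<Sum>k<r. \<Sum>i\<in>UNIV. \<Sum>l\<in>UNIV. C * wnrm n (?a k i l) * vnrm (n + r) y)"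
      by (rule sum.swap)
    also have "\<dots> = C * (\<Sum>k<r. mnrm n (A k)) * vnrm (n + r) y"
      by (simp add: sobolev_mat_norm_def sum_distrib_left sum_distrib_right)
    finally show "vnrm n (lower_part r A y) \<le> C * (\<Sum>k<r. mnrm n (A k)) * vnrm (n + r) y" .
  qed (rule C(1))
qed

lemma sobolev_mat_norm_nonneg: "A \<in> MW n \<Longrightarrow> 0 \<le> mnrm n A"
  unfolding sobolev_mat_norm_def by (intro sum_nonneg sobolev_norm_nonneg sobolev_mat_nth)

lemma wderiv_top_mem:
  assumes "y \<in> VW (n + r)"
  shows "(\<lambda>t. \<chi> i. (D ^^ r) (\<lambda>s. y s $ i) t) \<in> VW n"
    "vnrm n (\<lambda>t. \<chi> i. (D ^^ r) (\<lambda>s. y s $ i) t) \<le> vnrm (n + r) y"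
proof -
  have *: "(D ^^ r) (\<lambda>s. y s $ i) \<in> W n \<and> wnrm n ((D ^^ r) (\<lambda>s. y s $ i)) \<le> wnrm (n + r) (\<lambda>s. y s $ i)" for i
    using wderiv_pow_mem[OF sobolev_vec_nth[OF assms], of r i] by simp
  show "(\<lambda>t. \<chi> i. (D ^^ r) (\<lambda>s. y s $ i) t) \<in> VW n" using * by (simp add: sobolev_vec_def)
  show "vnrm n (\<lambda>t. \<chi> i. (D ^^ r) (\<lambda>s. y s $ i) t) \<le> vnrm (n + r) y"
    using * by (auto simp: sobolev_vec_norm_def intro: sum_mono)
qed

lemma diff_op_eq: "Lop r A y = (\<lambda>t. (\<chi> i. (D ^^ r) (\<lambda>s. y s $ i) t) + lower_part r A y t)"
  by (rule ext) (simp add: vec_eq_iff diff_op_nth)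

lemma diff_op_bound:
  "\<exists>C>0. \<forall>(A :: nat \<Rightarrow> real \<Rightarrow> complex ^ 'm ^ 'm) y. (\<forall>k<r. A k \<in> MW n) \<longrightarrow> y \<in> VW (n + r) \<longrightarrow>
    Lop r A y \<in> VW n \<and>
    vnrm n (Lop r A y) \<le> (1 + C * (\<Sum>k<r. mnrm n (A k))) * vnrm (n + r) y"
proof -
  obtain C where C: "C > 0" "\<And>(A :: nat \<Rightarrow> real \<Rightarrow> complex ^ 'm ^ 'm) y. (\<forall>k<r. A k \<in> MW n) \<Longrightarrow> y \<in> VW (n + r) \<Longrightarrow>
    lower_part r A y \<in> VW n \<and>
    vnrm n (lower_part r A y) \<le> C * (\<Sum>k<r. mnrm n (A k)) * vnrm (n + r) y"
    using lower_part_bound[of r n] by blast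
  have "Lop r A y \<in> VW n \<and>
    vnrm n (Lop r A y) \<le> (1 + C * (\<Sum>k<r. mnrm n (A k))) * vnrm (n + r) y"
    if A: "\<forall>k<r. A k \<in> MW n" and y: "y \<in> VW (n + r)" for A :: "nat \<Rightarrow> real \<Rightarrow> complex ^ 'm ^ 'm" and y
    unfolding diff_op_eq
    using sobolev_vec_add[OF wderiv_top_mem(1)[OF y] conjunct1[OF C(2)[OF A y]]]
      wderiv_top_mem(2)[OF y] C(2)[OF A y] by (auto simp: distrib_right)
  then show ?thesis using C(1) by blast
qed

lemma diff_op_diff_AE:
  assumes y: "y \<in> VW (n + r)" and z: "z \<in> VW (n + r)"
  shows "AE t in S. Lop r A (\<lambda>t. y t - z t) t = Lop r A y t - Lop r A z t"
proof -
  have "AE t in S. \<forall>x\<in>{..r} \<times> UNIV. (D ^^ fst x) (\<lambda>t. y t $ snd x - z t $ snd x) t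
      = (D ^^ fst x) (\<lambda>t. y t $ snd x) t - (D ^^ fst x) (\<lambda>t. z t $ snd x) t"
    using wderiv_pow_diff_AE[OF sobolev_vec_nth[OF y] sobolev_vec_nth[OF z]]
    by (intro AE_finite_allI) auto
  then show ?thesis
  proof eventually_elim
    case (elim t)
    have eq: "(D ^^ k) (\<lambda>t. y t $ i - z t $ i) t = (D ^^ k) (\<lambda>t. y t $ i) t - (D ^^ k) (\<lambda>t. z t $ i) t"
      if "k \<le> r" for k i using bspec[OF elim, of "(k, i)"] that by simp
    show ?case
      unfolding vec_eq_iff
      by (simp add: diff_op_nth lower_part_def eq right_diff_distrib sum_subtractf)
  qed
qed

lemma sobolev_norm_split: "wnrm (n + r) f = (\<Sum>k<r. nrm ((D ^^ k) f)) + wnrm n ((D ^^ r) f)"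
proof (induction r arbitrary: f)
  case (Suc r)
  have "(\<Sum>k<Suc r. nrm ((D ^^ k) f)) = nrm f + (\<Sum>k<r. nrm ((D ^^ k) (D f)))"
    by (subst sum.lessThan_Suc_shift) (simp add: funpow_Suc_right del: funpow.simps(2))
  then show ?case
    using Suc[of "D f"] by (simp add: sobolev_norm_Suc funpow_Suc_right del: funpow.simps(2))
qed simp

definition initial_size :: "nat \<Rightarrow> (real \<Rightarrow> complex ^ 'm) \<Rightarrow> real" where
  "initial_size r w = (\<Sum>i\<in>UNIV. \<Sum>k<r. cmod ((D ^^ k) (\<lambda>s. w s $ i) a))"

lemma initial_size_nonneg: "0 \<le> initial_size r w"
  unfolding initial_size_def by (intro sum_nonneg norm_ge_zero)

lemma a_priori_sup:
  fixes A :: "nat \<Rightarrow> real \<Rightarrow> complex ^ 'm ^ 'm"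
  assumes A: "\<forall>k<r. A k \<in> MW n"
  shows "\<exists>M>0. \<forall>w t. w \<in> VW (n + r) \<longrightarrow> t \<in> {a..b} \<longrightarrow>
    (\<Sum>i\<in>UNIV. \<Sum>k<r. cmod ((D ^^ k) (\<lambda>s. w s $ i) t))
      \<le> M * (initial_size r w + vnrm n (Lop r A w))"
proof -
  define \<alpha> where "\<alpha> i t = (\<Sum>k<r. \<Sum>l\<in>UNIV. cmod (A k t $ i $ l))" for i t
  define \<phi> where "\<phi> t = 1 + (\<Sum>i\<in>UNIV. \<alpha> i t)" for t
  have Ai: "integrable S (\<lambda>t. A k t $ i $ l)" if "k < r" for k i l
    using A that sobolev_mat_nth Lp_integrable sobolev_Lp by blast
  have \<phi>i: "integrable S \<phi>"
    unfolding \<phi>_def[abs_def] \<alpha>_def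
    by (intro Bochner_Integration.integrable_add Bochner_Integration.integrable_sum integrable_norm Ai) auto
  have \<alpha>0: "0 \<le> \<alpha> i t" for i t unfolding \<alpha>_def by (intro sum_nonneg norm_ge_zero)
  have \<phi>0: "0 \<le> \<phi> t" for t unfolding \<phi>_def by (intro add_nonneg_nonneg sum_nonneg \<alpha>0) simp
  obtain M where M: "M > 0" "\<And>U K t. continuous_on {a..b} U \<Longrightarrow> 0 \<le> K \<Longrightarrow> (\<forall>t\<in>{a..b}. 0 \<le> U t) \<Longrightarrow>
    (\<forall>t\<in>{a..b}. U t \<le> K + integral {a..t} (\<lambda>s. \<phi> s * U s)) \<Longrightarrow> t \<in> {a..b} \<Longrightarrow> U t \<le> M * K"
    using Gronwall[OF \<phi>i \<phi>0] by blast
  have "(\<Sum>i\<in>UNIV. \<Sum>k<r. cmod ((D ^^ k) (\<lambda>s. w s $ i) t))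
      \<le> M * (b - a + 1) * (initial_size r w + vnrm n (Lop r A w))"
    if w: "w \<in> VW (n + r)" and t: "t \<in> {a..b}" for w t
  proof -
    define y where "y k i = (D ^^ k) (\<lambda>s. w s $ i)" for k i
    define h where "h = Lop r A w"
    define U where "U t = (\<Sum>i\<in>UNIV. \<Sum>k<r. cmod (y k i t))" for t
    have hW: "h \<in> VW n" using diff_op_bound[of r n] A w unfolding h_def by blast
    have yP: "primitive_of (y k i) (y (Suc k) i)" if "k < r" for k i
      unfolding y_def by (rule wderiv_pow_primitive[OF sobolev_vec_nth[OF w]]) (use that in simp)
    have yc: "continuous_on {a..b} (y k i)" if "k < r" for k i
      by (rule primitive_of_continuous[OF yP[OF that]])
    have yi: "integrable S (y k i)" if "k \<le> r" for k i
      using wderiv_pow_mem[OF sobolev_vec_nth[OF w], of k i] that Lp_integrable[OF sobolev_Lp]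
      by (auto simp: y_def)
    have Uc: "continuous_on {a..b} U"
      unfolding U_def[abs_def] by (intro continuous_intros yc) auto
    have U0: "0 \<le> U t" for t unfolding U_def by (intro sum_nonneg norm_ge_zero)
    have yU: "cmod (y k l s) \<le> U s" if "k < r" for k l s
    proof -
      have "cmod (y k l s) \<le> (\<Sum>k<r. cmod (y k l s))" using that by (intro member_le_sum) auto
      also have "\<dots> \<le> U s" unfolding U_def
        by (rule member_le_sum[of l UNIV "\<lambda>i. \<Sum>k<r. cmod (y k i s)"]) (auto intro: sum_nonneg)
      finally show ?thesis .
    qed
    have top: "cmod (y r i s) \<le> cmod (h s $ i) + \<alpha> i s * U s" for i s
    proof -
      have "y r i s = h s $ i - lower_part r A w s $ i"
        by (simp add: h_def diff_op_nth y_def)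
      then have "cmod (y r i s) \<le> cmod (h s $ i) + cmod (lower_part r A w s $ i)"
        by (simp add: norm_triangle_ineq4)
      also have "cmod (lower_part r A w s $ i) \<le> (\<Sum>k<r. \<Sum>l\<in>UNIV. cmod (A k s $ i $ l) * U s)"
        unfolding lower_part_def y_def[symmetric]
        by (auto intro!: order_trans[OF norm_sum] sum_mono mult_left_mono yU simp: norm_mult)
      also have "\<dots> = \<alpha> i s * U s" by (simp add: \<alpha>_def sum_distrib_right)
      finally show ?thesis by simp
    qed
    have pointwise: "(\<Sum>i\<in>UNIV. \<Sum>k<r. cmod (y (Suc k) i s)) \<le> (\<Sum>i\<in>UNIV. cmod (h s $ i)) + \<phi> s * U s" for s
    proof -
      have "(\<Sum>k<r. cmod (y (Suc k) i s)) \<le> (\<Sum>k<r. cmod (y k i s)) + cmod (y r i s)" for i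
      proof -
        have "(\<Sum>k<r. cmod (y (Suc k) i s)) \<le> (\<Sum>k<Suc r. cmod (y k i s))"
          by (subst sum.lessThan_Suc_shift) simp
        then show ?thesis by simp
      qed
      then have "(\<Sum>i\<in>UNIV. \<Sum>k<r. cmod (y (Suc k) i s))
          \<le> (\<Sum>i\<in>UNIV. (\<Sum>k<r. cmod (y k i s)) + (cmod (h s $ i) + \<alpha> i s * U s))"
        using top by (intro sum_mono) (meson add_left_mono order_trans)
      also have "\<dots> = (\<Sum>i\<in>UNIV. cmod (h s $ i)) + \<phi> s * U s"
        by (simp add: sum.distrib U_def \<phi>_def distrib_right sum_distrib_right)
      finally show ?thesis .
    qed
    have hi: "integrable S (\<lambda>s. \<Sum>i\<in>UNIV. cmod (h s $ i))"
      using Lp_integrable[OF sobolev_Lp[OF sobolev_vec_nth[OF hW]]]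
      by (intro Bochner_Integration.integrable_sum integrable_norm)
    have \<phi>U: "integrable S (\<lambda>s. \<phi> s * U s)" by (rule integrable_mult_continuous[OF \<phi>i Uc])
    have sub: "f integrable_on {a..t}" if "integrable S f" "t \<in> {a..b}" for f :: "real \<Rightarrow> real" and t
      using integrable_on_sub(2)[OF that(1), of a t] that(2) by auto
    have hL: "integral {a..t} (\<lambda>s. \<Sum>i\<in>UNIV. cmod (h s $ i)) \<le> (b - a + 1) * vnrm n h" if t: "t \<in> {a..b}" for t
    proof -
      have "integral {a..t} (\<lambda>s. \<Sum>i\<in>UNIV. cmod (h s $ i)) \<le> integral {a..b} (\<lambda>s. \<Sum>i\<in>UNIV. cmod (h s $ i))"
        using t ab by (intro integral_subset_le sub[OF hi]) (auto intro: sum_nonneg)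
      also have "\<dots> = (\<integral>s. (\<Sum>i\<in>UNIV. cmod (h s $ i)) \<partial>S)" by (rule integral_S[OF hi, symmetric])
      also have "\<dots> = (\<Sum>i\<in>UNIV. \<integral>s. cmod (h s $ i) \<partial>S)"
        using Lp_integrable[OF sobolev_Lp[OF sobolev_vec_nth[OF hW]]]
        by (intro Bochner_Integration.integral_sum integrable_norm)
      also have "\<dots> \<le> (\<Sum>i\<in>UNIV. (b - a + 1) * wnrm n (\<lambda>s. h s $ i))"
      proof (rule sum_mono)
        fix i
        have "(\<integral>s. cmod (h s $ i) \<partial>S) \<le> (b - a + 1) * nrm (\<lambda>s. h s $ i)"
          by (rule Lp_L1[OF sobolev_Lp[OF sobolev_vec_nth[OF hW]]])
        also have "\<dots> \<le> (b - a + 1) * wnrm n (\<lambda>s. h s $ i)"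
          using ab Lp_norm_le_sobolev[OF sobolev_vec_nth[OF hW], of i] by (intro mult_left_mono) auto
        finally show "(\<integral>s. cmod (h s $ i) \<partial>S) \<le> (b - a + 1) * wnrm n (\<lambda>s. h s $ i)" .
      qed
      also have "\<dots> = (b - a + 1) * vnrm n h" by (simp add: sobolev_vec_norm_def sum_distrib_left)
      finally show ?thesis .
    qed
    have h0: "0 \<le> vnrm n h" by (rule sobolev_vec_norm_nonneg[OF hW])
    have inc: "U t \<le> (initial_size r w + (b - a + 1) * vnrm n h) + integral {a..t} (\<lambda>s. \<phi> s * U s)"
      if t: "t \<in> {a..b}" for t
    proof -
      have one: "cmod (y k i t) \<le> cmod (y k i a) + integral {a..t} (\<lambda>s. cmod (y (Suc k) i s))" if k: "k < r" for k i
      proof -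
        have "y k i t - y k i a = integral {a..t} (y (Suc k) i)"
          using yP[OF k] t by (simp add: primitive_of_def)
        moreover have "cmod (integral {a..t} (y (Suc k) i)) \<le> integral {a..t} (\<lambda>s. cmod (y (Suc k) i s))"
          using integrable_on_sub(1)[OF yi[of "Suc k" i], of a t] k t
          by (intro integral_norm_bound_integral) (auto simp: absolutely_integrable_on_def)
        ultimately show ?thesis using norm_triangle_sub[of "y k i t" "y k i a"] by simp
      qed
      have yt: "(\<lambda>s. cmod (y (Suc k) i s)) integrable_on {a..t}" if "k < r" for k i
        by (rule sub[OF integrable_norm[OF yi] t]) (use that in simp)
      have "U t \<le> (\<Sum>i\<in>UNIV. \<Sum>k<r. cmod (y k i a) + integral {a..t} (\<lambda>s. cmod (y (Suc k) i s)))"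
        unfolding U_def by (intro sum_mono one) simp
      also have "\<dots> = initial_size r w + (\<Sum>i\<in>UNIV. \<Sum>k<r. integral {a..t} (\<lambda>s. cmod (y (Suc k) i s)))"
        by (simp add: sum.distrib initial_size_def y_def)
      also have "(\<Sum>i\<in>UNIV. \<Sum>k<r. integral {a..t} (\<lambda>s. cmod (y (Suc k) i s)))
          = (\<Sum>i\<in>UNIV. integral {a..t} (\<lambda>s. \<Sum>k<r. cmod (y (Suc k) i s)))"
        by (intro sum.cong refl integral_sum[symmetric] yt) auto
      also have "\<dots> = integral {a..t} (\<lambda>s. \<Sum>i\<in>UNIV. \<Sum>k<r. cmod (y (Suc k) i s))"
        by (intro integral_sum[symmetric] integrable_sum yt) auto
      also have "\<dots> \<le> integral {a..t} (\<lambda>s. (\<Sum>i\<in>UNIV. cmod (h s $ i)) + \<phi> s * U s)"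
        by (intro integral_le integrable_sum yt integrable_add sub[OF hi t] sub[OF \<phi>U t] pointwise) auto
      also have "\<dots> = integral {a..t} (\<lambda>s. \<Sum>i\<in>UNIV. cmod (h s $ i)) + integral {a..t} (\<lambda>s. \<phi> s * U s)"
        by (rule Henstock_Kurzweil_Integration.integral_add[OF sub[OF hi t] sub[OF \<phi>U t]])
      finally show ?thesis using hL[OF t] by simp
    qed
    have "U t \<le> M * (initial_size r w + (b - a + 1) * vnrm n h)"
      using ab h0 initial_size_nonneg[of r w]
      by (intro M(2)[OF Uc _ _ _ t] ballI U0 inc add_nonneg_nonneg mult_nonneg_nonneg) auto
    also have "\<dots> \<le> M * ((b - a + 1) * initial_size r w + (b - a + 1) * vnrm n h)"
      using M(1) ab initial_size_nonneg[of r w] mult_right_mono[of 1 "b - a + 1" "initial_size r w"]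
      by (intro mult_left_mono add_mono) auto
    finally show ?thesis unfolding U_def y_def h_def by (simp add: algebra_simps)
  qed
  then show ?thesis using M(1) ab by (intro exI[of _ "M * (b - a + 1)"]) auto
qed

lemma a_priori:
  fixes A :: "nat \<Rightarrow> real \<Rightarrow> complex ^ 'm ^ 'm"
  assumes A: "\<forall>k<r. A k \<in> MW n"
  shows "\<exists>M>0. \<forall>w. w \<in> VW (n + r) \<longrightarrow>
    vnrm (n + r) w \<le> M * (initial_size r w + vnrm n (Lop r A w))"
proof -
  define E where "E w = initial_size r w + vnrm n (Lop r A w)" for w :: "real \<Rightarrow> complex ^ 'm"
  define y where "y w k i = (D ^^ k) (\<lambda>s. w s $ i)" for w :: "real \<Rightarrow> complex ^ 'm" and k i
  have hW: "Lop r A w \<in> VW n" if "w \<in> VW (n + r)" for w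
    using diff_op_bound[of r n] A that by blast
  have E0: "0 \<le> E w" if "w \<in> VW (n + r)" for w
    unfolding E_def using sobolev_vec_norm_nonneg[OF hW[OF that]] initial_size_nonneg[of r w] by simp
  obtain M where M: "M > 0" "\<And>w t. w \<in> VW (n + r) \<Longrightarrow> t \<in> {a..b} \<Longrightarrow>
      (\<Sum>i\<in>UNIV. \<Sum>k<r. cmod (y w k i t)) \<le> M * E w"
    using a_priori_sup[OF A] unfolding E_def y_def by blast
  have sup: "cmod (y w k l t) \<le> M * E w" if "w \<in> VW (n + r)" "k < r" "t \<in> {a..b}" for w k l t
  proof -
    have "cmod (y w k l t) \<le> (\<Sum>k<r. cmod (y w k l t))" using that by (intro member_le_sum) auto
    also have "\<dots> \<le> (\<Sum>i\<in>UNIV. \<Sum>k<r. cmod (y w k i t))"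
      by (rule member_le_sum[of l UNIV "\<lambda>i. \<Sum>k<r. cmod (y w k i t)"]) (auto intro: sum_nonneg)
    finally show ?thesis using M(2)[OF that(1,3)] by linarith
  qed
  have ym: "y w k l \<in> W (n + r - k)" if "w \<in> VW (n + r)" "k \<le> r" for w k l
    unfolding y_def using wderiv_pow_mem[OF sobolev_vec_nth[OF that(1)], of k l] that(2) by simp
  have yc: "continuous_on {a..b} (y w k l)" if "w \<in> VW (n + r)" "k < r" for w k l
    using sobolev_continuous[OF ym[OF that(1), of k l]] that(2) by simp
  obtain C where C: "C > 0" "\<And>f M. f \<in> borel_measurable S \<Longrightarrow> 0 \<le> M \<Longrightarrow>
      (AE t in S. cmod (f t) \<le> M) \<Longrightarrow> Lp_bound f (C * M)" using Lp_bound_const by blast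
  have low: "nrm (y w k l) \<le> C * M * E w" if "w \<in> VW (n + r)" "k < r" for w k l
  proof -
    have "AE t in S. cmod (y w k l t) \<le> M * E w" using sup[OF that] by (intro AE_I2) simp
    then show ?thesis
      using C(2)[OF measurable_continuous_S[OF yc[OF that]], of "M * E w"] M(1) E0[OF that(1)]
      by (simp add: Lp_bound_iff mult.assoc)
  qed
  define \<alpha> where "\<alpha> = (\<Sum>k<r. mnrm n (A k))"
  have An: "wnrm n (\<lambda>t. A k t $ i $ l) \<le> \<alpha>" "(\<lambda>t. A k t $ i $ l) \<in> W n" if k: "k < r" for k i l
  proof -
    have Ak: "(\<lambda>t. A k t $ i $ l) \<in> W n" for i l using A k sobolev_mat_nth by blast
    show "(\<lambda>t. A k t $ i $ l) \<in> W n" by (rule Ak)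
    have "wnrm n (\<lambda>t. A k t $ i $ l) \<le> (\<Sum>l\<in>UNIV. wnrm n (\<lambda>t. A k t $ i $ l))"
      by (rule member_le_sum[of l UNIV "\<lambda>l. wnrm n (\<lambda>t. A k t $ i $ l)"]) (auto intro: sobolev_norm_nonneg Ak)
    also have "\<dots> \<le> mnrm n (A k)" unfolding sobolev_mat_norm_def
      by (rule member_le_sum[of i UNIV "\<lambda>i. \<Sum>l\<in>UNIV. wnrm n (\<lambda>t. A k t $ i $ l)"])
        (auto intro!: sum_nonneg sobolev_norm_nonneg Ak)
    also have "\<dots> \<le> \<alpha>" unfolding \<alpha>_def using k A
      by (intro member_le_sum) (auto intro: sobolev_mat_norm_nonneg)
    finally show "wnrm n (\<lambda>t. A k t $ i $ l) \<le> \<alpha>" .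
  qed
  have \<alpha>0: "0 \<le> \<alpha>" unfolding \<alpha>_def using A by (intro sum_nonneg sobolev_mat_norm_nonneg) auto
  have combine: "\<exists>Q\<ge>0. \<forall>w i. w \<in> VW (n + r) \<longrightarrow> wnrm j (y w r i) \<le> Q * E w"
    if j: "j \<le> n" and R: "R \<ge> 0" and prod: "\<And>w k i l. w \<in> VW (n + r) \<Longrightarrow> k < r \<Longrightarrow>
      (\<lambda>t. A k t $ i $ l * y w k l t) \<in> W j \<and> wnrm j (\<lambda>t. A k t $ i $ l * y w k l t) \<le> R * E w" for j R
  proof (intro exI conjI allI impI)
    let ?Q = "1 + real r * (real CARD('m) * R)"
    show "?Q \<ge> 0" using R by simp
    fix w :: "real \<Rightarrow> complex ^ 'm" and i assume w: "w \<in> VW (n + r)"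
    have s1: "(\<lambda>t. \<Sum>l\<in>UNIV. A k t $ i $ l * y w k l t) \<in> W j \<and>
        wnrm j (\<lambda>t. \<Sum>l\<in>UNIV. A k t $ i $ l * y w k l t) \<le> real CARD('m) * R * E w" if k: "k < r" for k
    proof -
      have "(\<Sum>l\<in>UNIV. wnrm j (\<lambda>t. A k t $ i $ l * y w k l t)) \<le> (\<Sum>l\<in>(UNIV :: 'm set). R * E w)"
        using prod[OF w k] by (intro sum_mono) auto
      then show ?thesis
        using sobolev_sum[of UNIV "\<lambda>l t. A k t $ i $ l * y w k l t" j] prod[OF w k] by (simp add: mult.assoc)
    qed
    have s2: "(\<lambda>t. \<Sum>k<r. \<Sum>l\<in>UNIV. A k t $ i $ l * y w k l t) \<in> W j \<and>
        wnrm j (\<lambda>t. \<Sum>k<r. \<Sum>l\<in>UNIV. A k t $ i $ l * y w k l t) \<le> real r * (real CARD('m) * R * E w)"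
    proof -
      have "(\<Sum>k<r. wnrm j (\<lambda>t. \<Sum>l\<in>UNIV. A k t $ i $ l * y w k l t)) \<le> (\<Sum>k<r. real CARD('m) * R * E w)"
        using s1 by (intro sum_mono) auto
      then show ?thesis
        using sobolev_sum[of "{..<r}" "\<lambda>k t. \<Sum>l\<in>UNIV. A k t $ i $ l * y w k l t" j] s1 by simp
    qed
    have hj: "(\<lambda>t. Lop r A w t $ i) \<in> W j" "wnrm j (\<lambda>t. Lop r A w t $ i) \<le> E w"
    proof -
      note m = sobolev_mono[OF sobolev_vec_nth[OF hW[OF w]] j]
      show "(\<lambda>t. Lop r A w t $ i) \<in> W j" by (rule m)
      show "wnrm j (\<lambda>t. Lop r A w t $ i) \<le> E w"
        using m(2)[of i] sobolev_norm_nth_le[OF hW[OF w], of i] initial_size_nonneg[of r w] by (simp add: E_def)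
    qed
    have "y w r i = (\<lambda>t. Lop r A w t $ i - (\<Sum>k<r. \<Sum>l\<in>UNIV. A k t $ i $ l * y w k l t))"
      by (rule ext) (simp add: diff_op_nth lower_part_def y_def)
    then have "wnrm j (y w r i) \<le> E w + real r * (real CARD('m) * R * E w)"
      using sobolev_diff(2)[OF hj(1) conjunct1[OF s2]] hj(2) s2 by simp
    then show "wnrm j (y w r i) \<le> ?Q * E w" by (simp add: algebra_simps)
  qed
  have top: "\<exists>Q\<ge>0. \<forall>w i. w \<in> VW (n + r) \<longrightarrow> wnrm j (y w r i) \<le> Q * E w" if "j \<le> n" for j
    using that
  proof (induction j)
    case 0
    show ?case
    proof (rule combine)
      show "M * \<alpha> \<ge> 0" using M(1) \<alpha>0 by simp
      fix w :: "real \<Rightarrow> complex ^ 'm" and k i l assume w: "w \<in> VW (n + r)" and k: "k < r"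
      have AL: "(\<lambda>t. A k t $ i $ l) \<in> L" by (rule sobolev_Lp[OF An(2)[OF k]])
      have "AE t in S. cmod (y w k l t) \<le> M * E w" using sup[OF w k] by (intro AE_I2) simp
      note B = Lp_bounded_mult[OF AL measurable_continuous_S[OF yc[OF w k]] this]
      have "nrm (\<lambda>t. y w k l t * A k t $ i $ l) \<le> M * E w * nrm (\<lambda>t. A k t $ i $ l)" by (rule B(2))
      also have "\<dots> \<le> M * E w * \<alpha>"
        using M(1) E0[OF w] Lp_norm_le_sobolev[OF An(2)[OF k], of i l] An(1)[OF k, of i l]
        by (intro mult_left_mono) auto
      finally show "(\<lambda>t. A k t $ i $ l * y w k l t) \<in> W 0 \<and>
          wnrm 0 (\<lambda>t. A k t $ i $ l * y w k l t) \<le> M * \<alpha> * E w"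
        using B(1) by (simp add: sobolev_0 sobolev_norm_0 mult_ac)
    qed simp
  next
    case (Suc j)
    then obtain Q where Q: "Q \<ge> 0" "\<And>w i. w \<in> VW (n + r) \<Longrightarrow> wnrm j (y w r i) \<le> Q * E w" by auto
    obtain K where K: "K > 0" "\<And>u v. u \<in> W (Suc j) \<Longrightarrow> v \<in> W (Suc j) \<Longrightarrow>
      (\<lambda>t. u t * v t) \<in> W (Suc j) \<and> wnrm (Suc j) (\<lambda>t. u t * v t) \<le> K * wnrm (Suc j) u * wnrm (Suc j) v"
      using sobolev_mult[of "Suc j"] by auto
    let ?T = "real r * (C * M) + Q"
    have T0: "0 \<le> ?T" using C(1) M(1) Q(1) by simp
    have lower: "wnrm (j + r) (\<lambda>s. w s $ l) \<le> ?T * E w" if w: "w \<in> VW (n + r)" for w l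
    proof -
      have "(\<Sum>k<r. nrm (y w k l)) \<le> (\<Sum>k<r. C * M * E w)" using low[OF w] by (intro sum_mono) auto
      then show ?thesis
        using sobolev_norm_split[of j r "\<lambda>s. w s $ l"] Q(2)[OF w, of l] by (simp add: y_def algebra_simps)
    qed
    show ?case
    proof (rule combine)
      show "Suc j \<le> n" by (rule Suc.prems)
      show "K * \<alpha> * ?T \<ge> 0" using K(1) \<alpha>0 T0 by (intro mult_nonneg_nonneg) auto
      fix w :: "real \<Rightarrow> complex ^ 'm" and k i l assume w: "w \<in> VW (n + r)" and k: "k < r"
      note Aj = sobolev_mono[OF An(2)[OF k, of i l] Suc.prems]
      have wl: "(\<lambda>s. w s $ l) \<in> W (j + r)"
        by (rule sobolev_mono(1)[OF sobolev_vec_nth[OF w]]) (use Suc.prems in simp)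
      have yj: "y w k l \<in> W (j + r - k)" "wnrm (j + r - k) (y w k l) \<le> wnrm (j + r) (\<lambda>s. w s $ l)"
        using wderiv_pow_mem[OF wl, of k] k by (auto simp: y_def)
      have "Suc j \<le> j + r - k" using k by simp
      note ys = sobolev_mono[OF yj(1) this]
      have "wnrm (Suc j) (y w k l) \<le> ?T * E w" using ys(2) yj(2) lower[OF w, of l] by linarith
      then have "K * wnrm (Suc j) (\<lambda>t. A k t $ i $ l) * wnrm (Suc j) (y w k l) \<le> K * \<alpha> * (?T * E w)"
        using K(1) Aj(2) An(1)[OF k, of i l] \<alpha>0 sobolev_norm_nonneg[OF ys(1)] sobolev_norm_nonneg[OF Aj(1)]
        by (intro mult_mono mult_nonneg_nonneg) auto
      then show "(\<lambda>t. A k t $ i $ l * y w k l t) \<in> W (Suc j) \<and>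
          wnrm (Suc j) (\<lambda>t. A k t $ i $ l * y w k l t) \<le> K * \<alpha> * ?T * E w"
        using K(2)[OF Aj(1) ys(1)] by (simp add: mult.assoc)
    qed
  qed
  obtain Q where Q: "Q \<ge> 0" "\<And>w i. w \<in> VW (n + r) \<Longrightarrow> wnrm n (y w r i) \<le> Q * E w" using top[of n] by auto
  let ?T = "real CARD('m) * (real r * (C * M) + Q)"
  have "vnrm (n + r) w \<le> (?T + 1) * E w" if w: "w \<in> VW (n + r)" for w
  proof -
    have "wnrm (n + r) (\<lambda>s. w s $ l) \<le> (real r * (C * M) + Q) * E w" for l
    proof -
      have "(\<Sum>k<r. nrm (y w k l)) \<le> (\<Sum>k<r. C * M * E w)" using low[OF w] by (intro sum_mono) auto
      then show ?thesis
        using sobolev_norm_split[of n r "\<lambda>s. w s $ l"] Q(2)[OF w, of l] by (simp add: y_def algebra_simps)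
    qed
    then have "vnrm (n + r) w \<le> (\<Sum>i\<in>(UNIV :: 'm set). (real r * (C * M) + Q) * E w)"
      unfolding sobolev_vec_norm_def by (intro sum_mono)
    then show ?thesis using E0[OF w] by (simp add: distrib_right mult.assoc)
  qed
  moreover have "?T + 1 > 0" using C(1) M(1) Q(1) by (intro add_nonneg_pos mult_nonneg_nonneg add_nonneg_nonneg) auto
  ultimately show ?thesis unfolding E_def by (intro exI[of _ "?T + 1"]) auto
qed

end

section \<open>Uniform bounds near the limit problem\<close>

lemma finite_convergent_subsequence:
  fixes f :: "'x \<Rightarrow> nat \<Rightarrow> complex"
  assumes "finite X" "\<And>x. x \<in> X \<Longrightarrow> bounded (range (f x))"
  shows "\<exists>s. strict_mono s \<and> (\<forall>x\<in>X. convergent (\<lambda>k. f x (s k)))"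
  using assms
proof (induction rule: finite_induct)
  case empty
  show ?case by (intro exI[of _ id]) (simp add: strict_mono_def)
next
  case (insert x X)
  then obtain s :: "nat \<Rightarrow> nat" where s: "strict_mono s" "\<And>z. z \<in> X \<Longrightarrow> convergent (\<lambda>k. f z (s k))" by auto
  have "bounded (range (\<lambda>k. f x (s k)))"
    by (rule bounded_subset[OF insert.prems[of x]]) auto
  then obtain l t where t: "strict_mono (t :: nat \<Rightarrow> nat)" "((\<lambda>k. f x (s k)) \<circ> t) \<longlonglongrightarrow> l"
    using bounded_imp_convergent_subsequence by blast
  show ?case
  proof (intro exI conjI ballI)
    show "strict_mono (s \<circ> t)" by (rule strict_mono_o[OF s(1) t(1)])
    fix z assume "z \<in> insert x X"
    then show "convergent (\<lambda>k. f z ((s \<circ> t) k))"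
    proof
      assume "z = x"
      then show ?thesis using t(2) by (auto simp: convergent_def o_def)
    next
      assume "z \<in> X"
      then have "convergent ((\<lambda>k. f z (s k)) \<circ> t)" by (intro convergent_subseq_convergent s t)
      then show ?thesis by (simp add: o_def)
    qed
  qed
qed

lemma is_norm_equivalent:
  fixes N :: "complex ^ 'k \<Rightarrow> real"
  assumes N: "is_norm N"
  shows "\<exists>c>0. \<forall>x. N x \<le> c * norm x" "\<exists>c>0. \<forall>x. norm x \<le> c * N x"
proof -
  have n0: "\<And>x. 0 \<le> N x" and nz: "\<And>x. N x = 0 \<longleftrightarrow> x = 0"
    and nc: "\<And>s x. N (s *s x) = cmod s * N x" and nt: "\<And>x y. N (x + y) \<le> N x + N y"
    using N by (auto simp: is_norm_def)
  have nsum: "N (\<Sum>i\<in>X. g i) \<le> (\<Sum>i\<in>X. N (g i))" if "finite X" for X :: "'k set" and g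
    using that
  proof (induction rule: finite_induct)
    case empty
    show ?case using nz[of 0] by simp
  next
    case (insert x X)
    then show ?case using nt[of "g x" "\<Sum>i\<in>X. g i"] by simp
  qed
  define c where "c = 1 + (\<Sum>i\<in>UNIV. N (axis i 1))"
  have c: "c > 0" unfolding c_def by (intro add_pos_nonneg sum_nonneg n0) simp
  have up: "N x \<le> c * norm x" for x
  proof -
    have "x = (\<Sum>i\<in>UNIV. (x $ i) *s axis i 1)" by (rule basis_expansion[symmetric])
    then have "N x \<le> (\<Sum>i\<in>UNIV. N ((x $ i) *s axis i 1))" using nsum[of UNIV] by (metis finite)
    also have "\<dots> \<le> (\<Sum>i\<in>UNIV. norm x * N (axis i 1))"
      unfolding nc by (intro sum_mono mult_right_mono n0) (rule Finite_Cartesian_Product.norm_nth_le)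
    also have "\<dots> \<le> c * norm x" by (simp add: c_def sum_distrib_left algebra_simps)
    finally show ?thesis .
  qed
  then show "\<exists>c>0. \<forall>x. N x \<le> c * norm x" using c by blast
  have lip: "\<bar>N x - N y\<bar> \<le> c * norm (x - y)" for x y
  proof -
    have "N x \<le> N y + N (x - y)" using nt[of y "x - y"] by simp
    moreover have "N y \<le> N x + N (y - x)" using nt[of x "y - x"] by simp
    ultimately show ?thesis using up[of "x - y"] up[of "y - x"] by (simp add: norm_minus_commute)
  qed
  have cont: "continuous_on (sphere 0 1) N"
  proof (rule continuous_on_subset[OF _ subset_UNIV], rule continuous_onI)
    fix x e assume "(e::real) > 0"
    then show "\<exists>d>0. \<forall>x'\<in>UNIV. dist x' x < d \<longrightarrow> dist (N x') (N x) \<le> e"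
      using lip c by (intro exI[of _ "e / c"])
        (auto simp: dist_norm field_simps intro: order_trans[OF lip])
  qed
  have "sphere (0 :: complex ^ 'k) 1 \<noteq> {}" by simp
  then obtain u where u: "u \<in> sphere 0 1" "\<And>x. x \<in> sphere 0 1 \<Longrightarrow> N u \<le> N x"
    using continuous_attains_inf[OF compact_sphere _ cont] by blast
  have Nu: "N u > 0" using n0[of u] nz[of u] u(1) by (auto simp: less_le)
  have "norm x \<le> (1 / N u) * N x" for x
  proof (cases "x = 0")
    case False
    define s where "s = complex_of_real (1 / norm x)"
    have sx: "s *s x = (1 / norm x) *\<^sub>R x" by (simp add: vec_eq_iff s_def scaleR_conv_of_real[where 'a=complex])
    have "s *s x \<in> sphere 0 1" using False unfolding sx by simp
    then have "N u \<le> cmod s * N x" using u(2) nc by metis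
    then show ?thesis using False Nu by (simp add: s_def norm_divide field_simps)
  qed (use nz[of 0] in simp)
  then show "\<exists>c>0. \<forall>x. norm x \<le> c * N x" using Nu by (intro exI[of _ "1 / N u"]) auto
qed

context sobolev_interval
begin

lemma continuous_linear_operator_diff:
  assumes B: "continuous_linear_operator a b p N B" and y: "y \<in> VW N" and z: "z \<in> VW N"
  shows "B (\<lambda>t. y t - z t) = B y - B z"
proof -
  have "(\<lambda>t. y t - z t) = (\<lambda>t. y t + (-1) *s z t)" by (simp add: vec_eq_iff fun_eq_iff)
  moreover have "B (\<lambda>t. y t + (-1) *s z t) = B y + B (\<lambda>t. (-1) *s z t)"
    by (rule bspec[OF bspec[OF conjunct1[OF B[unfolded continuous_linear_operator_def]] y]])
      (rule sobolev_vec_cmult(1)[OF z])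
  moreover have "B (\<lambda>t. (-1) *s z t) = (-1) *s B z"
    using B z unfolding continuous_linear_operator_def by blast
  ultimately show ?thesis by (simp add: vec_eq_iff)
qed

lemma continuous_linear_operator_cmult:
  "continuous_linear_operator a b p N B \<Longrightarrow> y \<in> VW N \<Longrightarrow> B (\<lambda>t. s *s y t) = s *s B y"
  by (simp add: continuous_linear_operator_def)

lemma norm_vec_cmult: "norm (s *s x) = cmod s * norm x" for x :: "complex ^ 'k"
  by (simp add: norm_vec_def norm_mult L2_set_right_distrib)

lemma sobolev_vec_zero: "(\<lambda>t. 0) \<in> VW N" "vnrm N (\<lambda>t. 0) = 0"
  using sobolev_zero[of N] by (auto simp: sobolev_vec_def sobolev_vec_norm_def)

lemma sobolev_vec_norm_triangle3:
  assumes "x \<in> VW N" "y \<in> VW N" "z \<in> VW N"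
  shows "vnrm N (\<lambda>t. x t - z t) \<le> vnrm N (\<lambda>t. x t - y t) + vnrm N (\<lambda>t. y t - z t)"
  using sobolev_vec_add(2)[OF sobolev_vec_diff(1)[OF assms(1,2)] sobolev_vec_diff(1)[OF assms(2,3)]]
  by simp

text \<open>Baire's argument: nested balls such that some \<open>T k\<close> exceeds \<open>n\<close> on all of the \<open>n\<close>-th ball.\<close>

lemma uniform_boundedness:
  fixes T :: "nat \<Rightarrow> (real \<Rightarrow> complex ^ 'm) \<Rightarrow> complex ^ 'k"
  assumes T: "\<And>k. continuous_linear_operator a b p N (T k)"
    and pw: "\<And>y. y \<in> VW N \<Longrightarrow> \<exists>C. \<forall>k. norm (T k y) \<le> C"
  shows "\<exists>C. \<forall>k. \<forall>y\<in>VW N. vnrm N y \<le> 1 \<longrightarrow> norm (T k y) \<le> C"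
proof (rule ccontr)
  assume unb: "\<not> ?thesis"
  have step: "\<exists>z \<delta> k. z \<in> VW N \<and> 0 < \<delta> \<and> \<delta> \<le> \<epsilon> / 2 \<and> vnrm N (\<lambda>t. z t - y t) \<le> \<epsilon> / 2 \<and>
      (\<forall>x\<in>VW N. vnrm N (\<lambda>t. x t - z t) \<le> \<delta> \<longrightarrow> norm (T k x) > M)"
    if y: "y \<in> VW N" and \<epsilon>: "\<epsilon> > 0" for y \<epsilon> M
  proof -
    have "\<exists>z k. z \<in> VW N \<and> vnrm N (\<lambda>t. z t - y t) \<le> \<epsilon> / 2 \<and> norm (T k z) > M"
    proof (rule ccontr)
      assume "\<not> ?thesis"
      then have le: "norm (T k z) \<le> M" if "z \<in> VW N" "vnrm N (\<lambda>t. z t - y t) \<le> \<epsilon> / 2" for z k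
        using that by (meson not_le)
      have "norm (T k x) \<le> 4 * M / \<epsilon>" if x: "x \<in> VW N" "vnrm N x \<le> 1" for k x
      proof -
        define s where "s = complex_of_real (\<epsilon> / 2)"
        have sx: "(\<lambda>t. s *s x t) \<in> VW N" by (rule sobolev_vec_cmult(1)[OF x(1)])
        define z where "z t = y t + s *s x t" for t
        have zW: "z \<in> VW N" unfolding z_def[abs_def] by (rule sobolev_vec_add(1)[OF y sx])
        have cs: "cmod s = \<epsilon> / 2" using \<epsilon> by (simp add: s_def)
        have zy: "(\<lambda>t. z t - y t) = (\<lambda>t. s *s x t)" by (simp add: z_def)
        have "vnrm N (\<lambda>t. z t - y t) \<le> \<epsilon> / 2"
          unfolding zy sobolev_vec_cmult(2)[OF x(1)] cs using x(2) \<epsilon> by (simp add: mult_left_le)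
        then have "norm (T k z) \<le> M" by (rule le[OF zW])
        moreover have "norm (T k y) \<le> M" using le[OF y, of k] \<epsilon> by (simp add: sobolev_vec_zero)
        moreover have "s *s T k x = T k z - T k y"
          using continuous_linear_operator_diff[OF T zW y, of k] zy
            continuous_linear_operator_cmult[OF T x(1), of k s] by simp
        ultimately have "cmod s * norm (T k x) \<le> 2 * M"
          using norm_triangle_ineq4[of "T k z" "T k y"] norm_vec_cmult[of s "T k x"] by simp
        then show ?thesis using \<epsilon> unfolding cs by (simp add: field_simps)
      qed
      then show False using unb by blast
    qed
    then obtain z k where z: "z \<in> VW N" "vnrm N (\<lambda>t. z t - y t) \<le> \<epsilon> / 2" "norm (T k z) > M" by blast
    obtain d where d: "d > 0" "\<And>x. x \<in> VW N \<Longrightarrow> vnrm N (\<lambda>t. x t - z t) < d \<Longrightarrow> norm (T k x - T k z) < norm (T k z) - M"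
    proof -
      have "norm (T k z) - M > 0" using z(3) by simp
      then show ?thesis using T[of k] z(1) that unfolding continuous_linear_operator_def by blast
    qed
    have "norm (T k x) > M" if "x \<in> VW N" "vnrm N (\<lambda>t. x t - z t) \<le> min (d / 2) (\<epsilon> / 2)" for x
    proof -
      have "vnrm N (\<lambda>t. x t - z t) < d" using that(2) d(1) by simp
      from d(2)[OF that(1) this] show ?thesis
        using norm_triangle_ineq2[of "T k z" "T k x"] by (simp add: norm_minus_commute)
    qed
    then show ?thesis using z d(1) \<epsilon>
      by (intro exI[of _ z] exI[of _ "min (d / 2) (\<epsilon> / 2)"] exI[of _ k]) auto
  qed
  have "\<exists>\<sigma>. \<forall>n. (fst (\<sigma> n) \<in> VW N \<and> 0 < snd (\<sigma> n) \<and> snd (\<sigma> n) \<le> (1/2) ^ n) \<and>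
      (snd (\<sigma> (Suc n)) \<le> snd (\<sigma> n) / 2 \<and> vnrm N (\<lambda>t. fst (\<sigma> (Suc n)) t - fst (\<sigma> n) t) \<le> snd (\<sigma> n) / 2 \<and>
       (\<exists>k. \<forall>x\<in>VW N. vnrm N (\<lambda>t. x t - fst (\<sigma> (Suc n)) t) \<le> snd (\<sigma> (Suc n)) \<longrightarrow> norm (T k x) > real n))"
  proof (rule dependent_nat_choice)
    show "\<exists>\<tau>. fst \<tau> \<in> VW N \<and> 0 < snd \<tau> \<and> snd \<tau> \<le> (1/2::real) ^ 0"
      using sobolev_vec_zero(1) by (intro exI[of _ "(\<lambda>t. 0, 1)"]) simp
    fix \<tau> :: "(real \<Rightarrow> complex ^ 'm) \<times> real" and n
    assume \<tau>: "fst \<tau> \<in> VW N \<and> 0 < snd \<tau> \<and> snd \<tau> \<le> (1/2) ^ n"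
    then obtain z \<delta> k where "z \<in> VW N" "0 < \<delta>" "\<delta> \<le> snd \<tau> / 2" "vnrm N (\<lambda>t. z t - fst \<tau> t) \<le> snd \<tau> / 2"
      "\<forall>x\<in>VW N. vnrm N (\<lambda>t. x t - z t) \<le> \<delta> \<longrightarrow> norm (T k x) > real n"
      using step[of "fst \<tau>" "snd \<tau>" "real n"] by blast
    then show "\<exists>\<tau>'. (fst \<tau>' \<in> VW N \<and> 0 < snd \<tau>' \<and> snd \<tau>' \<le> (1/2) ^ Suc n) \<and>
      (snd \<tau>' \<le> snd \<tau> / 2 \<and> vnrm N (\<lambda>t. fst \<tau>' t - fst \<tau> t) \<le> snd \<tau> / 2 \<and>
       (\<exists>k. \<forall>x\<in>VW N. vnrm N (\<lambda>t. x t - fst \<tau>' t) \<le> snd \<tau>' \<longrightarrow> norm (T k x) > real n))"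
      using \<tau> by (intro exI[of _ "(z, \<delta>)"]) auto
  qed
  then obtain \<sigma> where \<sigma>: "\<And>n. fst (\<sigma> n) \<in> VW N" "\<And>n. 0 < snd (\<sigma> n)" "\<And>n. snd (\<sigma> n) \<le> (1/2) ^ n"
      "\<And>n. snd (\<sigma> (Suc n)) \<le> snd (\<sigma> n) / 2"
      "\<And>n. vnrm N (\<lambda>t. fst (\<sigma> (Suc n)) t - fst (\<sigma> n) t) \<le> snd (\<sigma> n) / 2"
      "\<And>n. \<exists>k. \<forall>x\<in>VW N. vnrm N (\<lambda>t. x t - fst (\<sigma> (Suc n)) t) \<le> snd (\<sigma> (Suc n)) \<longrightarrow> norm (T k x) > real n"
    by blast
  define y where "y n = fst (\<sigma> n)" for n
  define \<epsilon> where "\<epsilon> n = snd (\<sigma> n)" for n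
  note yW = \<sigma>(1)[folded y_def] and \<epsilon>0 = \<sigma>(2)[folded \<epsilon>_def] and \<epsilon>1 = \<sigma>(3)[folded \<epsilon>_def]
    and \<epsilon>2 = \<sigma>(4)[folded \<epsilon>_def] and y2 = \<sigma>(5)[folded y_def \<epsilon>_def] and big = \<sigma>(6)[folded y_def \<epsilon>_def]
  have tail': "vnrm N (\<lambda>t. y (n + j) t - y n t) \<le> \<epsilon> n - \<epsilon> (n + j)" for n j
  proof (induction j)
    case (Suc j)
    have "vnrm N (\<lambda>t. y (n + Suc j) t - y n t) \<le> vnrm N (\<lambda>t. y (Suc (n + j)) t - y (n + j) t) + vnrm N (\<lambda>t. y (n + j) t - y n t)"
      using sobolev_vec_norm_triangle3[OF yW yW yW, of "Suc (n + j)" n "n + j"] by simp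
    then show ?case using Suc y2[of "n + j"] \<epsilon>2[of "n + j"] by simp
  qed (simp add: sobolev_vec_zero)
  have tail: "vnrm N (\<lambda>t. y m t - y n t) \<le> \<epsilon> n" if "n \<le> m" for n m
    using tail'[of n "m - n"] \<epsilon>0[of m] that by simp
  obtain f where f: "f \<in> VW N" "(\<lambda>k. vnrm N (\<lambda>t. y k t - f t)) \<longlonglongrightarrow> 0"
  proof (rule sobolev_vec_complete[OF yW])
    fix e :: real assume e: "e > 0"
    obtain M where M: "(1/2::real) ^ M < e / 2" using real_arch_pow_inv[of "e/2" "1/2"] e by auto
    have "vnrm N (\<lambda>t. y i t - y j t) < e" if ij: "i \<ge> M" "j \<ge> M" for i j
    proof -
      have "vnrm N (\<lambda>t. y i t - y j t) \<le> vnrm N (\<lambda>t. y i t - y M t) + vnrm N (\<lambda>t. y M t - y j t)"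
        by (rule sobolev_vec_norm_triangle3[OF yW yW yW])
      also have "\<dots> \<le> \<epsilon> M + \<epsilon> M"
        using tail[OF ij(1)] tail[OF ij(2)] sobolev_vec_norm_minus_commute[OF yW yW, of M j] by simp
      finally show ?thesis using M \<epsilon>1[of M] by simp
    qed
    then show "\<exists>M. \<forall>i\<ge>M. \<forall>j\<ge>M. vnrm N (\<lambda>t. y i t - y j t) < e" by blast
  qed
  have ball: "vnrm N (\<lambda>t. f t - y n t) \<le> \<epsilon> n" for n
  proof (rule LIMSEQ_le_const)
    have "(\<lambda>k. vnrm N (\<lambda>t. y k t - f t) + \<epsilon> n) \<longlonglongrightarrow> 0 + \<epsilon> n" by (intro tendsto_intros f)
    then show "(\<lambda>k. vnrm N (\<lambda>t. y k t - f t) + \<epsilon> n) \<longlonglongrightarrow> \<epsilon> n" by simp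
    have "vnrm N (\<lambda>t. f t - y n t) \<le> vnrm N (\<lambda>t. y k t - f t) + \<epsilon> n" if "k \<ge> n" for k
      using sobolev_vec_norm_triangle3[OF f(1) yW yW, of n k] tail[OF that]
        sobolev_vec_norm_minus_commute[OF f(1) yW, of k] by simp
    then show "\<exists>M. \<forall>k\<ge>M. vnrm N (\<lambda>t. f t - y n t) \<le> vnrm N (\<lambda>t. y k t - f t) + \<epsilon> n" by blast
  qed
  obtain C where C: "\<And>k. norm (T k f) \<le> C" using pw[OF f(1)] by blast
  obtain n :: nat where n: "C \<le> real n" using real_arch_simple by blast
  obtain k where "norm (T k f) > real n" using big[of n] f(1) ball[of "Suc n"] by blast
  then show False using C[of k] n by linarith
qed

lemma unit_ball_bound_imp_bound:
  assumes B: "continuous_linear_operator a b p N B"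
    and C: "\<And>y. y \<in> VW N \<Longrightarrow> vnrm N y \<le> 1 \<Longrightarrow> norm (B y) \<le> C" and y: "y \<in> VW N"
  shows "norm (B y) \<le> C * vnrm N y"
proof -
  have C0: "0 \<le> C" using C[OF sobolev_vec_zero(1)] sobolev_vec_zero(2) by (metis norm_ge_zero order_trans zero_le_one)
  have v0: "0 \<le> vnrm N y" by (rule sobolev_vec_norm_nonneg[OF y])
  have *: "norm (B y) \<le> C * (vnrm N y + e)" if e: "e > 0" for e
  proof -
    define s where "s = complex_of_real (1 / (vnrm N y + e))"
    have cs: "cmod s = 1 / (vnrm N y + e)" using e v0 unfolding s_def norm_of_real by simp
    have "norm (B (\<lambda>t. s *s y t)) \<le> C"
      using e v0 by (intro C sobolev_vec_cmult(1) y) (simp add: sobolev_vec_cmult(2)[OF y] cs)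
    then have "(1 / (vnrm N y + e)) * norm (B y) \<le> C"
      by (simp add: continuous_linear_operator_cmult[OF B y] norm_vec_cmult cs)
    then show ?thesis using e v0 by (simp add: field_simps)
  qed
  show ?thesis
  proof (rule field_le_epsilon)
    fix e :: real assume e: "e > 0"
    have "C * (e / (C + 1)) \<le> e" using C0 e by (simp add: field_simps)
    then show "norm (B y) \<le> C * vnrm N y + e"
      using *[of "e / (C + 1)"] C0 e by (simp add: distrib_left)
  qed
qed

lemma wderiv_pow_diff:
  assumes "f \<in> W n" "g \<in> W n" "k < n" "t \<in> {a..b}"
  shows "(D ^^ k) (\<lambda>t. f t - g t) t = (D ^^ k) f t - (D ^^ k) g t"
proof (rule continuous_AE_eq[OF _ _ _ assms(4)])
  have c: "continuous_on {a..b} ((D ^^ k) h)" if "h \<in> W n" for h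
    using wderiv_pow_mem[OF that, of k] assms(3) sobolev_continuous[of "(D ^^ k) h" "n - k"] by simp
  show "continuous_on {a..b} ((D ^^ k) (\<lambda>t. f t - g t))" by (intro c sobolev_diff assms)
  show "continuous_on {a..b} (\<lambda>t. (D ^^ k) f t - (D ^^ k) g t)" by (intro continuous_intros c assms)
  show "AE t in S. (D ^^ k) (\<lambda>t. f t - g t) t = (D ^^ k) f t - (D ^^ k) g t"
    using assms by (intro wderiv_pow_diff_AE[where n=n]) auto
qed

lemma diff_op_cmult_AE:
  assumes y: "y \<in> VW (n + r)"
  shows "AE t in S. Lop r A (\<lambda>t. c *s y t) t = c *s Lop r A y t"
proof -
  have "AE t in S. \<forall>x\<in>{..r} \<times> UNIV. (D ^^ fst x) (\<lambda>t. c * y t $ snd x) t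
      = c * (D ^^ fst x) (\<lambda>t. y t $ snd x) t"
    using wderiv_pow_cmult_AE[OF sobolev_vec_nth[OF y]] by (intro AE_finite_allI) auto
  then show ?thesis
  proof eventually_elim
    case (elim t)
    have eq: "(D ^^ k) (\<lambda>t. c * y t $ i) t = c * (D ^^ k) (\<lambda>t. y t $ i) t"
      if "k \<le> r" for k i using bspec[OF elim, of "(k, i)"] that by simp
    show ?case
      unfolding vec_eq_iff
      by (simp add: diff_op_nth lower_part_def eq distrib_left sum_distrib_left mult_ac)
  qed
qed

lemma sobolev_mat_diff:
  assumes "X \<in> MW n" "Y \<in> MW n"
  shows "(\<lambda>t. X t - Y t) \<in> MW n"
  using assms sobolev_diff(1) unfolding sobolev_mat_def by simp

lemma diff_op_coefficients_diff:
  "Lop r A y t - Lop r A' y t = lower_part r (\<lambda>k t. A k t - A' k t) y t"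
  by (simp add: vec_eq_iff diff_op_nth lower_part_def left_diff_distrib sum_subtractf)

lemma diff_op_coefficients_bound:
  "\<exists>C>0. \<forall>(A :: nat \<Rightarrow> real \<Rightarrow> complex ^ 'm ^ 'm) A' w. (\<forall>k<r. A k \<in> MW n) \<longrightarrow> (\<forall>k<r. A' k \<in> MW n) \<longrightarrow>
    w \<in> VW (n + r) \<longrightarrow> vnrm n (\<lambda>t. Lop r A w t - Lop r A' w t)
      \<le> C * (\<Sum>k<r. mnrm n (\<lambda>t. A k t - A' k t)) * vnrm (n + r) w"
proof -
  obtain C where C: "C > 0" "\<And>A y. (\<forall>k<r. A k \<in> MW n) \<Longrightarrow> y \<in> VW (n + r) \<Longrightarrow>
    lower_part r A (y :: real \<Rightarrow> complex ^ 'm) \<in> VW n \<and>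
    vnrm n (lower_part r A y) \<le> C * (\<Sum>k<r. mnrm n (A k)) * vnrm (n + r) y"
    using lower_part_bound[of r n] by blast
  have "vnrm n (\<lambda>t. Lop r A w t - Lop r A' w t) \<le> C * (\<Sum>k<r. mnrm n (\<lambda>t. A k t - A' k t)) * vnrm (n + r) w"
    if "\<forall>k<r. A k \<in> MW n" "\<forall>k<r. A' k \<in> MW n" and w: "w \<in> VW (n + r)"
    for A A' :: "nat \<Rightarrow> real \<Rightarrow> complex ^ 'm ^ 'm" and w
  proof -
    have "\<forall>k<r. (\<lambda>t. A k t - A' k t) \<in> MW n" using that by (auto intro: sobolev_mat_diff)
    then show ?thesis
      unfolding diff_op_coefficients_diff using C(2)[of "\<lambda>k t. A k t - A' k t" w] w by blast
  qed
  then show ?thesis using C(1) by blast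
qed

lemma diff_op_mem_bound:
  fixes A :: "nat \<Rightarrow> real \<Rightarrow> complex ^ 'm ^ 'm"
  assumes A: "\<forall>k<r. A k \<in> MW n"
  shows "w \<in> VW (n + r) \<Longrightarrow> Lop r A w \<in> VW n"
    and "\<exists>K>0. \<forall>w\<in>VW (n + r). vnrm n (Lop r A w) \<le> K * vnrm (n + r) w"
proof -
  show "w \<in> VW (n + r) \<Longrightarrow> Lop r A w \<in> VW n" using diff_op_bound[of r n] A by blast
  obtain K where K: "K > 0" "\<And>w. w \<in> VW (n + r) \<Longrightarrow> vnrm n (Lop r A w) \<le> (1 + K * (\<Sum>k<r. mnrm n (A k))) * vnrm (n + r) w"
    using diff_op_bound[of r n] A by blast
  moreover have "1 + K * (\<Sum>k<r. mnrm n (A k)) > 0"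
    using K(1) A by (intro add_pos_nonneg mult_nonneg_nonneg sum_nonneg sobolev_mat_norm_nonneg) auto
  ultimately show "\<exists>K>0. \<forall>w\<in>VW (n + r). vnrm n (Lop r A w) \<le> K * vnrm (n + r) w" by blast
qed

lemma sequentially_within:
  fixes F :: "real \<Rightarrow> 'x::real_normed_vector"
  assumes lim: "(F \<longlongrightarrow> F \<mu>0) (at \<mu>0 within I)" and \<mu>: "\<And>k. \<mu> k \<in> I" "\<mu> \<longlonglongrightarrow> \<mu>0"
  shows "(\<lambda>k. F (\<mu> k)) \<longlonglongrightarrow> F \<mu>0"
proof -
  have "continuous (at \<mu>0 within I) F" using lim by (simp add: continuous_within)
  then show ?thesis by (rule continuous_within_tendsto_compose'[OF _ \<mu>])
qed

lemma tendsto_parameter: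
  fixes \<mu> :: "nat \<Rightarrow> real"
  assumes "\<And>k. \<bar>\<mu> k - \<mu>0\<bar> < 1 / real (Suc k)"
  shows "\<mu> \<longlonglongrightarrow> \<mu>0"
proof -
  have "(\<lambda>k. \<mu> k - \<mu>0) \<longlonglongrightarrow> 0"
    by (rule Lim_null_comparison[OF _ LIMSEQ_Suc[OF lim_1_over_n]])
      (use assms in \<open>auto intro!: always_eventually less_imp_le\<close>)
  then show ?thesis by (simp add: LIM_zero_iff)
qed

lemma operators_bounded_near:
  fixes B :: "real \<Rightarrow> (real \<Rightarrow> complex ^ 'm) \<Rightarrow> complex ^ 'k"
  assumes B: "\<And>\<mu>. \<mu> \<in> I \<Longrightarrow> continuous_linear_operator a b p N (B \<mu>)"
    and lim: "\<And>y. y \<in> VW N \<Longrightarrow> ((\<lambda>\<mu>. B \<mu> y) \<longlongrightarrow> B \<mu>0 y) (at \<mu>0 within I)"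
  shows "\<exists>\<epsilon>>0. \<exists>C>0. \<forall>\<mu>\<in>I. \<bar>\<mu> - \<mu>0\<bar> < \<epsilon> \<longrightarrow> (\<forall>y\<in>VW N. norm (B \<mu> y) \<le> C * vnrm N y)"
proof (rule ccontr)
  assume neg: "\<not> ?thesis"
  define P where "P k z \<longleftrightarrow> fst z \<in> I \<and> \<bar>fst z - \<mu>0\<bar> < 1 / real (Suc k) \<and> snd z \<in> VW N \<and>
      norm (B (fst z) (snd z)) > real (Suc k) * vnrm N (snd z)" for k z
  have "\<exists>z. P k z" for k
  proof (rule ccontr)
    assume "\<not> ?thesis"
    then have "\<forall>\<mu>\<in>I. \<bar>\<mu> - \<mu>0\<bar> < 1 / real (Suc k) \<longrightarrow> (\<forall>y\<in>VW N. norm (B \<mu> y) \<le> real (Suc k) * vnrm N y)"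
      by (auto simp: not_less P_def)
    moreover have "1 / real (Suc k) > 0" "real (Suc k) > 0" by simp_all
    ultimately show False using neg by blast
  qed
  then obtain Z where "\<forall>k. P k (Z k)" using choice[of P] by blast
  then have Z: "\<And>k. fst (Z k) \<in> I" "\<And>k. \<bar>fst (Z k) - \<mu>0\<bar> < 1 / real (Suc k)" "\<And>k. snd (Z k) \<in> VW N"
      "\<And>k. norm (B (fst (Z k)) (snd (Z k))) > real (Suc k) * vnrm N (snd (Z k))"
    unfolding P_def by blast+
  define \<mu> where "\<mu> k = fst (Z k)" for k
  have \<mu>lim: "\<mu> \<longlonglongrightarrow> \<mu>0" by (rule tendsto_parameter) (unfold \<mu>_def, rule Z(2))
  have "\<exists>C. \<forall>k. \<forall>y\<in>VW N. vnrm N y \<le> 1 \<longrightarrow> norm (B (\<mu> k) y) \<le> C"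
  proof (rule uniform_boundedness)
    show "continuous_linear_operator a b p N (B (\<mu> k))" for k using B Z(1) by (simp add: \<mu>_def)
    fix y :: "real \<Rightarrow> complex ^ 'm" assume y: "y \<in> VW N"
    have "\<mu> k \<in> I" for k by (simp add: \<mu>_def Z(1))
    then have "(\<lambda>k. B (\<mu> k) y) \<longlonglongrightarrow> B \<mu>0 y"
      by (rule sequentially_within[of "\<lambda>\<mu>. B \<mu> y", OF lim[OF y] _ \<mu>lim])
    then have "Bseq (\<lambda>k. B (\<mu> k) y)" by (rule convergent_imp_Bseq[OF convergentI])
    then show "\<exists>C. \<forall>k. norm (B (\<mu> k) y) \<le> C" by (auto simp: Bseq_def)
  qed
  then obtain C where C: "\<And>k y. y \<in> VW N \<Longrightarrow> vnrm N y \<le> 1 \<Longrightarrow> norm (B (\<mu> k) y) \<le> C" by blast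
  obtain k :: nat where k: "C \<le> real k" using real_arch_simple by blast
  have "norm (B (\<mu> k) (snd (Z k))) \<le> C * vnrm N (snd (Z k))"
    by (rule unit_ball_bound_imp_bound[OF _ C Z(3)]) (use B Z(1) in \<open>auto simp: \<mu>_def\<close>)
  also have "\<dots> \<le> real (Suc k) * vnrm N (snd (Z k))"
    using k sobolev_vec_norm_nonneg[OF Z(3)] by (intro mult_right_mono) auto
  finally show False using Z(4)[of k] by (simp add: \<mu>_def)
qed

lemma sobolev_mat_norm_sum_tendsto:
  fixes A :: "real \<Rightarrow> nat \<Rightarrow> real \<Rightarrow> complex ^ 'm ^ 'm"
  assumes A: "\<And>j. j \<in> {1..r} \<Longrightarrow>
      ((\<lambda>\<mu>. mnrm n (\<lambda>t. A \<mu> (r - j) t - A \<mu>0 (r - j) t)) \<longlongrightarrow> 0) (at \<mu>0 within I)"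
  shows "((\<lambda>\<mu>. \<Sum>k<r. mnrm n (\<lambda>t. A \<mu> k t - A \<mu>0 k t)) \<longlongrightarrow>
      (\<Sum>k<r. mnrm n (\<lambda>t. A \<mu>0 k t - A \<mu>0 k t))) (at \<mu>0 within I)"
proof (intro tendsto_sum)
  fix k assume "k \<in> {..<r}"
  then have "r - k \<in> {1..r}" "r - (r - k) = k" by auto
  moreover have "mnrm n (\<lambda>t. A \<mu>0 k t - A \<mu>0 k t) = 0"
    using sobolev_zero[of n] by (simp add: sobolev_mat_norm_def)
  ultimately show "((\<lambda>\<mu>. mnrm n (\<lambda>t. A \<mu> k t - A \<mu>0 k t)) \<longlongrightarrow>
      mnrm n (\<lambda>t. A \<mu>0 k t - A \<mu>0 k t)) (at \<mu>0 within I)"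
    using A[of "r - k"] by simp
qed

lemma sobolev_mat_norm_sum_self: "(\<Sum>k<r. mnrm n (\<lambda>t. A k t - A k t)) = 0"
  using sobolev_zero[of n] by (simp add: sobolev_mat_norm_def)

lemma diff_op_bounded_near:
  fixes A :: "real \<Rightarrow> nat \<Rightarrow> real \<Rightarrow> complex ^ 'm ^ 'm"
  assumes \<mu>0: "\<mu>0 \<in> I" and Am: "\<And>\<mu> k. \<mu> \<in> I \<Longrightarrow> k < r \<Longrightarrow> A \<mu> k \<in> MW n"
    and A: "\<And>j. j \<in> {1..r} \<Longrightarrow>
      ((\<lambda>\<mu>. mnrm n (\<lambda>t. A \<mu> (r - j) t - A \<mu>0 (r - j) t)) \<longlongrightarrow> 0) (at \<mu>0 within I)"
  shows "\<exists>\<epsilon>>0. \<exists>K>0. \<forall>\<mu>\<in>I. \<bar>\<mu> - \<mu>0\<bar> < \<epsilon> \<longrightarrow> (\<forall>w\<in>VW (n + r).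
    vnrm n (Lop r (A \<mu>) w) \<le> K * vnrm (n + r) w)"
proof -
  define s where "s \<mu> = (\<Sum>k<r. mnrm n (\<lambda>t. A \<mu> k t - A \<mu>0 k t))" for \<mu>
  have s0: "s \<mu>0 = 0" unfolding s_def by (rule sobolev_mat_norm_sum_self)
  have "(s \<longlongrightarrow> s \<mu>0) (at \<mu>0 within I)" unfolding s_def by (rule sobolev_mat_norm_sum_tendsto[where A=A and r=r]) (rule A)
  then have "eventually (\<lambda>\<mu>. s \<mu> < 1) (at \<mu>0 within I)"
    by (rule order_tendstoD) (simp add: s0)
  then obtain \<epsilon> where \<epsilon>: "\<epsilon> > 0" "\<And>\<mu>. \<mu> \<in> I \<Longrightarrow> \<mu> \<noteq> \<mu>0 \<Longrightarrow> \<bar>\<mu> - \<mu>0\<bar> < \<epsilon> \<Longrightarrow> s \<mu> < 1"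
    by (auto simp: eventually_at dist_real_def)
  have s1: "s \<mu> \<le> 1" if "\<mu> \<in> I" "\<bar>\<mu> - \<mu>0\<bar> < \<epsilon>" for \<mu>
    using \<epsilon>(2)[OF that(1) _ that(2)] s0 by (cases "\<mu> = \<mu>0") auto
  obtain C where C: "C > 0" "\<And>(A :: nat \<Rightarrow> real \<Rightarrow> complex ^ 'm ^ 'm) A' w. (\<forall>k<r. A k \<in> MW n) \<Longrightarrow> (\<forall>k<r. A' k \<in> MW n) \<Longrightarrow>
    w \<in> VW (n + r) \<Longrightarrow> vnrm n (\<lambda>t. Lop r A w t - Lop r A' w t)
      \<le> C * (\<Sum>k<r. mnrm n (\<lambda>t. A k t - A' k t)) * vnrm (n + r) w"
    using diff_op_coefficients_bound[of r n] by blast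
  have Am': "\<forall>k<r. A \<mu> k \<in> MW n" if "\<mu> \<in> I" for \<mu> using Am that by blast
  obtain K where K: "K > 0" "\<And>w. w \<in> VW (n + r) \<Longrightarrow> vnrm n (Lop r (A \<mu>0) w) \<le> K * vnrm (n + r) w"
    using diff_op_mem_bound(2)[OF Am'[OF \<mu>0]] by blast
  have "vnrm n (Lop r (A \<mu>) w) \<le> (K + C) * vnrm (n + r) w"
    if \<mu>: "\<mu> \<in> I" "\<bar>\<mu> - \<mu>0\<bar> < \<epsilon>" and w: "w \<in> VW (n + r)" for \<mu> w
  proof -
    have "vnrm n (\<lambda>t. Lop r (A \<mu>) w t - Lop r (A \<mu>0) w t) \<le> C * s \<mu> * vnrm (n + r) w"
      unfolding s_def by (rule C(2)[OF Am'[OF \<mu>(1)] Am'[OF \<mu>0] w])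
    also have "\<dots> \<le> C * vnrm (n + r) w"
      using C(1) s1[OF \<mu>] sobolev_vec_norm_nonneg[OF w] by (intro mult_right_mono) auto
    finally show ?thesis
      using sobolev_vec_norm_triangle_sub[OF diff_op_mem_bound(1)[OF Am'[OF \<mu>(1)] w]
          diff_op_mem_bound(1)[OF Am'[OF \<mu>0] w]] K(2)[OF w] by (simp add: distrib_right)
  qed
  then show ?thesis using \<epsilon>(1) K(1) C(1) by (intro exI[of _ \<epsilon>] conjI exI[of _ "K + C"]) auto
qed

lemma sobolev_vec_norm_eq_0:
  assumes h: "h \<in> VW n" "vnrm n h = 0"
  shows "AE t in S. h t = 0" "n > 0 \<Longrightarrow> t \<in> {a..b} \<Longrightarrow> h t = 0"
proof -
  have "wnrm n (\<lambda>t. h t $ i) = 0" for i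
    using sobolev_norm_nth_le[OF h(1), of i] h(2) sobolev_norm_nonneg[OF sobolev_vec_nth[OF h(1)], of i] by simp
  then have "nrm (\<lambda>t. h t $ i) = 0" for i
    using Lp_norm_le_sobolev[OF sobolev_vec_nth[OF h(1)], of i]
      Lp_norm_nonneg[OF sobolev_Lp[OF sobolev_vec_nth[OF h(1)]], of i] by (simp add: order_antisym)
  then have ae: "AE t in S. h t $ i = 0" for i
    by (rule Lp_norm_eq_0_AE[OF sobolev_Lp[OF sobolev_vec_nth[OF h(1)]]])
  then have "AE t in S. \<forall>i\<in>UNIV. h t $ i = 0" by (intro AE_finite_allI) auto
  then show "AE t in S. h t = 0" by eventually_elim (simp add: vec_eq_iff)
  assume n: "n > 0" and t: "t \<in> {a..b}"
  have "h t $ i = 0" for i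
    by (rule continuous_AE_eq[OF sobolev_continuous[OF sobolev_vec_nth[OF h(1)] n] continuous_on_const ae t])
  then show "h t = 0" by (simp add: vec_eq_iff)
qed

lemma AE_S_iff_open: "(AE t in lebesgue_on {a<..<b}. P t) \<longleftrightarrow> (AE t in S. P t)"
proof -
  have ae: "AE t in lebesgue. t \<notin> {a, b}" by (intro AE_not_in) auto
  have "(AE t in lebesgue. t \<in> {a<..<b} \<longrightarrow> P t) \<longleftrightarrow> (AE t in lebesgue. t \<in> {a..b} \<longrightarrow> P t)"
  proof
    assume "AE t in lebesgue. t \<in> {a<..<b} \<longrightarrow> P t"
    with ae show "AE t in lebesgue. t \<in> {a..b} \<longrightarrow> P t" by eventually_elim auto
  next
    assume "AE t in lebesgue. t \<in> {a..b} \<longrightarrow> P t"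
    then show "AE t in lebesgue. t \<in> {a<..<b} \<longrightarrow> P t" by eventually_elim auto
  qed
  then show ?thesis by (subst (1 2) AE_restrict_space_iff) auto
qed

lemma bvp_homogeneous_solutionI:
  assumes v: "v \<in> VW (n + r)" and h: "Lop r A v \<in> VW n" "vnrm n (Lop r A v) = 0"
    and B: "B v = 0"
  shows "bvp_solution a b p n r A B (\<lambda>t. 0) 0 v"
  unfolding bvp_solution_def
  using sobolev_vec_norm_eq_0[OF h] v B by (auto simp: AE_S_iff_open)

lemma bvp_solution_AE:
  assumes "bvp_solution a b p n r A B f c y"
  shows "y \<in> VW (n + r)" "AE t in S. Lop r A y t = f t" "B y = c"
proof -
  have "AE t in lebesgue_on {a<..<b}. Lop r A y t = f t"
    using assms by (cases "n = 0") (auto simp: bvp_solution_def intro!: AE_I2)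
  then show "AE t in S. Lop r A y t = f t" by (simp add: AE_S_iff_open)
qed (use assms in \<open>auto simp: bvp_solution_def\<close>)

lemma initial_size_diff:
  assumes "v \<in> VW (n + r)" "w \<in> VW (n + r)"
  shows "initial_size r (\<lambda>t. v t - w t)
    = (\<Sum>i\<in>UNIV. \<Sum>k<r. cmod ((D ^^ k) (\<lambda>s. v s $ i) a - (D ^^ k) (\<lambda>s. w s $ i) a))"
  unfolding initial_size_def
  using wderiv_pow_diff[OF sobolev_vec_nth[OF assms(1)] sobolev_vec_nth[OF assms(2)], of _ a] ab
  by (intro sum.cong refl) simp

text \<open>The initial values have a convergent subsequence, and the a priori estimate turns their
  convergence into convergence in the Sobolev norm.\<close>

lemma approximate_kernel_subsequence:
  fixes A :: "nat \<Rightarrow> real \<Rightarrow> complex ^ 'm ^ 'm"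
  assumes A: "\<forall>k<r. A k \<in> MW n" and v: "\<And>k. v k \<in> VW (n + r)" and v1: "\<And>k. vnrm (n + r) (v k) \<le> 1"
    and e0: "(\<lambda>k. vnrm n (Lop r A (v k))) \<longlonglongrightarrow> 0"
  obtains s u where "strict_mono s" "u \<in> VW (n + r)" "(\<lambda>k. vnrm (n + r) (\<lambda>t. v (s k) t - u t)) \<longlonglongrightarrow> 0"
    "vnrm n (Lop r A u) = 0"
proof -
  define L0 where "L0 = Lop r A"
  define e where "e k = vnrm n (L0 (v k))" for k
  have elim: "e \<longlonglongrightarrow> 0" using e0 by (simp add: e_def[abs_def] L0_def)
  have L0W: "L0 w \<in> VW n" if "w \<in> VW (n + r)" for w
    unfolding L0_def by (rule diff_op_mem_bound(1)[OF A that])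
  define X where "X x k = (D ^^ fst x) (\<lambda>t. v k t $ snd x) a" for x :: "nat \<times> 'm" and k
  have Xb: "bounded (range (X x))" if x: "x \<in> {..<r} \<times> UNIV" for x
  proof -
    obtain E where E: "E > 0" "\<And>n f t. f \<in> W (Suc n) \<Longrightarrow> t \<in> {a..b} \<Longrightarrow> cmod (f t) \<le> E * wnrm (Suc n) f"
      using sobolev_embedding by blast
    have "cmod (X x k) \<le> E" for k
    proof -
      obtain m where m: "n + r - fst x = Suc m" using x by (cases "n + r - fst x") auto
      have y: "(D ^^ fst x) (\<lambda>t. v k t $ snd x) \<in> W (Suc m)"
          "wnrm (Suc m) ((D ^^ fst x) (\<lambda>t. v k t $ snd x)) \<le> wnrm (n + r) (\<lambda>t. v k t $ snd x)"
        using wderiv_pow_mem[OF sobolev_vec_nth[OF v], of "fst x" k "snd x"] x m by auto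
      have "wnrm (Suc m) ((D ^^ fst x) (\<lambda>t. v k t $ snd x)) \<le> 1"
        using y(2) sobolev_norm_nth_le[OF v, of k "snd x"] v1[of k] by simp
      then have "E * wnrm (Suc m) ((D ^^ fst x) (\<lambda>t. v k t $ snd x)) \<le> E" using E(1) by simp
      then show ?thesis using E(2)[OF y(1), of a] ab by (simp add: X_def)
    qed
    then show ?thesis by (auto simp: bounded_iff)
  qed
  have "\<exists>s. strict_mono s \<and> (\<forall>x\<in>{..<r} \<times> UNIV. convergent (\<lambda>k. X x (s k)))"
    by (rule finite_convergent_subsequence[OF _ Xb]) auto
  then obtain s :: "nat \<Rightarrow> nat" where s: "strict_mono s"
      "\<And>x. x \<in> {..<r} \<times> UNIV \<Longrightarrow> (\<lambda>k. X x (s k)) \<longlonglongrightarrow> lim (\<lambda>k. X x (s k))"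
    by (auto simp: convergent_LIMSEQ_iff)
  define c where "c x = lim (\<lambda>k. X x (s k))" for x
  obtain M where M: "M > 0" "\<And>w. w \<in> VW (n + r) \<Longrightarrow>
      vnrm (n + r) w \<le> M * (initial_size r w + vnrm n (L0 w))"
    using a_priori[of r A n] A unfolding L0_def by blast
  define R where "R k = M * ((\<Sum>i\<in>UNIV. \<Sum>j<r. cmod (X (j, i) (s k) - c (j, i))) + e (s k))" for k
  have "R \<longlonglongrightarrow> M * ((\<Sum>i\<in>(UNIV :: 'm set). \<Sum>j<r. cmod (c (j, i) - c (j, i))) + 0)"
    unfolding R_def[abs_def]
    using s(2) LIMSEQ_subseq_LIMSEQ[OF elim s(1)]
    by (intro tendsto_intros) (auto simp: c_def o_def)
  then have Rlim: "R \<longlonglongrightarrow> 0" by simp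
  have vdiff: "vnrm (n + r) (\<lambda>t. v (s i) t - v (s j) t) \<le> R i + R j" for i j
  proof -
    let ?w = "\<lambda>t. v (s i) t - v (s j) t"
    have w: "?w \<in> VW (n + r)" by (rule sobolev_vec_diff(1)[OF v v])
    have "initial_size r ?w = (\<Sum>l\<in>UNIV. \<Sum>k<r. cmod (X (k, l) (s i) - X (k, l) (s j)))"
      by (simp add: initial_size_diff[OF v v] X_def)
    also have "\<dots> \<le> (\<Sum>l\<in>UNIV. \<Sum>k<r. cmod (X (k, l) (s i) - c (k, l)) + cmod (X (k, l) (s j) - c (k, l)))"
      by (intro sum_mono) (metis norm_minus_commute norm_triangle_ineq4 diff_diff_eq2 diff_add_cancel)
    finally have i: "initial_size r ?w \<le> (\<Sum>l\<in>UNIV. \<Sum>k<r. cmod (X (k, l) (s i) - c (k, l)))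
        + (\<Sum>l\<in>UNIV. \<Sum>k<r. cmod (X (k, l) (s j) - c (k, l)))" by (simp add: sum.distrib)
    have "vnrm n (L0 ?w) = vnrm n (\<lambda>t. L0 (v (s i)) t - L0 (v (s j)) t)"
      by (rule sobolev_vec_cong_AE[OF sobolev_vec_diff(1)[OF L0W[OF v] L0W[OF v]]])
        (use diff_op_diff_AE[OF v v, of A "s i" "s j"] in \<open>auto simp: L0_def elim!: eventually_mono\<close>)
    also have "\<dots> \<le> e (s i) + e (s j)"
      unfolding e_def by (rule sobolev_vec_diff(2)[OF L0W[OF v] L0W[OF v]])
    finally have "initial_size r ?w + vnrm n (L0 ?w) \<le> ((\<Sum>l\<in>UNIV. \<Sum>k<r. cmod (X (k, l) (s i) - c (k, l))) + e (s i))
        + ((\<Sum>l\<in>UNIV. \<Sum>k<r. cmod (X (k, l) (s j) - c (k, l))) + e (s j))" using i by linarith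
    then have "M * (initial_size r ?w + vnrm n (L0 ?w)) \<le> R i + R j"
      unfolding R_def distrib_left[symmetric] using M(1) by (intro mult_left_mono) auto
    then show ?thesis using M(2)[OF w] by linarith
  qed
  obtain u where u: "u \<in> VW (n + r)" "(\<lambda>k. vnrm (n + r) (\<lambda>t. v (s k) t - u t)) \<longlonglongrightarrow> 0"
  proof (rule sobolev_vec_complete[of "\<lambda>k. v (s k)" "n + r"])
    show "v (s k) \<in> VW (n + r)" for k by (rule v)
    fix \<eta> :: real assume "\<eta> > 0"
    then obtain K where K: "\<And>k. k \<ge> K \<Longrightarrow> \<bar>R k\<bar> < \<eta> / 2"
      using LIMSEQ_D[OF Rlim, of "\<eta> / 2"] by auto
    have "vnrm (n + r) (\<lambda>t. v (s i) t - v (s j) t) < \<eta>" if "i \<ge> K" "j \<ge> K" for i j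
      using vdiff[of i j] K[OF that(1)] K[OF that(2)] by linarith
    then show "\<exists>K. \<forall>i\<ge>K. \<forall>j\<ge>K. vnrm (n + r) (\<lambda>t. v (s i) t - v (s j) t) < \<eta>" by blast
  qed
  define \<rho> where "\<rho> k = vnrm (n + r) (\<lambda>t. v (s k) t - u t)" for k
  have \<rho>lim: "\<rho> \<longlonglongrightarrow> 0" using u(2) by (simp add: \<rho>_def[abs_def])
  have zero_if: "x = 0" if "0 \<le> x" "\<And>k. x \<le> g k" "g \<longlonglongrightarrow> 0" for x :: real and g
    using that LIMSEQ_le_const[of g 0 x] by force
  obtain K where K: "\<And>w. w \<in> VW (n + r) \<Longrightarrow> vnrm n (L0 w) \<le> K * vnrm (n + r) w"
    using diff_op_bound[of r n] A unfolding L0_def by blast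
  have "vnrm n (L0 u) = 0"
  proof (rule zero_if)
    show "0 \<le> vnrm n (L0 u)" by (rule sobolev_vec_norm_nonneg[OF L0W[OF u(1)]])
    show "vnrm n (L0 u) \<le> e (s k) + K * \<rho> k" for k
    proof -
      have "vnrm n (\<lambda>t. L0 (v (s k)) t - L0 u t) = vnrm n (L0 (\<lambda>t. v (s k) t - u t))"
        by (rule sobolev_vec_cong_AE[OF L0W[OF sobolev_vec_diff(1)[OF v u(1)]]])
          (use diff_op_diff_AE[OF v u(1), of A "s k"] in \<open>auto simp: L0_def\<close>)
      also have "\<dots> \<le> K * \<rho> k" unfolding \<rho>_def by (rule K[OF sobolev_vec_diff(1)[OF v u(1)]])
      finally show ?thesis
        using sobolev_vec_norm_triangle_sub[OF L0W[OF u(1)] L0W[OF v], of "s k"]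
          sobolev_vec_norm_minus_commute[OF L0W[OF u(1)] L0W[OF v], of "s k"] by (simp add: e_def)
    qed
    have "(\<lambda>k. e (s k) + K * \<rho> k) \<longlonglongrightarrow> 0 + K * 0"
      using LIMSEQ_subseq_LIMSEQ[OF elim s(1)] by (intro tendsto_intros \<rho>lim) (simp add: o_def)
    then show "(\<lambda>k. e (s k) + K * \<rho> k) \<longlonglongrightarrow> 0" by simp
  qed
  then show ?thesis using that[OF s(1) u] by (simp add: L0_def)
qed

text \<open>A normalised sequence violating the estimate has, by the a priori estimate, a subsequence that
  converges to a nontrivial solution of the homogeneous problem at \<open>\<mu>0\<close>.\<close>

lemma inverse_bounded_near:
  fixes A :: "real \<Rightarrow> nat \<Rightarrow> real \<Rightarrow> complex ^ 'm ^ 'm"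
    and B :: "real \<Rightarrow> (real \<Rightarrow> complex ^ 'm) \<Rightarrow> complex ^ 'k"
  assumes \<mu>0: "\<mu>0 \<in> I" and Am: "\<And>\<mu> k. \<mu> \<in> I \<Longrightarrow> k < r \<Longrightarrow> A \<mu> k \<in> MW n"
    and B: "\<And>\<mu>. \<mu> \<in> I \<Longrightarrow> continuous_linear_operator a b p (n + r) (B \<mu>)"
    and triv: "\<And>y. bvp_solution a b p n r (A \<mu>0) (B \<mu>0) (\<lambda>t. 0) 0 y \<Longrightarrow> \<forall>t\<in>{a..b}. y t = 0"
    and A: "\<And>j. j \<in> {1..r} \<Longrightarrow>
      ((\<lambda>\<mu>. mnrm n (\<lambda>t. A \<mu> (r - j) t - A \<mu>0 (r - j) t)) \<longlongrightarrow> 0) (at \<mu>0 within I)"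
    and lim: "\<And>y. y \<in> VW (n + r) \<Longrightarrow> ((\<lambda>\<mu>. B \<mu> y) \<longlongrightarrow> B \<mu>0 y) (at \<mu>0 within I)"
  shows "\<exists>\<epsilon>>0. \<exists>G>0. \<forall>\<mu>\<in>I. \<bar>\<mu> - \<mu>0\<bar> < \<epsilon> \<longrightarrow> (\<forall>w\<in>VW (n + r).
    vnrm (n + r) w \<le> G * (vnrm n (Lop r (A \<mu>) w) + norm (B \<mu> w)))"
proof (rule ccontr)
  assume neg: "\<not> ?thesis"
  define d where "d \<mu> w = vnrm n (Lop r (A \<mu>) w) + norm (B \<mu> w)" for \<mu> w
  have Am': "\<forall>k<r. A \<mu> k \<in> MW n" if "\<mu> \<in> I" for \<mu> using Am that by blast
  have DW: "Lop r (A \<mu>) w \<in> VW n" if "\<mu> \<in> I" "w \<in> VW (n + r)" for \<mu> w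
    by (rule diff_op_mem_bound(1)[OF Am'[OF that(1)] that(2)])
  have d0: "0 \<le> d \<mu> w" if "\<mu> \<in> I" "w \<in> VW (n + r)" for \<mu> w
    unfolding d_def using sobolev_vec_norm_nonneg[OF DW[OF that]] by simp
  define P where "P k z \<longleftrightarrow> fst z \<in> I \<and> \<bar>fst z - \<mu>0\<bar> < 1 / real (Suc k) \<and> snd z \<in> VW (n + r) \<and>
      vnrm (n + r) (snd z) = 1 \<and> d (fst z) (snd z) < 1 / real (Suc k)" for k z
  have "\<exists>z. P k z" for k
  proof -
    have "\<exists>\<mu>\<in>I. \<bar>\<mu> - \<mu>0\<bar> < 1 / real (Suc k) \<and> (\<exists>w\<in>VW (n + r). vnrm (n + r) w > real (Suc k) * d \<mu> w)"
    proof (rule ccontr)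
      assume "\<not> ?thesis"
      then have "\<forall>\<mu>\<in>I. \<bar>\<mu> - \<mu>0\<bar> < 1 / real (Suc k) \<longrightarrow> (\<forall>w\<in>VW (n + r). vnrm (n + r) w \<le> real (Suc k) * d \<mu> w)"
        by (auto simp: not_less)
      moreover have "1 / real (Suc k) > 0" "real (Suc k) > 0" by simp_all
      ultimately show False using neg unfolding d_def by blast
    qed
    then obtain \<mu> w where \<mu>: "\<mu> \<in> I" "\<bar>\<mu> - \<mu>0\<bar> < 1 / real (Suc k)" and w: "w \<in> VW (n + r)"
      and gt: "vnrm (n + r) w > real (Suc k) * d \<mu> w" by blast
    have pos: "vnrm (n + r) w > 0" using gt d0[OF \<mu>(1) w] by (smt (verit) mult_nonneg_nonneg of_nat_0_le_iff)
    define s where "s = complex_of_real (1 / vnrm (n + r) w)"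
    have cs: "cmod s = 1 / vnrm (n + r) w" using pos unfolding s_def norm_of_real by simp
    define v where "v t = s *s w t" for t
    have v: "v \<in> VW (n + r)" unfolding v_def[abs_def] by (rule sobolev_vec_cmult(1)[OF w])
    have v1: "vnrm (n + r) v = 1"
      unfolding v_def[abs_def] sobolev_vec_cmult(2)[OF w] cs using pos by simp
    have "vnrm n (Lop r (A \<mu>) v) = vnrm n (\<lambda>t. s *s Lop r (A \<mu>) w t)"
      unfolding v_def[abs_def]
      by (rule sobolev_vec_cong_AE[OF sobolev_vec_cmult(1)[OF DW[OF \<mu>(1) w]]])
        (use diff_op_cmult_AE[OF w, of "A \<mu>" s] in \<open>auto elim!: eventually_mono\<close>)
    then have "d \<mu> v = cmod s * d \<mu> w"
      unfolding d_def using continuous_linear_operator_cmult[OF B[OF \<mu>(1)] w, of s]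
      by (simp add: v_def[abs_def] sobolev_vec_cmult(2)[OF DW[OF \<mu>(1) w]] norm_vec_cmult distrib_left)
    also have "\<dots> < 1 / real (Suc k)" unfolding cs using gt pos by (simp add: field_simps)
    finally have "P k (\<mu>, v)" using \<mu> v v1 by (simp add: P_def)
    then show ?thesis ..
  qed
  then obtain Z where "\<forall>k. P k (Z k)" using choice[of P] by blast
  then have Z: "\<And>k. fst (Z k) \<in> I" "\<And>k. \<bar>fst (Z k) - \<mu>0\<bar> < 1 / real (Suc k)" "\<And>k. snd (Z k) \<in> VW (n + r)"
      "\<And>k. vnrm (n + r) (snd (Z k)) = 1" "\<And>k. d (fst (Z k)) (snd (Z k)) < 1 / real (Suc k)"
    unfolding P_def by blast+
  define \<mu> where "\<mu> k = fst (Z k)" for k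
  define v where "v k = snd (Z k)" for k
  note Z' = Z[folded \<mu>_def v_def]
  have \<mu>lim: "\<mu> \<longlonglongrightarrow> \<mu>0" by (rule tendsto_parameter) (rule Z'(2))
  have dlim: "(\<lambda>k. d (\<mu> k) (v k)) \<longlonglongrightarrow> 0"
    by (rule Lim_null_comparison[OF _ LIMSEQ_Suc[OF lim_1_over_n]])
      (use Z'(5) d0[OF Z'(1,3)] in \<open>auto intro!: always_eventually less_imp_le\<close>)
  define L0 where "L0 = Lop r (A \<mu>0)"
  define e where "e k = vnrm n (L0 (v k))" for k
  have L0W: "L0 w \<in> VW n" if "w \<in> VW (n + r)" for w unfolding L0_def by (rule DW[OF \<mu>0 that])
  have elim: "e \<longlonglongrightarrow> 0"
  proof -
    obtain C where C: "C > 0" "\<And>(A :: nat \<Rightarrow> real \<Rightarrow> complex ^ 'm ^ 'm) A' w. (\<forall>k<r. A k \<in> MW n) \<Longrightarrow> (\<forall>k<r. A' k \<in> MW n) \<Longrightarrow>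
      w \<in> VW (n + r) \<Longrightarrow> vnrm n (\<lambda>t. Lop r A w t - Lop r A' w t)
        \<le> C * (\<Sum>k<r. mnrm n (\<lambda>t. A k t - A' k t)) * vnrm (n + r) w"
      using diff_op_coefficients_bound[of r n] by blast
    define s where "s \<mu> = (\<Sum>k<r. mnrm n (\<lambda>t. A \<mu> k t - A \<mu>0 k t))" for \<mu>
    have "(s \<longlongrightarrow> s \<mu>0) (at \<mu>0 within I)" unfolding s_def by (rule sobolev_mat_norm_sum_tendsto[where A=A and r=r]) (rule A)
    then have "(\<lambda>k. s (\<mu> k)) \<longlonglongrightarrow> s \<mu>0" by (rule sequentially_within[OF _ Z'(1) \<mu>lim])
    moreover have "s \<mu>0 = 0" unfolding s_def by (rule sobolev_mat_norm_sum_self)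
    ultimately have slim: "(\<lambda>k. s (\<mu> k)) \<longlonglongrightarrow> 0" by simp
    have le: "e k \<le> d (\<mu> k) (v k) + C * s (\<mu> k)" for k
    proof -
      have "vnrm n (\<lambda>t. Lop r (A (\<mu> k)) (v k) t - L0 (v k) t) \<le> C * s (\<mu> k) * vnrm (n + r) (v k)"
        unfolding L0_def s_def by (rule C(2)[OF Am'[OF Z'(1)] Am'[OF \<mu>0] Z'(3)])
      then show ?thesis
        using sobolev_vec_norm_triangle_sub[OF L0W[OF Z'(3)] DW[OF Z'(1,3)], of k k k]
          sobolev_vec_norm_minus_commute[OF L0W[OF Z'(3)] DW[OF Z'(1,3)], of k k k] Z'(4)[of k]
        by (simp add: d_def e_def) (smt (verit) norm_ge_zero)
    qed
    have "(\<lambda>k. d (\<mu> k) (v k) + C * s (\<mu> k)) \<longlonglongrightarrow> 0 + C * 0" by (intro tendsto_intros dlim slim)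
    then have "(\<lambda>k. d (\<mu> k) (v k) + C * s (\<mu> k)) \<longlonglongrightarrow> 0" by simp
    then show ?thesis
      by (rule Lim_null_comparison[rotated])
        (use le sobolev_vec_norm_nonneg[OF L0W[OF Z'(3)]] in \<open>auto simp: e_def intro!: always_eventually\<close>)
  qed
  obtain s u where s: "strict_mono s" and u: "u \<in> VW (n + r)" "(\<lambda>k. vnrm (n + r) (\<lambda>t. v (s k) t - u t)) \<longlonglongrightarrow> 0"
      "vnrm n (L0 u) = 0"
    by (rule approximate_kernel_subsequence[OF Am'[OF \<mu>0] Z'(3) eq_refl[OF Z'(4)]])
      (use elim in \<open>auto simp: e_def[abs_def] L0_def\<close>)
  define \<rho> where "\<rho> k = vnrm (n + r) (\<lambda>t. v (s k) t - u t)" for k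
  have \<rho>lim: "\<rho> \<longlonglongrightarrow> 0" using u(2) by (simp add: \<rho>_def[abs_def])
  have "1 \<le> vnrm (n + r) u + \<rho> k" for k
    using sobolev_vec_norm_triangle_sub[OF Z'(3) u(1), of "s k"] Z'(4)[of "s k"] by (simp add: \<rho>_def)
  moreover have "(\<lambda>k. vnrm (n + r) u + \<rho> k) \<longlonglongrightarrow> vnrm (n + r) u + 0" by (intro tendsto_intros \<rho>lim)
  ultimately have u1: "1 \<le> vnrm (n + r) u" using LIMSEQ_le_const by fastforce
  have "B \<mu>0 u = 0"
  proof -
    obtain \<epsilon> C where \<epsilon>: "\<epsilon> > 0" "C > 0"
      "\<And>\<mu> y. \<mu> \<in> I \<Longrightarrow> \<bar>\<mu> - \<mu>0\<bar> < \<epsilon> \<Longrightarrow> y \<in> VW (n + r) \<Longrightarrow> norm (B \<mu> y) \<le> C * vnrm (n + r) y"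
      using operators_bounded_near[of I "n + r" B \<mu>0, OF B lim] by blast
    have m: "(\<lambda>k. \<mu> (s k)) \<longlonglongrightarrow> \<mu>0" using LIMSEQ_subseq_LIMSEQ[OF \<mu>lim s] by (simp add: o_def)
    have ev: "\<forall>\<^sub>F k in sequentially. \<bar>\<mu> (s k) - \<mu>0\<bar> < \<epsilon>"
      using tendstoD[OF m \<epsilon>(1)] by (simp add: dist_real_def)
    have "\<forall>\<^sub>F k in sequentially. norm (B (\<mu> (s k)) u) \<le> d (\<mu> (s k)) (v (s k)) + C * \<rho> k"
      using ev
    proof eventually_elim
      case (elim k)
      have w: "(\<lambda>t. v (s k) t - u t) \<in> VW (n + r)" by (rule sobolev_vec_diff(1)[OF Z'(3) u(1)])
      have "norm (B (\<mu> (s k)) (v (s k)) - B (\<mu> (s k)) u) \<le> C * \<rho> k"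
        using \<epsilon>(3)[OF Z'(1) elim w] continuous_linear_operator_diff[OF B[OF Z'(1)] Z'(3) u(1)]
        by (simp add: \<rho>_def)
      moreover have "norm (B (\<mu> (s k)) (v (s k))) \<le> d (\<mu> (s k)) (v (s k))"
        unfolding d_def using sobolev_vec_norm_nonneg[OF DW[OF Z'(1) Z'(3)]] by simp
      ultimately show ?case
        using norm_triangle_sub[of "B (\<mu> (s k)) u" "B (\<mu> (s k)) (v (s k))"]
        by (simp add: norm_minus_commute)
    qed
    moreover have "(\<lambda>k. d (\<mu> (s k)) (v (s k)) + C * \<rho> k) \<longlonglongrightarrow> 0"
    proof -
      have "(\<lambda>k. d (\<mu> (s k)) (v (s k)) + C * \<rho> k) \<longlonglongrightarrow> 0 + C * 0"
        using LIMSEQ_subseq_LIMSEQ[OF dlim s] by (intro tendsto_intros \<rho>lim) (simp add: o_def)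
      then show ?thesis by simp
    qed
    ultimately have "(\<lambda>k. B (\<mu> (s k)) u) \<longlonglongrightarrow> 0" by (rule Lim_null_comparison)
    moreover have "(\<lambda>k. B (\<mu> (s k)) u) \<longlonglongrightarrow> B \<mu>0 u"
      by (rule sequentially_within[of "\<lambda>\<mu>. B \<mu> u", OF lim[OF u(1)] Z'(1) m])
    ultimately show ?thesis using LIMSEQ_unique by blast
  qed
  with u(3) have "bvp_solution a b p n r (A \<mu>0) (B \<mu>0) (\<lambda>t. 0) 0 u"
    using u(1) L0W[OF u(1)] unfolding L0_def by (intro bvp_homogeneous_solutionI)
  then have "\<forall>t\<in>{a..b}. u t = 0" by (rule triv)
  then have "AE t in S. (0 :: complex ^ 'm) = u t" by (intro AE_I2) simp
  from sobolev_vec_cong_AE[OF sobolev_vec_zero(1) this, of "n + r"]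
  have "vnrm (n + r) u = 0" by (simp add: sobolev_vec_zero(2))
  then show False using u1 by simp
qed

end

theorem theorem3p5:
  fixes a b \<mu>0 :: real and p :: ennreal and n r :: nat and I :: "real set"
    and A :: "real \<Rightarrow> nat \<Rightarrow> real \<Rightarrow> complex ^ 'm ^ 'm"
    and B :: "real \<Rightarrow> (real \<Rightarrow> complex ^ 'm) \<Rightarrow> complex ^ 'k"
    and N :: "complex ^ 'k \<Rightarrow> real"
  assumes "a < b" and "r \<ge> 1" and "CARD('k) = r * CARD('m)" and "1 \<le> p"
    and "is_norm N"
    and "closed I" and "is_interval I" and "\<mu>0 \<in> I"
    and "\<And>\<mu> k. \<mu> \<in> I \<Longrightarrow> k < r \<Longrightarrow> A \<mu> k \<in> sobolev_mat a b p n"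
    and "\<And>\<mu>. \<mu> \<in> I \<Longrightarrow> continuous_linear_operator a b p (n + r) (B \<mu>)"
    and "\<And>y. bvp_solution a b p n r (A \<mu>0) (B \<mu>0) (\<lambda>t. 0) 0 y \<Longrightarrow> \<forall>t\<in>{a..b}. y t = 0"
    and "\<And>j. j \<in> {1..r} \<Longrightarrow>
      ((\<lambda>\<mu>. sobolev_mat_norm a b p n (\<lambda>t. A \<mu> (r - j) t - A \<mu>0 (r - j) t)) \<longlongrightarrow> 0)
        (at \<mu>0 within I)"
    and "\<And>y. y \<in> sobolev_vec a b p (n + r) \<Longrightarrow>
      ((\<lambda>\<mu>. B \<mu> y) \<longlongrightarrow> B \<mu>0 y) (at \<mu>0 within I)"
  shows "\<exists>\<epsilon> \<gamma>1 \<gamma>2. \<epsilon> > 0 \<and> \<gamma>1 > 0 \<and> \<gamma>2 > 0 \<and>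
    (\<forall>(f :: real \<Rightarrow> real \<Rightarrow> complex ^ 'm) (c :: real \<Rightarrow> complex ^ 'k).
      (\<forall>\<mu>\<in>I. f \<mu> \<in> sobolev_vec a b p n) \<longrightarrow>
      (\<forall>\<mu>\<in>I \<inter> {\<mu>0 - \<epsilon><..<\<mu>0 + \<epsilon>}. \<forall>y0 y.
        bvp_solution a b p n r (A \<mu>0) (B \<mu>0) (f \<mu>0) (c \<mu>0) y0 \<longrightarrow>
        bvp_solution a b p n r (A \<mu>) (B \<mu>) (f \<mu>) (c \<mu>) y \<longrightarrow>
        (let d = sobolev_vec_norm a b p n (\<lambda>t. diff_op a b r (A \<mu>) y0 t - f \<mu> t)
               + N (B \<mu> y0 - c \<mu>)
         in \<gamma>1 * d \<le> sobolev_vec_norm a b p (n + r) (\<lambda>t. y0 t - y t) \<and>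
            sobolev_vec_norm a b p (n + r) (\<lambda>t. y0 t - y t) \<le> \<gamma>2 * d)))"
proof -
  interpret sobolev_interval a b p using assms(1,4) by unfold_locales
  note Am = assms(9) and Bc = assms(10)
  obtain \<epsilon>1 C where C: "\<epsilon>1 > 0" "C > 0"
    "\<And>\<mu> w. \<mu> \<in> I \<Longrightarrow> \<bar>\<mu> - \<mu>0\<bar> < \<epsilon>1 \<Longrightarrow> w \<in> VW (n + r) \<Longrightarrow> norm (B \<mu> w) \<le> C * vnrm (n + r) w"
    using operators_bounded_near[of I "n + r" B \<mu>0, OF assms(10,13)] by blast
  obtain \<epsilon>2 K where K: "\<epsilon>2 > 0" "K > 0"
    "\<And>\<mu> w. \<mu> \<in> I \<Longrightarrow> \<bar>\<mu> - \<mu>0\<bar> < \<epsilon>2 \<Longrightarrow> w \<in> VW (n + r) \<Longrightarrow>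
      vnrm n (Lop r (A \<mu>) w) \<le> K * vnrm (n + r) w"
    using diff_op_bounded_near[of \<mu>0 I r A n, OF assms(8,9,12)] by blast
  obtain \<epsilon>3 G where G: "\<epsilon>3 > 0" "G > 0"
    "\<And>\<mu> w. \<mu> \<in> I \<Longrightarrow> \<bar>\<mu> - \<mu>0\<bar> < \<epsilon>3 \<Longrightarrow> w \<in> VW (n + r) \<Longrightarrow>
      vnrm (n + r) w \<le> G * (vnrm n (Lop r (A \<mu>) w) + norm (B \<mu> w))"
    using inverse_bounded_near[of \<mu>0 I r A n B, OF assms(8-13)] by blast
  obtain c1 where c1: "c1 > 0" "\<And>x. N x \<le> c1 * norm x" using is_norm_equivalent(1)[OF assms(5)] by blast
  obtain c2 where c2: "c2 > 0" "\<And>x. norm x \<le> c2 * N x" using is_norm_equivalent(2)[OF assms(5)] by blast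
  have N0: "0 \<le> N x" for x using assms(5) by (simp add: is_norm_def)
  define \<epsilon> where "\<epsilon> = min \<epsilon>1 (min \<epsilon>2 \<epsilon>3)"
  show ?thesis
  proof (intro exI conjI allI impI ballI)
    show "\<epsilon> > 0" using C K G by (simp add: \<epsilon>_def)
    show "1 / (K + c1 * C) > 0" using C K c1 by (simp add: add_pos_pos)
    show "G * (1 + c2) > 0" using G c2 by simp
    fix f :: "real \<Rightarrow> real \<Rightarrow> complex ^ 'm" and c :: "real \<Rightarrow> complex ^ 'k" and \<mu> y0 y
    assume \<mu>: "\<mu> \<in> I \<inter> {\<mu>0 - \<epsilon><..<\<mu>0 + \<epsilon>}"
      and y0: "bvp_solution a b p n r (A \<mu>0) (B \<mu>0) (f \<mu>0) (c \<mu>0) y0"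
      and y: "bvp_solution a b p n r (A \<mu>) (B \<mu>) (f \<mu>) (c \<mu>) y"
    have \<mu>I: "\<mu> \<in> I" and near: "\<bar>\<mu> - \<mu>0\<bar> < \<epsilon>1" "\<bar>\<mu> - \<mu>0\<bar> < \<epsilon>2" "\<bar>\<mu> - \<mu>0\<bar> < \<epsilon>3"
      using \<mu> by (auto simp: \<epsilon>_def abs_less_iff)
    note Y0 = bvp_solution_AE[OF y0] and Y = bvp_solution_AE[OF y]
    define w where "w t = y0 t - y t" for t
    have w: "w \<in> VW (n + r)" unfolding w_def[abs_def] by (rule sobolev_vec_diff(1)[OF Y0(1) Y(1)])
    have Dw: "Lop r (A \<mu>) w \<in> VW n" using diff_op_bound[of r n] Am[OF \<mu>I] w by blast
    have "AE t in S. Lop r (A \<mu>) w t = Lop r (A \<mu>) y0 t - f \<mu> t"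
      using diff_op_diff_AE[OF Y0(1) Y(1), of "A \<mu>"] Y(2)
      by eventually_elim (simp add: w_def[abs_def])
    then have d1: "vnrm n (\<lambda>t. Lop r (A \<mu>) y0 t - f \<mu> t) = vnrm n (Lop r (A \<mu>) w)"
      by (rule sobolev_vec_cong_AE[OF Dw])
    have d2: "B \<mu> y0 - c \<mu> = B \<mu> w"
      using continuous_linear_operator_diff[OF Bc[OF \<mu>I] Y0(1) Y(1)] Y(3) by (simp add: w_def[abs_def])
    have v0: "0 \<le> vnrm n (Lop r (A \<mu>) w)" by (rule sobolev_vec_norm_nonneg[OF Dw])
    have "N (B \<mu> w) \<le> c1 * (C * vnrm (n + r) w)"
      using c1(2)[of "B \<mu> w"] mult_left_mono[OF C(3)[OF \<mu>I near(1) w], of c1] c1(1) by linarith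
    then have "vnrm n (Lop r (A \<mu>) w) + N (B \<mu> w) \<le> (K + c1 * C) * vnrm (n + r) w"
      using K(3)[OF \<mu>I near(2) w] by (simp add: distrib_right mult.assoc)
    moreover have "K + c1 * C > 0" using C K c1 by (simp add: add_pos_pos)
    ultimately have lower: "1 / (K + c1 * C) * (vnrm n (Lop r (A \<mu>) w) + N (B \<mu> w)) \<le> vnrm (n + r) w"
      by (simp add: pos_divide_le_eq mult.commute)
    have "vnrm n (Lop r (A \<mu>) w) + norm (B \<mu> w)
        \<le> (1 + c2) * (vnrm n (Lop r (A \<mu>) w) + N (B \<mu> w))"
      using c2(2)[of "B \<mu> w"] mult_nonneg_nonneg[OF less_imp_le[OF c2(1)] v0] N0[of "B \<mu> w"]
      by (simp add: distrib_right distrib_left)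
    then have "G * (vnrm n (Lop r (A \<mu>) w) + norm (B \<mu> w))
        \<le> G * ((1 + c2) * (vnrm n (Lop r (A \<mu>) w) + N (B \<mu> w)))"
      using G(2) by (intro mult_left_mono) auto
    then have upper: "vnrm (n + r) w \<le> G * (1 + c2) * (vnrm n (Lop r (A \<mu>) w) + N (B \<mu> w))"
      using G(3)[OF \<mu>I near(3) w] by (simp add: mult.assoc)
    show "let d = vnrm n (\<lambda>t. Lop r (A \<mu>) y0 t - f \<mu> t) + N (B \<mu> y0 - c \<mu>)
        in 1 / (K + c1 * C) * d \<le> vnrm (n + r) (\<lambda>t. y0 t - y t) \<and>
          vnrm (n + r) (\<lambda>t. y0 t - y t) \<le> G * (1 + c2) * d"
      unfolding Let_def d1 d2 using lower upper by (simp add: w_def[abs_def])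
  qed
qed


end
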